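(* In asynchronous message-passing systems with $n$ nodes and at most $f<n/2$ crash failures, there exists an implementation of linearizable update/query state machines such that each command takes $O(\sqrt{k})$ message delays and $O(1)$ message size overhead, where $k$ is the actual number of crash failures in the system.
   Context: Model: asynchronous message-passing system with $n$ nodes, at most $f<n/2$ of which may crash ($k\le f$ is the number that actually crash in the execution); reliable FIFO channels between every pair of nodes (a message whose send command is completed is eventually delivered if the receiver has not crashed, and messages from $i$ to $j$ are delivered in sending order). Each node executes its operations sequentially. Local computation time is negligible. If $D$ is the maximum delay of messages between nonfaulty nodes in an execution, a command takes at most $c$ message delays if it completes within time $cD$. An update/query state machine is a replicated state machine supporting only two kinds of commands: updates (which modify the state and return only an acknowledgement) and queries (which return information on the state and do not modify it); there are no mixed update-and-query commands, and all updates commute. An implementation is linearizable if for each execution there is a total order of all commands that respects real-time order (a command that completes before another starts precedes it) and in which each query's response is the one obtained by applying all updates preceding it in the order. $O(1)$ message size overhead means that, if each command has size $O(1)$, then each message in the implementation has size $O(1)$. *)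

theory Defs
  imports Complex_Main
begin

section \<open>Update/query state machines\<close>

datatype ('u, 'q) command = Update 'u | Query 'q

datatype 'r response = Ack | Result 'r

record ('s, 'u, 'q, 'r) state_machine =
  init_state :: 's
  apply_update :: "'u \<Rightarrow> 's \<Rightarrow> 's"
  answer :: "'q \<Rightarrow> 's \<Rightarrow> 'r"

text \<open>
  By the shape of the record, updates return no information and queries leave the state unchanged;
  what remains to be required is that updates commute.
\<close>

definition update_query_state_machine :: "('s, 'u, 'q, 'r) state_machine \<Rightarrow> bool" where
  "update_query_state_machine M \<longleftrightarrow>
     (\<forall>u v s. apply_update M u (apply_update M v s) = apply_update M v (apply_update M u s))"


section \<open>Protocols\<close>

text \<open>
  The wire format: a message is a string of bits and embedded commands. Everything that is not a
  command (node identifiers, counters, tags, ...) has to be written out in bits and is charged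
  accordingly.
\<close>

datatype ('u, 'q) letter = Bit bool | Cmd "('u, 'q) command"

type_synonym ('u, 'q) message = "('u, 'q) letter list"

definition message_size :: "(('u, 'q) command \<Rightarrow> nat) \<Rightarrow> ('u, 'q) message \<Rightarrow> nat" where
  "message_size sz m = sum_list (map (case_letter (\<lambda>_. 1) sz) m)"

datatype ('u, 'q) local_event = Invocation "('u, 'q) command" | Receipt nat "('u, 'q) message"

datatype ('u, 'q, 'r) action = Send nat "('u, 'q) message" | Respond "'r response"

text \<open>
  A deterministic event-driven protocol: the value of \<open>P i h\<close> is the sequence of actions that node
  \<open>i\<close> executes upon the last event of its local history \<open>h\<close>. As the history determines everything
  that a node can know, it plays the role of an arbitrary local state. In \<open>Receipt j m\<close> and
  \<open>Send j m\<close>, \<open>j\<close> is the sender and the receiver, respectively. Nodes have no clocks.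
\<close>

type_synonym ('u, 'q, 'r) protocol =
  "nat \<Rightarrow> ('u, 'q) local_event list \<Rightarrow> ('u, 'q, 'r) action list"


section \<open>Asynchronous executions with crash failures\<close>

datatype ('u, 'q) trigger = Invoked "('u, 'q) command" | Received nat

text \<open>
  In \<open>Step i e stop\<close>, node \<open>i\<close> reacts to \<open>e\<close>, where \<open>Received j\<close> is the receipt of the next message
  in the channel from \<open>j\<close>. If \<open>stop = None\<close>, all actions prescribed by the protocol are executed; if
  \<open>stop = Some m\<close>, the node crashes during the step and only the first \<open>m\<close> actions are completed.
\<close>

datatype ('u, 'q) event = Step nat "('u, 'q) trigger" "nat option" | Crash nat | Idle

text \<open>
  Nodes are the numbers below \<open>n\<close>. The event at position \<open>t\<close> of an execution happens at real time
  \<open>time E t\<close>. Local computation is instantaneous, several events may happen at the same time, and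
  finite executions are padded with \<open>Idle\<close>.
\<close>

record ('u, 'q) execution =
  event :: "nat \<Rightarrow> ('u, 'q) event"
  time :: "nat \<Rightarrow> real"

text \<open>
  A command is identified with the position of its invocation in the execution. \<open>channel c i j\<close> is
  the queue of messages in transit from \<open>i\<close> to \<open>j\<close>, each with the time at which it was sent;
  \<open>pending c i\<close> is the command that \<open>i\<close> is currently executing; \<open>responses c a = Some (t, r)\<close> means
  that command \<open>a\<close> completed at position \<open>t\<close> with response \<open>r\<close>.
\<close>

record ('u, 'q, 'r) config =
  history :: "nat \<Rightarrow> ('u, 'q) local_event list"
  channel :: "nat \<Rightarrow> nat \<Rightarrow> (('u, 'q) message \<times> real) list"
  crashed :: "nat set"
  pending :: "nat \<Rightarrow> nat option"
  responses :: "nat \<Rightarrow> (nat \<times> 'r response) option"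

definition initial_config :: "('u, 'q, 'r) config" where
  "initial_config =
     \<lparr>history = (\<lambda>_. []), channel = (\<lambda>_ _. []), crashed = {},
      pending = (\<lambda>_. None), responses = (\<lambda>_. None)\<rparr>"

text \<open>A response given while no command is pending has no effect.\<close>

fun perform ::
  "nat \<Rightarrow> real \<Rightarrow> nat \<Rightarrow> ('u, 'q, 'r) action \<Rightarrow> ('u, 'q, 'r) config \<Rightarrow> ('u, 'q, 'r) config" where
  "perform t now i (Send j m) c =
     c\<lparr>channel := (channel c)(i := (channel c i)(j := channel c i j @ [(m, now)]))\<rparr>"
| "perform t now i (Respond r) c =
     (case pending c i of
        None \<Rightarrow> c
      | Some a \<Rightarrow> c\<lparr>pending := (pending c)(i := None),
                   responses := (responses c)(a := Some (t, r))\<rparr>)"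

fun observe ::
  "nat \<Rightarrow> nat \<Rightarrow> ('u, 'q) trigger \<Rightarrow> ('u, 'q, 'r) config \<Rightarrow> ('u, 'q, 'r) config" where
  "observe t i (Invoked x) c =
     c\<lparr>history := (history c)(i := history c i @ [Invocation x]),
       pending := (pending c)(i := Some t)\<rparr>"
| "observe t i (Received j) c =
     c\<lparr>history := (history c)(i := history c i @ [Receipt j (fst (hd (channel c j i)))]),
       channel := (channel c)(j := (channel c j)(i := tl (channel c j i)))\<rparr>"

fun next_config ::
  "('u, 'q, 'r) protocol \<Rightarrow> nat \<Rightarrow> real \<Rightarrow> ('u, 'q) event
     \<Rightarrow> ('u, 'q, 'r) config \<Rightarrow> ('u, 'q, 'r) config" where
  "next_config P t now (Step i e stop) c =
     (let c' = observe t i e c; actions = P i (history c' i)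
      in case stop of
           None \<Rightarrow> fold (perform t now i) actions c'
         | Some m \<Rightarrow>
             (fold (perform t now i) (take m actions) c')\<lparr>crashed := insert i (crashed c)\<rparr>)"
| "next_config P t now (Crash i) c = c\<lparr>crashed := insert i (crashed c)\<rparr>"
| "next_config P t now Idle c = c"

primrec config_at ::
  "('u, 'q, 'r) protocol \<Rightarrow> ('u, 'q) execution \<Rightarrow> nat \<Rightarrow> ('u, 'q, 'r) config" where
  "config_at P E 0 = initial_config"
| "config_at P E (Suc t) = next_config P t (time E t) (event E t) (config_at P E t)"

text \<open>Each node executes its commands sequentially: it is idle when a command is invoked.\<close>

fun enabled :: "nat \<Rightarrow> ('u, 'q, 'r) config \<Rightarrow> ('u, 'q) event \<Rightarrow> bool" where
  "enabled n c (Step i (Invoked x) stop) \<longleftrightarrow> i < n \<and> i \<notin> crashed c \<and> pending c i = None"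
| "enabled n c (Step i (Received j) stop) \<longleftrightarrow>
     i < n \<and> i \<notin> crashed c \<and> j < n \<and> j \<noteq> i \<and> channel c j i \<noteq> []"
| "enabled n c (Crash i) \<longleftrightarrow> i < n \<and> i \<notin> crashed c"
| "enabled n c Idle \<longleftrightarrow> True"

definition faulty :: "('u, 'q) execution \<Rightarrow> nat set" where
  "faulty E = {i. \<exists>t. event E t = Crash i \<or> (\<exists>e m. event E t = Step i e (Some m))}"

text \<open>
  The last condition is reliability of the channels. As channels are queues, it is enough to require
  that a non-empty channel to a nonfaulty node eventually delivers its first message. It does not
  depend on whether the sender crashes after the send.
\<close>

definition is_execution ::
  "nat \<Rightarrow> nat \<Rightarrow> ('u, 'q, 'r) protocol \<Rightarrow> ('u, 'q) execution \<Rightarrow> bool" where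
  "is_execution n f P E \<longleftrightarrow>
     (\<forall>t. enabled n (config_at P E t) (event E t)) \<and>
     mono (time E) \<and>
     card (faulty E) \<le> f \<and>
     (\<forall>i j t. i < n \<and> j < n \<and> i \<noteq> j \<and> j \<notin> faulty E \<and> channel (config_at P E t) i j \<noteq> [] \<longrightarrow>
        (\<exists>t'\<ge>t. event E t' = Step j (Received i) None))"

definition sent_messages ::
  "('u, 'q, 'r) protocol \<Rightarrow> ('u, 'q) execution \<Rightarrow> ('u, 'q) message set" where
  "sent_messages P E = {m. \<exists>t i j s. (m, s) \<in> set (channel (config_at P E t) i j)}"

definition nonfaulty_delays :: "('u, 'q, 'r) protocol \<Rightarrow> ('u, 'q) execution \<Rightarrow> real set" where
  "nonfaulty_delays P E =
     {time E t - snd (hd (channel (config_at P E t) i j)) | i j t.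
        i \<notin> faulty E \<and> j \<notin> faulty E \<and> event E t = Step j (Received i) None}"

definition invoked :: "('u, 'q) execution \<Rightarrow> nat \<Rightarrow> (nat \<times> ('u, 'q) command) option" where
  "invoked E t = (case event E t of Step i (Invoked x) stop \<Rightarrow> Some (i, x) | _ \<Rightarrow> None)"

definition completes ::
  "('u, 'q, 'r) protocol \<Rightarrow> ('u, 'q) execution \<Rightarrow> nat \<Rightarrow> nat \<Rightarrow> 'r response \<Rightarrow> bool" where
  "completes P E a t r \<longleftrightarrow> (\<exists>t'. responses (config_at P E t') a = Some (t, r))"


section \<open>Linearizability\<close>

definition commands :: "('u, 'q) execution \<Rightarrow> nat set" where
  "commands E = dom (invoked E)"

definition precedes :: "('u, 'q, 'r) protocol \<Rightarrow> ('u, 'q) execution \<Rightarrow> nat \<Rightarrow> nat \<Rightarrow> bool" where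
  "precedes P E a b \<longleftrightarrow> (\<exists>t r. completes P E a t r \<and> t < b)"

definition updates_before ::
  "('u, 'q) execution \<Rightarrow> (nat \<times> nat) set \<Rightarrow> nat \<Rightarrow> nat set" where
  "updates_before E R a = {b. (b, a) \<in> R \<and> (\<exists>i u. invoked E b = Some (i, Update u))}"

definition apply_command ::
  "('s, 'u, 'q, 'r) state_machine \<Rightarrow> ('u, 'q) execution \<Rightarrow> nat \<Rightarrow> 's \<Rightarrow> 's" where
  "apply_command M E a s =
     (case invoked E a of Some (i, Update u) \<Rightarrow> apply_update M u s | _ \<Rightarrow> s)"

text \<open>
  The order \<open>R\<close> is a strict total order on all invoked commands. It need not be of order type omega:
  updates that never complete and that no query observes can be put at the end, even if the
  execution is infinite. The existence of the list \<open>bs\<close> entails that only finitely many updates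
  precede a completed query.
\<close>

definition linearizable ::
  "('s, 'u, 'q, 'r) state_machine \<Rightarrow> ('u, 'q, 'r) protocol \<Rightarrow> ('u, 'q) execution \<Rightarrow> bool" where
  "linearizable M P E \<longleftrightarrow>
     (\<exists>R. R \<subseteq> commands E \<times> commands E \<and> trans R \<and> irrefl R \<and> total_on (commands E) R \<and>
        (\<forall>a\<in>commands E. \<forall>b\<in>commands E. precedes P E a b \<longrightarrow> (a, b) \<in> R) \<and>
        (\<forall>a i u t r. invoked E a = Some (i, Update u) \<and> completes P E a t r \<longrightarrow> r = Ack) \<and>
        (\<forall>a i q t r. invoked E a = Some (i, Query q) \<and> completes P E a t r \<longrightarrow>
           (\<exists>bs. distinct bs \<and> set bs = updates_before E R a \<and> sorted_wrt (\<lambda>b b'. (b, b') \<in> R) bs \<and>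
              r = Result (answer M q (fold (apply_command M E) bs (init_state M))))))"

definition linearizable_implementation ::
  "nat \<Rightarrow> nat \<Rightarrow> ('s, 'u, 'q, 'r) state_machine \<Rightarrow> ('u, 'q, 'r) protocol \<Rightarrow> bool" where
  "linearizable_implementation n f M P \<longleftrightarrow> (\<forall>E. is_execution n f P E \<longrightarrow> linearizable M P E)"


section \<open>Complexity\<close>

text \<open>
  A set of delays need not have a maximum, so \<open>D\<close> ranges over all nonnegative upper bounds; the claim
  for the maximum implies the claim for every upper bound. Running times are only
  meaningful for commands invoked at nonfaulty nodes.
\<close>

definition takes_message_delays ::
  "('u, 'q, 'r) protocol \<Rightarrow> ('u, 'q) execution \<Rightarrow> nat \<Rightarrow> real \<Rightarrow> bool" where
  "takes_message_delays P E a c \<longleftrightarrow>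
     (\<forall>D\<ge>0. (\<forall>d\<in>nonfaulty_delays P E. d \<le> D) \<longrightarrow>
        (\<exists>t r. completes P E a t r \<and> time E t - time E a \<le> c * D))"

text \<open>The latency bound may depend on the number of nodes that actually crash in the execution.\<close>

definition command_latency ::
  "nat \<Rightarrow> nat \<Rightarrow> ('u, 'q, 'r) protocol \<Rightarrow> (nat \<Rightarrow> real) \<Rightarrow> bool" where
  "command_latency n f P g \<longleftrightarrow>
     (\<forall>E a i x. is_execution n f P E \<and> invoked E a = Some (i, x) \<and> i \<notin> faulty E \<longrightarrow>
        takes_message_delays P E a (g (card (faulty E))))"

text \<open>
  Whenever the commands invoked in an execution have size at most \<open>s\<close>, the messages have size at
  most \<open>b s\<close>. The size measure is arbitrary on commands that are not invoked, so a protocol cannot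
  use made-up commands as cheap carriers of information.
\<close>

definition message_size_bound ::
  "nat \<Rightarrow> nat \<Rightarrow> ('u, 'q, 'r) protocol \<Rightarrow> (nat \<Rightarrow> nat) \<Rightarrow> bool" where
  "message_size_bound n f P b \<longleftrightarrow>
     (\<forall>E sz s. is_execution n f P E \<and> (\<forall>a i x. invoked E a = Some (i, x) \<longrightarrow> sz x \<le> s) \<longrightarrow>
        (\<forall>m\<in>sent_messages P E. message_size sz m \<le> b s))"

end

theory Submission
  imports Defs "HOL-Library.Countable" "HOL-Library.Sublist"
begin

text \<open>
  Each node keeps a growing set of items and works in rounds. In a round it broadcasts its items;
  the receivers merge them into theirs and reply with all they know; the round ends when a quorum of
  \<open>n - f\<close> nodes, including itself, has replied. As quorums intersect, of any two rounds one
  ends with everything with which the other one started. A round of a nonfaulty node takes two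
  message delays, however slow the faulty nodes are.

  On top of the rounds runs a sequence of lattice agreements by means of classifiers (Attiya,
  Herlihy and Rachman). Sets of entrants descend a binary tree: a classifier with threshold \<open>c\<close>
  passes a set to the left if at most \<open>c\<close> entrants have been seen there, and otherwise passes all
  entrants that have been seen to the right. Hence the sets at the leaves form a chain. Any node may
  advance any set, and a new set is launched whenever more entrants become known. Once
  the entries of the nonfaulty nodes have spread, the sets lack at most \<open>k\<close> of the \<open>n\<close> nodes, and with
  the thresholds \<open>n - 1\<close>, \<open>n - 4\<close>, \<open>n - 9\<close>, \<open>\<dots>\<close> followed by a linear search they reach a leaf after
  \<open>O(sqrt k)\<close> classifiers.

  A leaf of agreement \<open>r\<close> opens agreement \<open>r + 1\<close>. A node enters it only one round after it
  has heard that it is open, and sets launched in agreement \<open>r\<close> must not have heard of it; so all entries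
  of later agreements contain all views of agreement \<open>r\<close>, and the views of all agreements form a chain.
  A command completes when it belongs to a view, which happens at the latest in the
  third agreement after it has become known to all nonfaulty nodes.
\<close>

section \<open>The protocol\<close>

text \<open>Two obstacles shape the construction. First, messages must have constant size although
  nodes exchange all they know. Delays are charged per message and bandwidth is free: a packet is
  cut into single letters that are sent at the same instant and each arrive within one delay, so
  that resending the whole knowledge costs neither time nor message size. Second, faulty nodes may
  be slow rather than dead, and may open agreements and launch small sets of which the nonfaulty
  nodes have not heard. Hence no node waits for a particular other node; items are facts that anyone
  may carry forward, and time is counted along the descent of one set held by a nonfaulty node. The
  thresholds balance two costs. After \<open>l\<close> left turns sizes up to \<open>n - l^2\<close>
  remain, and a set lacking at most \<open>k\<close> entrants can take left turns only while
  \<open>l\<close> is of the order of \<open>sqrt k\<close>; a right turn at depth \<open>l\<close>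
  confines the sizes to an interval of length at most \<open>2 * l + 1\<close>, which a linear
  search can afford.\<close>

text \<open>
  \<open>Op i m x\<close>: the \<open>m\<close>-th command of node \<open>i\<close> is \<open>x\<close>. \<open>Level r\<close>: agreement \<open>r\<close> is open. \<open>Entry r i X\<close>:
  node \<open>i\<close> proposes the commands \<open>X\<close> in agreement \<open>r\<close>. \<open>Val r p es\<close>: in agreement \<open>r\<close>, the set \<open>es\<close> of
  entrants has arrived at the classifier with path \<open>p\<close>, which is listed from the classifier up to the
  root; \<open>True\<close> stands for the branch of the large sets.
\<close>

datatype 'c item =
    Op nat nat 'c
  | Level nat
  | Entry nat nat "(nat \<times> nat) list"
  | Val nat "bool list" "nat list"

instance item :: (countable) countable
  by countable_datatype

type_synonym ('u, 'q) packet = "bool \<times> ('u, 'q) command item list"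

section \<open>Prefix-free coding of packets\<close>

definition contents :: "'c item list \<Rightarrow> 'c list" where
  "contents K = [x. Op j m x \<leftarrow> K]"

text \<open>
  Packets, i.e. sets of items with a flag that distinguishes requests from replies, are sent as
  streams of one-letter messages. As channels are FIFO, a prefix-free code is enough to reassemble
  them, and packets truncated by a crash are never completed. The code puts the commands after an
  unary encoding of everything else.
\<close>

definition encode :: "('u, 'q) packet \<Rightarrow> ('u, 'q) letter list" where
  "encode a = replicate (to_nat (fst a, map (map_item (\<lambda>_. ())) (snd a))) (Bit True) @
     Bit False # map Cmd (contents (snd a)) @ [Bit False]"

text \<open>The type of commands need not be countable, so only the shape of a packet, with the
  commands erased, can be numbered by \<open>to_nat\<close>. The shape tells which items carry a
  command, and each carries at most one, so the listed commands can be put back in order.\<close>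

lemma items_eqI:
  assumes "map (map_item (\<lambda>_. ())) K = map (map_item (\<lambda>_. ())) K'" "contents K = contents K'"
  shows "K = K'"
  using assms
proof (induction K arbitrary: K')
  case (Cons a K)
  then obtain b L where K': "K' = b # L" by (cases K') auto
  have "a = b \<and> contents K = contents L"
    using Cons.prems unfolding K' by (cases a; cases b) (auto simp: contents_def)
  then show ?case using Cons unfolding K' by auto
qed simp

lemma replicate_append_eq:
  assumes "replicate a x @ y # r = replicate b x @ y # r'" "x \<noteq> y"
  shows "a = b \<and> r = r'"
  using assms(1)
proof (induction a arbitrary: b)
  case 0
  then show ?case using assms(2) by (cases b) auto
next
  case (Suc a)
  then show ?case using assms(2) by (cases b) auto
qed

lemma map_Cmd_append_eq:
  assumes "map Cmd xs @ Bit False # r = map Cmd ys @ Bit False # r'"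
  shows "xs = ys"
  using assms
proof (induction xs arbitrary: ys)
  case Nil
  then show ?case by (cases ys) auto
next
  case (Cons x xs)
  then show ?case by (cases ys) auto
qed

abbreviation stream :: "('u, 'q) packet list \<Rightarrow> ('u, 'q) letter list" where
  "stream as \<equiv> concat (map encode as)"

lemma encode_prefix_free:
  assumes "encode a @ r = encode b @ r'"
  shows "a = b"
proof -
  have 1: "to_nat (fst a, map (map_item (\<lambda>_. ())) (snd a)) = to_nat (fst b, map (map_item (\<lambda>_. ())) (snd b)) \<and>
      map Cmd (contents (snd a)) @ Bit False # r = map Cmd (contents (snd b)) @ Bit False # r'"
    by (rule replicate_append_eq[of _ "Bit True" "Bit False"]) (use assms in \<open>auto simp: encode_def\<close>)
  then have "contents (snd a) = contents (snd b)"
    by (blast dest: map_Cmd_append_eq)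
  then show ?thesis
    using 1 by (auto intro!: prod_eqI items_eqI)
qed

lemma encode_nonempty [simp]: "encode a \<noteq> []"
  by (simp add: encode_def)

text \<open>Safety of decoding: whatever is left in buffer and channel as \<open>r\<close>, the
  packets decoded so far are an initial part of those sent, even if a crash cut off the
  stream.\<close>

lemma prefix_of_concat_encode:
  assumes "prefix (stream as @ r) (stream bs)"
  shows "prefix as bs"
  using assms
proof (induction as arbitrary: bs)
  case (Cons a as)
  then obtain q where q: "stream bs = encode a @ stream as @ r @ q"
    by (auto simp: prefix_def)
  then obtain b bs' where bs: "bs = b # bs'" by (cases bs) auto
  with q have e: "encode a @ stream as @ r @ q = encode b @ stream bs'" by simp
  then have "a = b" by (rule encode_prefix_free)
  with e have "prefix (stream as @ r) (stream bs')"
    by (metis append.assoc prefixI same_append_eq)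
  with Cons.IH \<open>a = b\<close> bs show ?case by auto
qed simp

text \<open>Counterpart for liveness: once the letters of \<open>as\<close> have arrived, no packet
  of \<open>as\<close> can be stuck in the buffer \<open>r\<close>, as the buffer never begins with
  a complete code word.\<close>

lemma concat_encode_prefix_of:
  assumes "prefix (stream as) (stream bs @ r)"
    and "\<And>a. \<not> prefix (encode a) r"
  shows "prefix as bs"
  using assms(1)
proof (induction as arbitrary: bs)
  case (Cons a as)
  then obtain q where q: "encode a @ stream as @ q = stream bs @ r"
    by (auto simp: prefix_def)
  then obtain b bs' where bs: "bs = b # bs'"
    using assms(2)[of a] by (cases bs) (auto simp: prefix_def)
  with q have e: "encode a @ stream as @ q = encode b @ stream bs' @ r" by simp
  then have "a = b" by (rule encode_prefix_free)
  with e have "prefix (stream as) (stream bs' @ r)"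
    by (metis prefixI same_append_eq)
  with Cons.IH \<open>a = b\<close> bs show ?case by auto
qed simp

lemma Cmd_in_encode: "Cmd x \<in> set (encode a) \<longleftrightarrow> (\<exists>j m. Op j m x \<in> set (snd a))"
  by (force simp: encode_def contents_def split: item.splits)

definition requests :: "('u, 'q) packet list \<Rightarrow> ('u, 'q) command item list list" where
  "requests as = map snd (filter fst as)"

definition replies :: "('u, 'q) packet list \<Rightarrow> ('u, 'q) command item list list" where
  "replies as = map snd (filter (\<lambda>a. \<not> fst a) as)"

lemma requests_append [simp]: "requests (as @ bs) = requests as @ requests bs"
  by (simp add: requests_def)

lemma replies_append [simp]: "replies (as @ bs) = replies as @ replies bs"
  by (simp add: replies_def)

lemma requests_simps [simp]:
  "requests [] = []" "requests ((True, K) # as) = K # requests as"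
    "requests ((False, K) # as) = requests as"
  by (auto simp: requests_def)

lemma replies_simps [simp]:
  "replies [] = []" "replies ((True, K) # as) = replies as" "replies ((False, K) # as) = K # replies as"
  by (auto simp: replies_def)

lemma prefix_requests: "prefix as bs \<Longrightarrow> prefix (requests as) (requests bs)"
  by (auto simp: prefix_def)

lemma prefix_replies: "prefix as bs \<Longrightarrow> prefix (replies as) (replies bs)"
  by (auto simp: prefix_def)

lemma set_requests: "K \<in> set (requests as) \<longleftrightarrow> (True, K) \<in> set as"
  by (force simp: requests_def)

lemma set_replies: "K \<in> set (replies as) \<longleftrightarrow> (False, K) \<in> set as"
  by (force simp: replies_def)

text \<open>
  \<open>starts\<close> lists what the node knew at the starts of its rounds, the current round first, after two
  dummy rounds; \<open>outbox\<close> and \<open>inbox\<close> are complete logs.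
\<close>

record ('u, 'q, 'r) node_state =
  know :: "('u, 'q) command item list"
  starts :: "('u, 'q) command item list list"
  inbox :: "nat \<Rightarrow> ('u, 'q) packet list"
  outbox :: "nat \<Rightarrow> ('u, 'q) packet list"
  buffer :: "nat \<Rightarrow> ('u, 'q) letter list"
  own :: "('u, 'q) command list"
  waiting :: bool
  answers :: "'r response list"

definition init_node :: "('u, 'q, 'r) node_state" where
  "init_node = \<lparr>know = [Level 0], starts = [[], []], inbox = (\<lambda>_. []), outbox = (\<lambda>_. []),
     buffer = (\<lambda>_. []), own = [], waiting = False, answers = []\<rparr>"

section \<open>Data read off a list of items\<close>

definition ops :: "'c item list \<Rightarrow> (nat \<times> nat) list" where
  "ops K = [(j, m). Op j m x \<leftarrow> K]"

definition entrants :: "nat \<Rightarrow> 'c item list \<Rightarrow> nat list" where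
  "entrants r K = [j. Entry r' j X \<leftarrow> K, r' = r]"

definition pool :: "nat \<Rightarrow> bool list \<Rightarrow> 'c item list \<Rightarrow> nat list" where
  "pool r p K = concat [es. Val r' p' es \<leftarrow> K, r' = r \<and> p' = p]"

definition view :: "nat \<Rightarrow> nat list \<Rightarrow> 'c item list \<Rightarrow> (nat \<times> nat) list" where
  "view r es K = concat [X. Entry r' j X \<leftarrow> K, r' = r \<and> j \<in> set es]"

lemma set_ops: "set (ops K) = {(j, m). \<exists>x. Op j m x \<in> set K}"
  by (induction K) (auto simp: ops_def split: item.splits)

lemma set_entrants: "set (entrants r K) = {j. \<exists>X. Entry r j X \<in> set K}"
  by (induction K) (auto simp: entrants_def split: item.splits)

lemma set_pool: "set (pool r p K) = {j. \<exists>es. Val r p es \<in> set K \<and> j \<in> set es}"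
  by (induction K) (auto simp: pool_def split: item.splits)

lemma set_view: "set (view r es K) = {a. \<exists>X j. Entry r j X \<in> set K \<and> j \<in> set es \<and> a \<in> set X}"
  by (induction K) (auto simp: view_def split: item.splits)

lemma set_levels: "set [g r. Level r \<leftarrow> L, P r] = {g r | r. Level r \<in> set L \<and> P r}"
  by (induction L) (auto split: item.splits)

lemma set_vals: "set [g r p es. Val r p es \<leftarrow> L, P r p es] = {g r p es | r p es. Val r p es \<in> set L \<and> P r p es}"
  by (induction L) (auto split: item.splits)

text \<open>A packet is recognized by comparing the whole buffer with the code words after each
  letter. As the code is prefix-free and letters come one by one, this finds the end of every
  packet; \<open>inv encode\<close> is only taken on the range of \<open>encode\<close>.\<close>

fun absorb :: "nat \<Rightarrow> ('u, 'q) local_event \<Rightarrow> ('u, 'q, 'r) node_state \<Rightarrow> ('u, 'q, 'r) node_state" where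
  "absorb i (Invocation x) s =
     s\<lparr>know := know s @ [Op i (length (own s)) x], own := own s @ [x], waiting := True\<rparr>"
| "absorb i (Receipt j m) s =
     (let b = buffer s j @ m in
      if b \<in> range encode
      then s\<lparr>know := know s @ snd (inv encode b),
             inbox := (inbox s)(j := inbox s j @ [inv encode b]),
             buffer := (buffer s)(j := [])\<rparr>
      else s\<lparr>buffer := (buffer s)(j := b)\<rparr>)"

locale quorum_protocol =
  fixes n f :: nat and M :: "('s, 'u, 'q, 'r) state_machine"
begin

text \<open>
  A classifier of depth \<open>l\<close> with lower bound \<open>lo\<close>: as long as all sets were small, the thresholds are
  \<open>n - 1\<close>, \<open>n - 4\<close>, \<open>n - 9\<close>, \<open>\<dots>\<close>; after that the sizes are searched one by one.
\<close>

definition cut :: "nat \<Rightarrow> nat \<Rightarrow> nat" where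
  "cut l lo =
     (if lo = 0 then if (Suc l)\<^sup>2 < n then n - (Suc l)\<^sup>2 else 1 else Suc lo)"

primrec bounds :: "bool list \<Rightarrow> nat \<times> nat" where
  "bounds [] = (0, n)"
| "bounds (b # p) =
     (let c = cut (length p) (fst (bounds p)) in
      if b then (c, snd (bounds p)) else (fst (bounds p), c))"

definition thr :: "bool list \<Rightarrow> nat" where
  "thr p = cut (length p) (fst (bounds p))"

definition lower :: "bool list \<Rightarrow> nat" where
  "lower p = fst (bounds p)"

definition upper :: "bool list \<Rightarrow> nat" where
  "upper p = snd (bounds p)"

text \<open>The sets at \<open>p\<close> will be shown to have more than \<open>lower p\<close>
  elements, and their union at most \<open>upper p\<close>; at a leaf this forces all of them to be
  equal.\<close>

definition leaf :: "bool list \<Rightarrow> bool" where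
  "leaf p \<longleftrightarrow> upper p \<le> Suc (lower p)"

lemma lower_simps [simp]:
  "lower [] = 0" "lower (True # p) = thr p" "lower (False # p) = lower p"
  by (auto simp: lower_def thr_def Let_def)

lemma upper_simps [simp]:
  "upper [] = n" "upper (True # p) = upper p" "upper (False # p) = thr p"
  by (auto simp: upper_def thr_def Let_def)

lemma thr_pos: "0 < thr p"
  by (auto simp: thr_def cut_def)

text \<open>
  What node \<open>i\<close> adds at the end of a round, where \<open>A'\<close>, \<open>A\<close> and \<open>B\<close> are what it knew at the start of
  the previous round, at the start and at the end of this round. Everything in \<open>A'\<close> has been stored
  by a quorum before this round began, so the last of several small sets to pass a classifier has
  seen all of them. Large sets are collected in a round that begins after the threshold has been
  exceeded, so they contain the small ones.
\<close>

definition derived :: "nat \<Rightarrow> 'c item list \<Rightarrow> 'c item list \<Rightarrow> 'c item list \<Rightarrow> 'c item list" where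
  "derived i A' A B =
     [Entry r i (ops B). Level r \<leftarrow> A, \<not> (\<exists>X. Entry r i X \<in> set B)] @
     [Val r [] (entrants r A). Level r \<leftarrow> A,
        entrants r A \<noteq> [] \<and> \<not> (\<exists>r'>r. Level r' \<in> set B)] @
     [Val r (False # p) es. Val r p es \<leftarrow> A', \<not> leaf p \<and> card (set (pool r p B)) \<le> thr p] @
     [Val r (True # p) (pool r p B). Val r p es \<leftarrow> A, \<not> leaf p \<and> thr p < card (set (pool r p A))] @
     [Level (Suc r). Val r p es \<leftarrow> B, leaf p]"

lemma derived_iff: "y \<in> set (derived i A' A B) \<longleftrightarrow>
    (\<exists>r. y = Entry r i (ops B) \<and> Level r \<in> set A \<and> (\<nexists>X. Entry r i X \<in> set B)) \<or>
    (\<exists>r. y = Val r [] (entrants r A) \<and> Level r \<in> set A \<and> entrants r A \<noteq> [] \<and>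
       (\<nexists>r'. r < r' \<and> Level r' \<in> set B)) \<or>
    (\<exists>r p es. y = Val r (False # p) es \<and> Val r p es \<in> set A' \<and> \<not> leaf p \<and>
       card (set (pool r p B)) \<le> thr p) \<or>
    (\<exists>r p es. y = Val r (True # p) (pool r p B) \<and> Val r p es \<in> set A \<and> \<not> leaf p \<and>
       thr p < card (set (pool r p A))) \<or>
    (\<exists>r p es. y = Level (Suc r) \<and> Val r p es \<in> set B \<and> leaf p)"
  unfolding derived_def set_append Un_iff
    set_levels[where g = "\<lambda>r. Entry r i (ops B)"] set_levels[where g = "\<lambda>r. Val r [] (entrants r A)"]
    set_vals[where g = "\<lambda>r p es. Val r (False # p) es"] set_vals[where g =
      "\<lambda>r p es. Val r (True # p) (pool r p B)"]
    set_vals[where g = "\<lambda>r p es. Level (Suc r)"]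
  by blast

lemma Op_derived [simp]: "Op j m x \<notin> set (derived i A' A B)"
  by (simp add: derived_iff)

lemma Entry_derived: "Entry r j X \<in> set (derived i A' A B) \<longleftrightarrow>
    j = i \<and> X = ops B \<and> Level r \<in> set A \<and> (\<nexists>X. Entry r i X \<in> set B)"
  by (auto simp: derived_iff)

lemma Level_derived: "Level r \<in> set (derived i A' A B) \<longleftrightarrow>
    (\<exists>r' p es. r = Suc r' \<and> Val r' p es \<in> set B \<and> leaf p)"
  by (auto simp: derived_iff)

lemma Val_Nil_derived: "Val r [] es \<in> set (derived i A' A B) \<longleftrightarrow>
    es = entrants r A \<and> es \<noteq> [] \<and> Level r \<in> set A \<and> (\<nexists>r'. r < r' \<and> Level r' \<in> set B)"
  by (auto simp: derived_iff)

lemma Val_False_derived: "Val r (False # p) es \<in> set (derived i A' A B) \<longleftrightarrow>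
    Val r p es \<in> set A' \<and> \<not> leaf p \<and> card (set (pool r p B)) \<le> thr p"
  by (auto simp: derived_iff)

lemma Val_True_derived: "Val r (True # p) es \<in> set (derived i A' A B) \<longleftrightarrow>
    es = pool r p B \<and> (\<exists>es'. Val r p es' \<in> set A) \<and> \<not> leaf p \<and> thr p < card (set (pool r p A))"
  by (auto simp: derived_iff)

text \<open>With a single node no message will ever arrive, so that no round can be waited for.\<close>

definition views :: "'c item list \<Rightarrow> (nat \<times> nat) list list" where
  "views K = (if n = 1 then [ops K] else [view r es K. Val r p es \<leftarrow> K, leaf p])"

lemma set_views:
  "set (views K) = (if n = 1 then {ops K} else {view r es K | r p es. Val r p es \<in> set K \<and> leaf p})"
  by (simp only: views_def set_vals split: if_split) auto

text \<open>Updates commute, so a view needs no internal order and can be folded as a finite set. In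
  an execution the choice by \<open>SOME\<close> is unambiguous, since a node and an index determine
  the command.\<close>

definition reply :: "('u, 'q) command item list \<Rightarrow> (nat \<times> nat) list \<Rightarrow> ('u, 'q) command \<Rightarrow> 'r response" where
  "reply K v x =
     (case x of
        Update u \<Rightarrow> Ack
      | Query q \<Rightarrow> Result (answer M q (Finite_Set.fold
          (\<lambda>a. case_command (apply_update M) (\<lambda>_ s. s) (SOME x. Op (fst a) (snd a) x \<in> set K))
          (init_state M) (set v))))"

text \<open>The \<open>1\<close> is the node's own vote, and the \<open>2\<close> accounts for the
  dummy rounds, which need no replies. Hence the first event at a node completes a dummy round and
  opens its first real one. Replies carry no tags, as they are counted in channel order.\<close>

definition quorum_replied :: "nat \<Rightarrow> ('u, 'q, 'r) node_state \<Rightarrow> bool" where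
  "quorum_replied i s \<longleftrightarrow>
     n \<le> f + 1 + card {j. j < n \<and> j \<noteq> i \<and> length (starts s) \<le> length (replies (inbox s j)) + 2}"

definition advance :: "nat \<Rightarrow> ('u, 'q, 'r) node_state \<Rightarrow> ('u, 'q, 'r) node_state" where
  "advance i s =
     (if quorum_replied i s
      then let K = know s @ derived i (starts s ! 1) (starts s ! 0) (know s)
        in s\<lparr>know := K, starts := K # starts s\<rparr>
      else s)"

definition post :: "('u, 'q, 'r) node_state \<Rightarrow> ('u, 'q, 'r) node_state \<Rightarrow> ('u, 'q, 'r) node_state" where
  "post s s' = s'\<lparr>outbox := \<lambda>j. outbox s' j @
     (if length (requests (inbox s j)) < length (requests (inbox s' j)) then [(False, know s')] else []) @
     (if length (starts s) < length (starts s') then [(True, know s')] else [])\<rparr>"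

definition ready :: "nat \<Rightarrow> ('u, 'q, 'r) node_state \<Rightarrow> bool" where
  "ready i s \<longleftrightarrow> (\<exists>v\<in>set (views (know s)). (i, length (own s) - 1) \<in> set v)"

definition respond :: "nat \<Rightarrow> ('u, 'q, 'r) node_state \<Rightarrow> ('u, 'q, 'r) node_state" where
  "respond i s =
     (if waiting s \<and> ready i s
      then s\<lparr>waiting := False, answers := answers s @
        [reply (know s) (SOME v. v \<in> set (views (know s)) \<and> (i, length (own s) - 1) \<in> set v) (last (own s))]\<rparr>
      else s)"

definition step :: "nat \<Rightarrow> ('u, 'q, 'r) node_state \<Rightarrow> ('u, 'q) local_event \<Rightarrow> ('u, 'q, 'r) node_state" where
  "step i s e = respond i (post s (advance i (absorb i e s)))"

definition node :: "nat \<Rightarrow> ('u, 'q) local_event list \<Rightarrow> ('u, 'q, 'r) node_state" where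
  "node i h = foldl (step i) init_node h"

definition sends :: "nat \<Rightarrow> ('u, 'q, 'r) node_state \<Rightarrow> ('u, 'q, 'r) node_state \<Rightarrow> ('u, 'q, 'r) action list" where
  "sends i s s' = concat (map (\<lambda>j. map (\<lambda>l. Send j [l])
     (stream (drop (length (outbox s j)) (outbox s' j)))) (filter (\<lambda>j. j \<noteq> i) [0..<n]))"

text \<open>A protocol is a function of the history, so the states before and after the last event
  are recomputed, and the actions are read off as the growth of the logs \<open>outbox\<close> and
  \<open>answers\<close>; this is why the logs are never emptied. Responses come after all
  sends.\<close>

definition protocol :: "('u, 'q, 'r) protocol" where
  "protocol i h = (let s = node i (butlast h); s' = node i h
     in sends i s s' @ map Respond (drop (length (answers s)) (answers s')))"

section \<open>Effect of a single step\<close>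

lemma node_snoc: "node i (h @ [e]) = step i (node i h) e"
  by (simp add: node_def)

lemma absorb_simps [simp]:
  "starts (absorb i e s) = starts s" "outbox (absorb i e s) = outbox s" "answers (absorb i e s) = answers s"
  by (cases e; auto simp: Let_def)+

lemma absorb_mono:
  "prefix (know s) (know (absorb i e s))" "prefix (inbox s j) (inbox (absorb i e s) j)"
  "prefix (own s) (own (absorb i e s))"
  by (cases e; auto simp: Let_def)+

lemma advance_simps [simp]:
  "inbox (advance i s) = inbox s" "outbox (advance i s) = outbox s" "own (advance i s) = own s"
  "buffer (advance i s) = buffer s" "waiting (advance i s) = waiting s" "answers (advance i s) = answers s"
  by (auto simp: advance_def Let_def)

lemma advance_mono: "prefix (know s) (know (advance i s))" "suffix (starts s) (starts (advance i s))"
  by (auto simp: advance_def Let_def suffix_Cons)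

lemma post_simps [simp]:
  "know (post s s') = know s'" "starts (post s s') = starts s'" "inbox (post s s') = inbox s'"
  "own (post s s') = own s'" "buffer (post s s') = buffer s'" "waiting (post s s') = waiting s'"
  "answers (post s s') = answers s'"
  by (auto simp: post_def)

lemma respond_simps [simp]:
  "know (respond i s) = know s" "starts (respond i s) = starts s" "inbox (respond i s) = inbox s"
  "own (respond i s) = own s" "buffer (respond i s) = buffer s" "outbox (respond i s) = outbox s"
  by (auto simp: respond_def)

lemma ready_cong: "know s = know s' \<Longrightarrow> own s = own s' \<Longrightarrow> ready i s = ready i s'"
  by (simp add: ready_def)

lemma step_simps [simp]:
  "inbox (step i s e) = inbox (absorb i e s)" "own (step i s e) = own (absorb i e s)"
  "buffer (step i s e) = buffer (absorb i e s)"
  by (auto simp: step_def)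

lemma step_mono:
  "prefix (know s) (know (step i s e))" "suffix (starts s) (starts (step i s e))"
  "prefix (inbox s j) (inbox (step i s e) j)" "prefix (outbox s j) (outbox (step i s e) j)"
  "prefix (own s) (own (step i s e))"
  using absorb_mono[where s = s and i = i and e = e] advance_mono[where s = "absorb i e s" and i = i]
  by (auto simp: step_def post_def intro: prefix_order.trans)

lemma outbox_step: "outbox (step i s e) j = outbox s j @
    (if length (requests (inbox s j)) < length (requests (inbox (step i s e) j)) then [(False, know (step i s e))] else []) @
    (if length (starts s) < length (starts (step i s e)) then [(True, know (step i s e))] else [])"
  by (simp add: step_def post_def)

lemma step_cases:
  obtains (round) "quorum_replied i (absorb i e s)"
      "know (step i s e) = know (absorb i e s) @ derived i (starts s ! 1) (starts s ! 0) (know (absorb i e s))"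
      "starts (step i s e) = know (step i s e) # starts s"
    | (no_round) "\<not> quorum_replied i (absorb i e s)" "know (step i s e) = know (absorb i e s)"
      "starts (step i s e) = starts s"
  by (cases "quorum_replied i (absorb i e s)") (auto simp: step_def advance_def Let_def)

lemma step_waiting: "waiting (step i s e) \<longleftrightarrow> waiting (absorb i e s) \<and> \<not> ready i (step i s e)"
proof -
  have "ready i (step i s e) = ready i (post s (advance i (absorb i e s)))"
    by (rule ready_cong) (auto simp: step_def)
  then show ?thesis by (auto simp: step_def respond_def)
qed

lemma step_answers:
  obtains (response) v where "waiting (absorb i e s)" "\<not> waiting (step i s e)"
    "v \<in> set (views (know (step i s e)))"
      "(i, length (own (step i s e)) - 1) \<in> set v"
      "answers (step i s e) = answers s @ [reply (know (step i s e)) v (last (own (step i s e)))]"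
    | (silent) "waiting (step i s e) = waiting (absorb i e s)" "answers (step i s e) = answers s"
proof (cases "waiting (absorb i e s) \<and> ready i (step i s e)")
  case True
  let ?s = "step i s e"
  define v where "v = (SOME v. v \<in> set (views (know ?s)) \<and> (i, length (own ?s) - 1) \<in> set v)"
  have "v \<in> set (views (know ?s)) \<and> (i, length (own ?s) - 1) \<in> set v"
    unfolding v_def by (rule someI_ex) (use True in \<open>auto simp: ready_def\<close>)
  moreover have "ready i (post s (advance i (absorb i e s)))"
    using True by (subst ready_cong[of _ ?s]) (auto simp: step_def)
  then have "answers ?s = answers s @ [reply (know ?s) v (last (own ?s))]"
    using True unfolding v_def by (auto simp: step_def respond_def)
  ultimately show thesis using that(1) True by (auto simp: step_waiting)
next
  case False
  then have "\<not> (waiting (absorb i e s) \<and> ready i (post s (advance i (absorb i e s))))"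
    using ready_cong[of "step i s e" "post s (advance i (absorb i e s))"] by (auto simp: step_def)
  then show thesis using that(2) by (auto simp: step_def respond_def)
qed

end

section \<open>Executions and message streams\<close>

definition sent_to :: "nat \<Rightarrow> ('u, 'q, 'r) action list \<Rightarrow> ('u, 'q) message list" where
  "sent_to j as = [m. Send j' m \<leftarrow> as, j' = j]"

lemma sent_to_simps [simp]:
  "sent_to j [] = []" "sent_to j (Send j' m # as) = (if j' = j then m # sent_to j as else sent_to j as)"
  "sent_to j (Respond r # as) = sent_to j as" "sent_to j (as @ bs) = sent_to j as @ sent_to j bs"
  by (auto simp: sent_to_def)

lemma sent_to_Responds [simp]: "sent_to j (map Respond rs) = []"
  by (induction rs) auto

lemma sent_to_Sends [simp]: "sent_to j (map (\<lambda>l. Send j' (g l)) ls) = (if j' = j then map g ls else [])"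
  by (induction ls) auto

lemma prefix_sent_to_take: "prefix (sent_to j (take m as)) (sent_to j as)"
  by (metis append_take_drop_id prefixI sent_to_simps(4))

lemma channel_fold: "channel (fold (perform t now i) as c) a b =
    channel c a b @ (if a = i then map (\<lambda>m. (m, now)) (sent_to b as) else [])"
proof (induction as arbitrary: c)
  case (Cons x as)
  show ?case
  proof (cases x)
    case (Send j m)
    then show ?thesis by (auto simp: Cons.IH)
  next
    case (Respond r)
    then show ?thesis by (auto simp: Cons.IH split: option.split)
  qed
qed simp

lemma history_fold [simp]: "history (fold (perform t now i) as c) = history c"
proof (induction as arbitrary: c)
  case (Cons x as)
  then show ?case by (cases x) (auto split: option.split)
qed simp

lemma crashed_fold [simp]: "crashed (fold (perform t now i) as c) = crashed c"
proof (induction as arbitrary: c)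
  case (Cons x as)
  then show ?case by (cases x) (auto split: option.split)
qed simp

lemma pending_fold_sends:
  assumes "\<forall>x\<in>set as. \<exists>j m. x = Send j m"
  shows "pending (fold (perform t now i) as c) = pending c"
    "responses (fold (perform t now i) as c) = responses c"
  using assms by (induction as arbitrary: c) auto

lemma observe_simps [simp]:
  "crashed (observe t i tr c) = crashed c" "responses (observe t i tr c) = responses c"
  by (cases tr; simp)+

context quorum_protocol
begin

lemma sent_to_sends:
  "sent_to b (sends i s s') = (if b < n \<and> b \<noteq> i
     then map (\<lambda>l. [l]) (stream (drop (length (outbox s b)) (outbox s' b))) else [])"
proof -
  define g where "g j = stream (drop (length (outbox s j)) (outbox s' j))" for j
  have "sent_to b (concat (map (\<lambda>j. map (\<lambda>l. Send j [l]) (g j)) (filter (\<lambda>j. j \<noteq> i) [0..<k]))) =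
      (if b < k \<and> b \<noteq> i then map (\<lambda>l. [l]) (g b) else [])" for k
  proof (induction k)
    case (Suc k)
    then show ?case by (auto simp: less_Suc_eq)
  qed simp
  then show ?thesis unfolding sends_def g_def by blast
qed

lemma in_sends: "x \<in> set (sends i s s') \<Longrightarrow> \<exists>j m. x = Send j m"
  by (auto simp: sends_def)

lemma absorb_stream: "stream (inbox (absorb i (Receipt j m) s) j) @ buffer (absorb i (Receipt j m) s) j =
    stream (inbox s j) @ buffer s j @ m"
proof (cases "buffer s j @ m \<in> range encode")
  case True
  then have "encode (inv encode (buffer s j @ m)) = buffer s j @ m"
    by (rule f_inv_into_f)
  then show ?thesis using True by (simp add: Let_def)
qed simp

lemma absorb_other:
  assumes "\<And>m. e \<noteq> Receipt j m"
  shows "inbox (absorb i e s) j = inbox s j" "buffer (absorb i e s) j = buffer s j"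
  using assms by (cases e; auto simp: Let_def)+

lemma absorb_buffer:
  assumes "\<And>a. \<not> prefix (encode a) (buffer s j)" "\<And>m. e = Receipt j m \<Longrightarrow> length m \<le> 1"
  shows "\<not> prefix (encode a) (buffer (absorb i e s) j)"
proof (cases "\<exists>m. e = Receipt j m")
  case False
  then show ?thesis using assms(1) absorb_other by metis
next
  case True
  then obtain m where e: "e = Receipt j m" by blast
  show ?thesis
  proof (cases "buffer s j @ m \<in> range encode")
    case True
    then show ?thesis using e by (auto simp: Let_def)
  next
    case False
    have "\<not> prefix (encode a) (buffer s j @ m)"
    proof
      assume "prefix (encode a) (buffer s j @ m)"
      moreover have "m = [] \<or> (\<exists>l. m = [l])" using assms(2)[OF e] by (cases m) auto
      ultimately have "prefix (encode a) (buffer s j) \<or> encode a = buffer s j @ m"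
        by (auto simp: prefix_snoc)
      then show False using assms(1) False by (metis rangeI)
    qed
    then show ?thesis using e False by (auto simp: Let_def)
  qed
qed

lemma absorb_know:
  obtains (invocation) x where "e = Invocation x" "know (absorb i e s) = know s @ [Op i (length (own s)) x]"
      "inbox (absorb i e s) = inbox s"
    | (packet) j m a where "e = Receipt j m" "know (absorb i e s) = know s @ snd a"
      "inbox (absorb i e s) = (inbox s)(j := inbox s j @ [a])"
    | (partial) j m where "e = Receipt j m" "know (absorb i e s) = know s" "inbox (absorb i e s) = inbox s"
proof (cases e)
  case (Invocation x)
  then show thesis using that(1) by auto
next
  case (Receipt j m)
  then show thesis using that(2,3) by (cases "buffer s j @ m \<in> range encode") (auto simp: Let_def)
qed

end

section \<open>Node states along an execution\<close>

locale protocol_run = quorum_protocol n f M for n f and M :: "('s, 'u, 'q, 'r) state_machine" +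
  fixes E :: "('u, 'q) execution"
  assumes run: "is_execution n f protocol E" and majority: "2 * f < n"
begin

abbreviation cfg :: "nat \<Rightarrow> ('u, 'q, 'r) config" where
  "cfg \<equiv> config_at protocol E"

abbreviation chan :: "nat \<Rightarrow> nat \<Rightarrow> nat \<Rightarrow> (('u, 'q) message \<times> real) list" where
  "chan t i j \<equiv> channel (cfg t) i j"

definition S :: "nat \<Rightarrow> nat \<Rightarrow> ('u, 'q, 'r) node_state" where
  "S i t = node i (history (cfg t) i)"

definition local_event :: "nat \<Rightarrow> nat \<Rightarrow> ('u, 'q) trigger \<Rightarrow> ('u, 'q) local_event" where
  "local_event t i tr = (case tr of Invoked x \<Rightarrow> Invocation x
     | Received j \<Rightarrow> Receipt j (fst (hd (chan t j i))))"

definition steps :: "nat \<Rightarrow> nat \<Rightarrow> ('u, 'q) local_event \<Rightarrow> bool" where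
  "steps t i e \<longleftrightarrow> (\<exists>tr stop. event E t = Step i tr stop \<and> e = local_event t i tr)"

definition done_actions :: "nat \<Rightarrow> nat \<Rightarrow> nat option \<Rightarrow> ('u, 'q, 'r) action list" where
  "done_actions t i stop =
     (let as = sends i (S i t) (S i (Suc t)) @ map Respond (drop (length (answers (S i t))) (answers (S i (Suc t))))
      in case stop of None \<Rightarrow> as | Some m \<Rightarrow> take m as)"

lemma en: "enabled n (cfg t) (event E t)"
  using run by (auto simp: is_execution_def)

lemma S_0 [simp]: "S i 0 = init_node"
  by (simp add: S_def initial_config_def node_def)

lemma observe_history: "history (observe t i tr (cfg t)) l =
    (if l = i then history (cfg t) i @ [local_event t i tr] else history (cfg t) l)"
  by (cases tr) (auto simp: local_event_def)

lemma history_Suc: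
  assumes "event E t = Step i tr stop"
  shows "history (cfg (Suc t)) l =
    (if l = i then history (cfg t) i @ [local_event t i tr] else history (cfg t) l)"
  by (simp add: assms Let_def observe_history split: option.split)

lemma S_Suc:
  assumes "event E t = Step i tr stop"
  shows "S l (Suc t) = (if l = i then step i (S i t) (local_event t i tr) else S l t)"
  unfolding S_def history_Suc[OF assms] by (simp add: node_snoc)

lemma S_Suc_idle:
  assumes "\<And>i tr stop. event E t \<noteq> Step i tr stop"
  shows "S l (Suc t) = S l t"
  using assms by (cases "event E t") (auto simp: S_def)

lemma steps_unique: "steps t i e \<Longrightarrow> steps t j e' \<Longrightarrow> i = j \<and> e = e'"
  by (auto simp: steps_def)

lemma steps_S: "steps t i e \<Longrightarrow> S l (Suc t) = (if l = i then step i (S i t) e else S l t)"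
  by (auto simp: steps_def S_Suc)

lemma S_Suc_cases:
  obtains "S l (Suc t) = S l t" | e where "steps t l e" "S l (Suc t) = step l (S l t) e"
proof (cases "\<exists>i tr stop. event E t = Step i tr stop")
  case True
  then obtain i tr stop where e: "event E t = Step i tr stop" by blast
  then show thesis using S_Suc[OF e, of l] that by (cases "l = i") (auto simp: steps_def)
next
  case False
  then show thesis using that(1) S_Suc_idle by blast
qed

lemma steps_lt: "steps t i e \<Longrightarrow> i < n \<and> i \<notin> crashed (cfg t)"
  using en[of t] by (cases "event E t") (auto simp: steps_def elim: enabled.elims)

lemma steps_Receipt:
  assumes "steps t i (Receipt j m)"
  shows "j < n" "j \<noteq> i" "chan t j i \<noteq> []" "m = fst (hd (chan t j i))"
    "\<exists>stop. event E t = Step i (Received j) stop"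
proof -
  obtain tr stop where tr: "event E t = Step i tr stop" "Receipt j m = local_event t i tr"
    using assms by (auto simp: steps_def)
  then have "tr = Received j" "m = fst (hd (chan t j i))"
    by (cases tr; simp add: local_event_def)+
  with tr en[of t] show "j < n" "j \<noteq> i" "chan t j i \<noteq> []" "m = fst (hd (chan t j i))"
    "\<exists>stop. event E t = Step i (Received j) stop"
    by auto
qed

lemma protocol_history_Suc:
  assumes "event E t = Step i tr stop"
  shows "protocol i (history (observe t i tr (cfg t)) i) =
    sends i (S i t) (S i (Suc t)) @ map Respond (drop (length (answers (S i t))) (answers (S i (Suc t))))"
  using history_Suc[OF assms, of i] by (simp add: protocol_def Let_def observe_history S_def)

abbreviation performed where
  "performed t i tr stop \<equiv> fold (perform t (time E t) i) (done_actions t i stop) (observe t i tr (cfg t))"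

lemma cfg_Suc:
  assumes "event E t = Step i tr stop"
  shows "cfg (Suc t) = (let c = performed t i tr stop
    in if stop = None then c else c\<lparr>crashed := insert i (crashed (cfg t))\<rparr>)"
  using protocol_history_Suc[OF assms]
  by (auto simp: assms Let_def done_actions_def split: option.split)

lemma channel_Suc:
  assumes "event E t = Step i tr stop"
  shows "chan (Suc t) a b =
    (if tr = Received a \<and> b = i then tl (chan t a b) else chan t a b) @
    (if a = i then map (\<lambda>m. (m, time E t)) (sent_to b (done_actions t i stop)) else [])"
proof -
  have "chan (Suc t) a b =
      channel (performed t i tr stop) a b"
    unfolding cfg_Suc[OF assms] by (simp add: Let_def)
  then show ?thesis by (cases tr) (auto simp: channel_fold)
qed

lemma crashed_Suc: "event E t = Step i tr stop \<Longrightarrow>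
    crashed (cfg (Suc t)) = (if stop = None then crashed (cfg t) else insert i (crashed (cfg t)))"
  by (simp add: cfg_Suc Let_def del: config_at.simps)

lemma crashed_mono: "crashed (cfg t) \<subseteq> crashed (cfg (Suc t))"
proof (cases "event E t")
  case (Step i tr stop)
  then show ?thesis using crashed_Suc by auto
qed auto

lemma sent_to_done_actions:
  shows "prefix (sent_to b (done_actions t i stop)) (sent_to b (sends i (S i t) (S i (Suc t))))"
    "stop = None \<Longrightarrow> sent_to b (done_actions t i stop) = sent_to b (sends i (S i t) (S i (Suc t)))"
proof -
  define as where "as = sends i (S i t) (S i (Suc t)) @
    map Respond (drop (length (answers (S i t))) (answers (S i (Suc t))))"
  have as: "sent_to b as = sent_to b (sends i (S i t) (S i (Suc t)))"
    by (simp add: as_def)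
  have d: "done_actions t i stop = (case stop of None \<Rightarrow> as | Some m \<Rightarrow> take m as)"
    unfolding done_actions_def as_def Let_def ..
  show "prefix (sent_to b (done_actions t i stop)) (sent_to b (sends i (S i t) (S i (Suc t))))"
    unfolding d as[symmetric] by (auto intro: prefix_sent_to_take split: option.split)
  show "stop = None \<Longrightarrow> sent_to b (done_actions t i stop) = sent_to b (sends i (S i t) (S i (Suc t)))"
    unfolding d as[symmetric] by simp
qed

text \<open>Conservation of letters: what is decoded, buffered and in transit makes up what was
  sent. A crash within a step breaks the equality, since \<open>S\<close> reflects the complete step
  although only some of its sends were carried out; then an initial part remains.\<close>

definition stream_ok :: "nat \<Rightarrow> nat \<Rightarrow> nat \<Rightarrow> bool" where
  "stream_ok t i j \<longleftrightarrow> (\<exists>ls. map fst (chan t i j) = map (\<lambda>l. [l]) ls \<and>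
     prefix (stream (inbox (S j t) i) @ buffer (S j t) i @ ls) (stream (outbox (S i t) j)) \<and>
     (i \<notin> crashed (cfg t) \<longrightarrow>
       stream (inbox (S j t) i) @ buffer (S j t) i @ ls = stream (outbox (S i t) j)) \<and>
     (\<forall>a. \<not> prefix (encode a) (buffer (S j t) i)))"

lemma prefix_map_singleton:
  "prefix ms (map (\<lambda>l. [l]) ls) \<Longrightarrow> \<exists>ls'. ms = map (\<lambda>l. [l]) ls' \<and> prefix ls' ls"
proof (induction ms arbitrary: ls)
  case (Cons m ms)
  then obtain l ls0 where ls: "ls = l # ls0" by (cases ls) auto
  with Cons obtain ls' where "ms = map (\<lambda>l. [l]) ls'" "prefix ls' ls0" by auto
  then show ?case using Cons.prems ls by (intro exI[of _ "l # ls'"]) auto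
qed auto

lemma stream_ok:
  assumes "i < n" "j < n" "i \<noteq> j"
  shows "stream_ok t i j"
proof (induction t)
  case 0
  then show ?case by (auto simp: stream_ok_def initial_config_def init_node_def)
next
  case (Suc t)
  then obtain ls where ls: "map fst (chan t i j) = map (\<lambda>l. [l]) ls"
    and pre: "prefix (stream (inbox (S j t) i) @ buffer (S j t) i @ ls) (stream (outbox (S i t) j))"
    and eq: "i \<notin> crashed (cfg t) \<Longrightarrow>
       stream (inbox (S j t) i) @ buffer (S j t) i @ ls = stream (outbox (S i t) j)"
    and clean: "\<And>a. \<not> prefix (encode a) (buffer (S j t) i)"
    by (auto simp: stream_ok_def)
  show ?case
  proof (cases "\<exists>k tr stop. event E t = Step k tr stop")
    case False
    then have "S l (Suc t) = S l t" for l using S_Suc_idle by blast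
    moreover have "channel (cfg (Suc t)) = channel (cfg t)" using False by (cases "event E t") auto
    ultimately show ?thesis
      unfolding stream_ok_def using ls pre eq clean crashed_mono[of t]
      by (intro exI[of _ ls]) (auto simp del: config_at.simps)
  next
    case True
    then obtain k tr stop where ev: "event E t = Step k tr stop" by blast
    consider "k = i" | "k = j" "tr = Received i" | "k \<noteq> i" "\<not> (k = j \<and> tr = Received i)" by blast
    then show ?thesis
    proof cases
      case 1
      define new where "new = drop (length (outbox (S i t) j)) (outbox (S i (Suc t)) j)"
      have Sj: "S j (Suc t) = S j t" using S_Suc[OF ev, of j] 1 assms by auto
      have nc: "i \<notin> crashed (cfg t)" using steps_lt[of t i "local_event t i tr"] ev 1
        by (auto simp: steps_def)
      have "prefix (outbox (S i t) j) (outbox (S i (Suc t)) j)"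
        using S_Suc[OF ev, of i] 1 step_mono(4) by auto
      then have out: "outbox (S i (Suc t)) j = outbox (S i t) j @ new"
        unfolding new_def by (auto simp: prefix_def)
      have snt: "sent_to j (sends i (S i t) (S i (Suc t))) = map (\<lambda>l. [l]) (stream new)"
        using assms by (auto simp: sent_to_sends new_def)
      obtain ls' where ls': "sent_to j (done_actions t i stop) = map (\<lambda>l. [l]) ls'"
        "prefix ls' (stream new)"
        using prefix_map_singleton sent_to_done_actions(1)[of j t i stop] unfolding snt by blast
      have full: "ls' = stream new" if "stop = None"
      proof -
        have "map (\<lambda>l. [l]) ls' = map (\<lambda>l. [l]) (stream new)"
          using sent_to_done_actions(2)[OF that, of j t i] ls'(1) snt by simp
        then show ?thesis by (simp add: inj_map_eq_map[of "\<lambda>l. [l]"] inj_def)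
      qed
      have "map fst (chan (Suc t) i j) = map (\<lambda>l. [l]) (ls @ ls')"
        unfolding channel_Suc[OF ev] using 1 assms ls ls'(1) by (auto simp: comp_def)
      moreover have "prefix (stream (inbox (S j t) i) @ buffer (S j t) i @ ls @ ls') (stream (outbox (S i (Suc t)) j))"
      proof -
        obtain zs where "stream new = ls' @ zs" using ls'(2) by (auto simp: prefix_def)
        then have "stream (outbox (S i (Suc t)) j) =
            (stream (inbox (S j t) i) @ buffer (S j t) i @ ls) @ ls' @ zs"
          unfolding out eq[OF nc] by simp
        then show ?thesis by (simp add: prefix_def)
      qed
      moreover have "stream (inbox (S j t) i) @ buffer (S j t) i @ ls @ ls' = stream (outbox (S i (Suc t)) j)"
        if "i \<notin> crashed (cfg (Suc t))"
      proof -
        have "stop = None" using that crashed_Suc[OF ev] 1 by (auto split: if_splits)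
        then show ?thesis using eq[OF nc] full unfolding out
          by (metis append.assoc concat_append map_append)
      qed
      ultimately show ?thesis unfolding stream_ok_def Sj using clean by (intro exI[of _ "ls @ ls'"]) blast
    next
      case 2
      have Si: "S i (Suc t) = S i t" using S_Suc[OF ev, of i] 2 assms by auto
      have st: "steps t j (local_event t j tr)" using ev 2 by (auto simp: steps_def)
      have le: "local_event t j tr = Receipt i (fst (hd (chan t i j)))" using 2
        by (simp add: local_event_def)
      have ne: "chan t i j \<noteq> []" using steps_Receipt(3) st le by metis
      then obtain l ls0 where l: "ls = l # ls0" using ls by (cases ls) auto
      then have hd: "fst (hd (chan t i j)) = [l]" "map fst (tl (chan t i j)) = map (\<lambda>l. [l]) ls0"
        using ls ne by (cases "chan t i j"; auto)+
      have Sj: "S j (Suc t) = step j (S j t) (Receipt i [l])" using S_Suc[OF ev, of j] 2 le hd by auto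
      have "stream (inbox (S j (Suc t)) i) @ buffer (S j (Suc t)) i = stream (inbox (S j t) i) @ buffer (S j t) i @ [l]"
        unfolding Sj step_simps by (rule absorb_stream)
      then have str: "stream (inbox (S j (Suc t)) i) @ buffer (S j (Suc t)) i @ ls0 = stream (inbox (S j t) i) @ buffer (S j t) i @ ls"
        unfolding l by (metis append.assoc append_Cons append_Nil)
      have "\<not> prefix (encode a) (buffer (S j (Suc t)) i)" for a
        unfolding Sj step_simps by (rule absorb_buffer) (use clean in auto)
      moreover have "map fst (chan (Suc t) i j) = map (\<lambda>l. [l]) ls0"
        unfolding channel_Suc[OF ev] using 2 assms hd by auto
      ultimately show ?thesis unfolding stream_ok_def Si using pre eq str crashed_mono[of t]
        by (intro exI[of _ ls0]) (auto simp del: config_at.simps)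
    next
      case 3
      have Si: "S i (Suc t) = S i t" using S_Suc[OF ev, of i] 3 by auto
      have "inbox (S j (Suc t)) i = inbox (S j t) i \<and> buffer (S j (Suc t)) i = buffer (S j t) i"
      proof (cases "k = j")
        case True
        then have "local_event t j tr \<noteq> Receipt i m" for m using 3
          by (auto simp: local_event_def split: trigger.splits)
        then show ?thesis
          using S_Suc[OF ev, of j] True absorb_other[of "local_event t j tr" i j "S j t"] by simp
      next
        case False
        then show ?thesis using S_Suc[OF ev, of j] by auto
      qed
      moreover have "chan (Suc t) i j = chan t i j"
        unfolding channel_Suc[OF ev] using 3 by auto
      ultimately show ?thesis
        unfolding stream_ok_def using ls pre eq clean crashed_mono[of t] Si
        by (intro exI[of _ ls]) (auto simp del: config_at.simps)
    qed
  qed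
qed

lemma inbox_prefix_outbox:
  assumes "i < n" "j < n" "i \<noteq> j"
  shows "prefix (inbox (S j t) i) (outbox (S i t) j)"
  using stream_ok[OF assms, of t] prefix_of_concat_encode by (auto simp: stream_ok_def)

lemma S_mono:
  assumes "t \<le> t'"
  shows "prefix (know (S i t)) (know (S i t'))" "suffix (starts (S i t)) (starts (S i t'))"
    "prefix (inbox (S i t) j) (inbox (S i t') j)" "prefix (outbox (S i t) j) (outbox (S i t') j)"
    "prefix (own (S i t)) (own (S i t'))"
proof -
  have "prefix (know (S i t)) (know (S i t')) \<and> suffix (starts (S i t)) (starts (S i t')) \<and>
    prefix (inbox (S i t) j) (inbox (S i t') j) \<and> prefix (outbox (S i t) j) (outbox (S i t') j) \<and>
    prefix (own (S i t)) (own (S i t'))"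
    using assms
  proof (induction t' rule: dec_induct)
    case (step m)
    show ?case
    proof (cases rule: S_Suc_cases[of i m])
      case 1
      then show ?thesis using step.IH by simp
    next
      case (2 e)
      have "prefix (know (S i m)) (know (S i (Suc m)))" "suffix (starts (S i m)) (starts (S i (Suc m)))"
        "prefix (inbox (S i m) j) (inbox (S i (Suc m)) j)"
          "prefix (outbox (S i m) j) (outbox (S i (Suc m)) j)"
        "prefix (own (S i m)) (own (S i (Suc m)))"
        unfolding 2(2) by (rule step_mono)+
      then show ?thesis using step.IH
        by (blast intro: prefix_order.order_trans suffix_order.order_trans)
    qed
  qed auto
  then show "prefix (know (S i t)) (know (S i t'))" "suffix (starts (S i t)) (starts (S i t'))"
    "prefix (inbox (S i t) j) (inbox (S i t') j)" "prefix (outbox (S i t) j) (outbox (S i t') j)"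
    "prefix (own (S i t)) (own (S i t'))"
    by auto
qed

abbreviation known :: "nat \<Rightarrow> nat \<Rightarrow> ('u, 'q) command item set" where
  "known i t \<equiv> set (know (S i t))"

lemma know_mono: "t \<le> t' \<Longrightarrow> known i t \<subseteq> known i t'"
  by (rule set_mono_prefix) (rule S_mono)

end

section \<open>Rounds\<close>

lemma prefix_nth: "prefix xs ys \<Longrightarrow> m < length xs \<Longrightarrow> ys ! m = xs ! m"
  by (auto simp: prefix_def nth_append)

context protocol_run
begin

lemma steps_Invocation:
  assumes "steps t i (Invocation x)"
  shows "invoked E t = Some (i, x)"
proof -
  obtain tr stop where "event E t = Step i tr stop" "Invocation x = local_event t i tr"
    using assms by (auto simp: steps_def)
  then show ?thesis by (cases tr) (auto simp: invoked_def local_event_def)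
qed

abbreviation views_at :: "nat \<Rightarrow> nat \<Rightarrow> (nat \<times> nat) list set" where
  "views_at i t \<equiv> set (views (know (S i t)))"

lemma outbox_know:
  assumes "a \<in> set (outbox (S i t) j)"
  shows "set (snd a) \<subseteq> known i t"
  using assms
proof (induction t)
  case 0
  then show ?case by (simp add: init_node_def)
next
  case (Suc t)
  show ?case
  proof (cases "a \<in> set (outbox (S i t) j)")
    case True
    then show ?thesis using Suc.IH know_mono[of t "Suc t" i] by auto
  next
    case False
    then show ?thesis
      using Suc.prems by (cases rule: S_Suc_cases[of i t]) (auto simp: outbox_step split: if_splits)
  qed
qed

lemma inbox_absorb_know:
  assumes "\<And>j a. a \<in> set (inbox s j) \<Longrightarrow> set (snd a) \<subseteq> set (know s)" "a \<in> set (inbox (absorb i e s) j)"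
  shows "set (snd a) \<subseteq> set (know (absorb i e s))"
  using assms by (cases rule: absorb_know[of e i s]) (fastforce split: if_splits)+

lemma inbox_know:
  assumes "a \<in> set (inbox (S i t) j)"
  shows "set (snd a) \<subseteq> known i t"
  using assms
proof (induction t arbitrary: j a)
  case 0
  then show ?case by (simp add: init_node_def)
next
  case (Suc t)
  show ?case
  proof (cases rule: S_Suc_cases[of i t])
    case 1
    then show ?thesis using Suc by auto
  next
    case (2 e)
    have "set (snd a) \<subseteq> set (know (absorb i e (S i t)))"
      using Suc 2 by (intro inbox_absorb_know) auto
    then show ?thesis using 2(2) by (cases rule: step_cases[of i e "S i t"]) auto
  qed
qed

lemma received_packet:
  assumes "steps t i (Receipt j m)"
    and "inbox (absorb i (Receipt j m) (S i t)) = (inbox (S i t))(j := inbox (S i t) j @ [a])"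
  shows "a \<in> set (outbox (S j t) i)"
proof -
  note j = steps_Receipt(1,2)[OF assms(1)]
  have "inbox (S i (Suc t)) j = inbox (S i t) j @ [a]"
    using assms(2) steps_S[OF assms(1), of i] by simp
  moreover have "prefix (inbox (S i (Suc t)) j) (outbox (S j (Suc t)) i)"
    using inbox_prefix_outbox[of j i "Suc t"] j steps_lt[OF assms(1)] by blast
  ultimately have "a \<in> set (outbox (S j (Suc t)) i)"
    using set_mono_prefix by (metis in_set_conv_decomp subsetD)
  then show ?thesis using steps_S[OF assms(1), of j] j by simp
qed

lemma absorbed_items:
  assumes "steps t i e" "y \<in> set (know (absorb i e (S i t)))"
  obtains "y \<in> known i t"
    | j where "j < n" "y \<in> known j t"
    | x where "e = Invocation x" "y = Op i (length (own (S i t))) x"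
proof (cases rule: absorb_know[of e i "S i t"])
  case (invocation x)
  then show ?thesis using assms that by auto
next
  case (packet j m a)
  have "a \<in> set (outbox (S j t) i)"
    by (rule received_packet) (use assms(1) packet in simp_all)
  then have "set (snd a) \<subseteq> known j t" by (rule outbox_know)
  then show ?thesis using assms(2) packet(2) steps_Receipt(1)[OF assms(1)[unfolded packet(1)]] that(1,2)
    by auto
next
  case (partial j m)
  then show ?thesis using assms that by auto
qed

definition round_ends :: "nat \<Rightarrow> nat \<Rightarrow> ('u, 'q) command item list \<Rightarrow> ('u, 'q) command item list
    \<Rightarrow> ('u, 'q) command item list \<Rightarrow> bool" where
  "round_ends t i A' A B \<longleftrightarrow> (\<exists>e. steps t i e \<and> quorum_replied i (absorb i e (S i t)) \<and>
     A' = starts (S i t) ! 1 \<and> A = starts (S i t) ! 0 \<and> B = know (absorb i e (S i t)))"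

lemma round_ends_unique: "round_ends t i A' A B \<Longrightarrow> round_ends t i A1' A1 B1 \<Longrightarrow> A' = A1' \<and> A = A1 \<and> B = B1"
  unfolding round_ends_def using steps_unique by blast

lemma round_ends_Suc:
  assumes "round_ends t i A' A B"
  shows "i < n" "know (S i (Suc t)) = B @ derived i A' A B"
    "starts (S i (Suc t)) = know (S i (Suc t)) # starts (S i t)"
    "known i t \<subseteq> set B"
proof -
  obtain e where e: "steps t i e" "quorum_replied i (absorb i e (S i t))" "A' = starts (S i t) ! 1"
      "A = starts (S i t) ! 0" "B = know (absorb i e (S i t))"
    using assms by (auto simp: round_ends_def)
  show "i < n" using steps_lt[OF e(1)] by simp
  have "S i (Suc t) = step i (S i t) e" using steps_S[OF e(1)] by simp
  then show "know (S i (Suc t)) = B @ derived i A' A B"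
    "starts (S i (Suc t)) = know (S i (Suc t)) # starts (S i t)"
    using e by (cases rule: step_cases[of i e "S i t"]; simp)+
  show "known i t \<subseteq> set B" unfolding e(5) by (rule set_mono_prefix) (rule absorb_mono)
qed

lemma S_Suc_round_cases:
  obtains (unchanged) "S i (Suc t) = S i t"
    | (quiet) e where "steps t i e" "know (S i (Suc t)) = know (absorb i e (S i t))"
      "starts (S i (Suc t)) = starts (S i t)"
        "\<not> quorum_replied i (absorb i e (S i t))" "S i (Suc t) = step i (S i t) e"
    | (round) e A' A B where "steps t i e" "round_ends t i A' A B" "B = know (absorb i e (S i t))"
        "S i (Suc t) = step i (S i t) e"
proof (cases rule: S_Suc_cases[of i t])
  case 1
  then show thesis by (rule that(1))
next
  case (2 e)
  show thesis
  proof (cases rule: step_cases[of i e "S i t"])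
    case round
    then show thesis using 2 that(3)[of e "starts (S i t) ! 1" "starts (S i t) ! 0"]
      by (auto simp: round_ends_def)
  next
    case no_round
    then show thesis using 2 that(2) by auto
  qed
qed

section \<open>Provenance of items\<close>

lemma Op_origin:
  assumes "Op j m x \<in> known l t"
  shows "\<exists>a<t. invoked E a = Some (j, x) \<and> length (own (S j a)) = m"
  using assms
proof (induction t arbitrary: l)
  case 0
  then show ?case by (simp add: init_node_def)
next
  case (Suc t)
  have *: "\<exists>a<Suc t. invoked E a = Some (j, x) \<and> length (own (S j a)) = m"
    if "steps t l e" "Op j m x \<in> set (know (absorb l e (S l t)))" for e
    using that
  proof (cases rule: absorbed_items)
    case (3 x')
    then have "invoked E t = Some (l, x')" using that(1) steps_Invocation by simp
    then show ?thesis using 3 by auto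
  qed (use Suc.IH less_Suc_eq in blast)+
  show ?case
  proof (cases rule: S_Suc_round_cases[of l t])
    case unchanged
    then show ?thesis using Suc less_Suc_eq by fastforce
  next
    case (quiet e)
    then show ?thesis using Suc.prems * by auto
  next
    case (round e A' A B)
    then show ?thesis using Suc.prems * round_ends_Suc(2)[OF round(2)] by auto
  qed
qed

lemma item_origin:
  assumes "y \<in> known l t" "y \<noteq> Level 0" "\<And>j m x. y \<noteq> Op j m x"
  shows "\<exists>i t' A' A B. t' < t \<and> round_ends t' i A' A B \<and> y \<in> set (derived i A' A B)"
  using assms(1)
proof (induction t arbitrary: l)
  case 0
  then show ?case using assms(2) by (simp add: init_node_def)
next
  case (Suc t)
  have IH: "\<exists>i t' A' A B. t' < Suc t \<and> round_ends t' i A' A B \<and> y \<in> set (derived i A' A B)"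
    if "y \<in> known l t" for l
    using Suc.IH[OF that] less_Suc_eq by blast
  have *: "\<exists>i t' A' A B. t' < Suc t \<and> round_ends t' i A' A B \<and> y \<in> set (derived i A' A B)"
    if "steps t l e" "y \<in> set (know (absorb l e (S l t)))" for e
    using that by (cases rule: absorbed_items) (use IH assms(3) in blast)+
  show ?case
  proof (cases rule: S_Suc_round_cases[of l t])
    case unchanged
    then show ?thesis using Suc.prems IH by auto
  next
    case (quiet e)
    then show ?thesis using Suc.prems * by auto
  next
    case (round e A' A B)
    then consider "y \<in> set (know (absorb l e (S l t)))" | "y \<in> set (derived l A' A B)"
      using Suc.prems round_ends_Suc(2)[OF round(2)] by auto
    then show ?thesis using * round(1,2) by cases blast+
  qed
qed

text \<open>A request is appended to the outbox for every \<open>j\<close>, including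
  \<open>i\<close> itself, so the rounds can be read off any of them.\<close>

lemma starts_requests: "starts (S i t) = rev (requests (outbox (S i t) j)) @ [[], []]"
proof (induction t)
  case 0
  then show ?case by (simp add: init_node_def)
next
  case (Suc t)
  show ?case
  proof (cases rule: S_Suc_round_cases[of i t])
    case unchanged
    then show ?thesis using Suc by simp
  next
    case (quiet e)
    then show ?thesis using Suc by (simp add: outbox_step)
  next
    case (round e A' A B)
    then show ?thesis using Suc round_ends_Suc(3)[OF round(2)] by (simp add: outbox_step)
  qed
qed

lemma length_starts: "2 \<le> length (starts (S i t))"
  by (simp add: starts_requests[of i t 0])

lemma starts_sorted: "sorted_wrt (\<lambda>K K'. set K' \<subseteq> set K) (know (S i t) # starts (S i t))"
proof (induction t)
  case 0
  then show ?case by (simp add: init_node_def)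
next
  case (Suc t)
  show ?case
  proof (cases rule: S_Suc_round_cases[of i t])
    case unchanged
    then show ?thesis using Suc by simp
  next
    case (quiet e)
    then show ?thesis using Suc know_mono[of t "Suc t" i] by (auto simp del: config_at.simps)
  next
    case (round e A' A B)
    then show ?thesis using Suc round_ends_Suc(3)[OF round(2)] know_mono[of t "Suc t" i] by fastforce
  qed
qed

lemma round_ends_subset:
  assumes "round_ends t i A' A B"
  shows "set A' \<subseteq> set A" "set A \<subseteq> known i t" "set A \<subseteq> set B"
proof -
  obtain K K' Ks where s: "starts (S i t) = K # K' # Ks"
    using length_starts[of i t] by (cases "starts (S i t)"; cases "tl (starts (S i t))") auto
  then have "A = K" "A' = K'" using assms by (auto simp: round_ends_def)
  then show "set A' \<subseteq> set A" "set A \<subseteq> known i t" "set A \<subseteq> set B"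
    using starts_sorted[of i t] round_ends_Suc(4)[OF assms] unfolding s by auto
qed

text \<open>One receipt completes at most one packet, so each step takes in at most one request and
  answers it at once.\<close>

lemma length_replies_requests: "length (replies (outbox (S l t) i)) = length (requests (inbox (S l t) i))"
proof (induction t)
  case 0
  then show ?case by (simp add: init_node_def)
next
  case (Suc t)
  show ?case
  proof (cases rule: S_Suc_cases[of l t])
    case 1
    then show ?thesis using Suc by simp
  next
    case (2 e)
    have "length (requests (inbox (absorb l e (S l t)) i)) \<in>
        {length (requests (inbox (S l t) i)), Suc (length (requests (inbox (S l t) i)))}"
    proof (cases rule: absorb_know[of e l "S l t"])
      case (packet j m a)
      then show ?thesis by (cases a; cases "fst a") auto
    qed auto
    then show ?thesis unfolding 2(2) outbox_step using Suc by auto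
  qed
qed

text \<open>Replies are snapshots of the whole knowledge. As they correspond one to one to the
  requests, the \<open>m\<close>-th reply was given when the \<open>m\<close>-th request was already
  in, which replaces sequence numbers.\<close>

lemma reply_content:
  assumes "m < length (replies (outbox (S l t) i))"
  shows "\<exists>s\<le>t. replies (outbox (S l t) i) ! m = know (S l s) \<and> m < length (requests (inbox (S l s) i))"
  using assms
proof (induction t)
  case 0
  then show ?case by (simp add: init_node_def)
next
  case (Suc t)
  have p: "prefix (replies (outbox (S l t) i)) (replies (outbox (S l (Suc t)) i))"
    by (intro prefix_replies S_mono) simp
  show ?case
  proof (cases "m < length (replies (outbox (S l t) i))")
    case True
    then have "replies (outbox (S l (Suc t)) i) ! m = replies (outbox (S l t) i) ! m"
      by (rule prefix_nth[OF p])
    then show ?thesis using Suc.IH[OF True] le_Suc_eq by auto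
  next
    case False
    then have ne: "replies (outbox (S l (Suc t)) i) \<noteq> replies (outbox (S l t) i)" using Suc.prems by auto
    then obtain e where e: "steps t l e" "S l (Suc t) = step l (S l t) e"
      by (cases rule: S_Suc_cases[of l t]) auto
    then have "replies (outbox (S l (Suc t)) i) = replies (outbox (S l t) i) @ [know (S l (Suc t))]"
      using ne by (auto simp: outbox_step split: if_splits)
    moreover from this have "m = length (replies (outbox (S l t) i))" using False Suc.prems by auto
    ultimately show ?thesis using Suc.prems length_replies_requests[of l "Suc t" i]
      by (intro exI[of _ "Suc t"]) (auto simp: nth_append)
  qed
qed

section \<open>Quorums behind the rounds\<close>

definition round_start :: "nat \<Rightarrow> nat \<Rightarrow> nat" where
  "round_start i t = (LEAST s. length (starts (S i s)) = length (starts (S i t)))"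

lemma round_start:
  shows "round_start i t \<le> t" "starts (S i (round_start i t)) = starts (S i t)"
    "length (starts (S i t)) \<le> length (starts (S i s)) \<Longrightarrow> round_start i t \<le> s"
proof -
  show le: "round_start i t \<le> t" unfolding round_start_def by (rule Least_le) simp
  have eq: "length (starts (S i (round_start i t))) = length (starts (S i t))"
    unfolding round_start_def by (rule LeastI[of _ t]) simp
  then show "starts (S i (round_start i t)) = starts (S i t)"
    using S_mono(2)[OF le, of i] by (auto simp: suffix_def)
  assume s: "length (starts (S i t)) \<le> length (starts (S i s))"
  show "round_start i t \<le> s"
  proof (rule ccontr)
    assume "\<not> round_start i t \<le> s"
    then have "length (starts (S i s)) \<le> length (starts (S i (round_start i t)))"
      using S_mono(2)[of s "round_start i t" i] suffix_length_le by auto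
    then have "length (starts (S i s)) = length (starts (S i t))" using s eq by simp
    then have "round_start i t \<le> s" unfolding round_start_def by (rule Least_le)
    then show False using \<open>\<not> round_start i t \<le> s\<close> by simp
  qed
qed

lemma hd_starts_subset: "set (starts (S i t) ! 0) \<subseteq> known i t"
  using starts_sorted[of i t] length_starts[of i t] by (cases "starts (S i t)") auto

abbreviation replied where
  "replied i t A B l s \<equiv>
     round_start i t \<le> s \<and> s \<le> Suc t \<and> set A \<subseteq> known l s \<and> known l s \<subseteq> set B"

text \<open>For another node, \<open>s\<close> is the moment of its reply to the request of this
  round. The request had been read, so the snapshot contains \<open>A\<close>; the reply has been
  received, so the snapshot is contained in \<open>B\<close>. It cannot precede the round, since the
  request had to be sent first. The node itself is a witness at \<open>t\<close>. Dummy rounds, for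
  which nothing was sent, are excluded by \<open>A \<noteq> []\<close>.\<close>

lemma round_witnesses:
  assumes "round_ends t i A' A B" "A \<noteq> []"
  shows "\<exists>Q\<subseteq>{..<n}. n \<le> f + card Q \<and>
    (\<forall>l\<in>Q. \<exists>s. replied i t A B l s)"
proof -
  obtain e where e: "steps t i e" "quorum_replied i (absorb i e (S i t))"
      "A = starts (S i t) ! 0" "B = know (absorb i e (S i t))"
    using assms(1) by (auto simp: round_ends_def)
  have i: "i < n" using round_ends_Suc(1)[OF assms(1)] .
  let ?s1 = "absorb i e (S i t)"
  define W where "W = {l. l < n \<and> l \<noteq> i \<and> length (starts ?s1) \<le> length (replies (inbox ?s1 l)) + 2}"
  define Q where "Q = insert i W"
  have "finite W" "i \<notin> W" by (auto simp: W_def)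
  then have "card Q = Suc (card W)" unfolding Q_def by simp
  then have "n \<le> f + card Q" using e(2) unfolding quorum_replied_def W_def[symmetric] by simp
  moreover have "\<exists>s. replied i t A B l s"
    if "l \<in> Q" for l
  proof (cases "l = i")
    case True
    then show ?thesis
      using round_start(1)[of i t] round_ends_subset(2)[OF assms(1)] round_ends_Suc(4)[OF assms(1)]
      by (intro exI[of _ t]) simp
  next
    case False
    define R where "R = requests (outbox (S i t) l)"
    have st: "starts (S i t) = rev R @ [[], []]" unfolding R_def by (rule starts_requests)
    have "R \<noteq> []"
    proof
      assume "R = []"
      then show False using assms(2) e(3) st by simp
    qed
    then obtain R' K where "R = R' @ [K]" by (metis rev_exhaust)
    then have R: "R = R' @ [A]" using e(3) st by simp
    \<comment> \<open>Index of the request of the current round, the last one sent to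
      \<open>l\<close> so far.\<close>
    define m where "m = length R'"
    have lR: "length R = Suc m" using R m_def by simp
    have l: "l < n" "l \<noteq> i" "length (starts ?s1) \<le> length (replies (inbox ?s1 l)) + 2"
      using that False unfolding Q_def W_def by simp_all
    then have m: "m < length (replies (inbox ?s1 l))" unfolding absorb_simps st using lR by simp
    have in1: "inbox (S i (Suc t)) = inbox ?s1" using steps_S[OF e(1), of i] by simp
    have pre: "prefix (replies (inbox ?s1 l)) (replies (outbox (S l (Suc t)) i))"
      unfolding in1[symmetric] using l i by (intro prefix_replies inbox_prefix_outbox) auto
    then have m': "m < length (replies (outbox (S l (Suc t)) i))" using m prefix_length_le by fastforce
    have C: "replies (inbox ?s1 l) ! m = replies (outbox (S l (Suc t)) i) ! m"
      using prefix_nth[OF pre m] by simp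
    obtain s where s: "s \<le> Suc t" "replies (outbox (S l (Suc t)) i) ! m = know (S l s)"
        "m < length (requests (inbox (S l s) i))"
      using reply_content[OF m'] by blast
    have "replies (inbox ?s1 l) ! m \<in> set (replies (inbox ?s1 l))" using m by simp
    then have "(False, know (S l s)) \<in> set (inbox ?s1 l)" using C s(2) by (simp add: set_replies)
    then have 1: "known l s \<subseteq> set B"
      unfolding e(4) using inbox_absorb_know[of "S i t" "(False, know (S l s))" i e l] inbox_know by auto
    have pre2: "prefix (requests (inbox (S l s) i)) (requests (outbox (S i s) l))"
      using l i by (intro prefix_requests inbox_prefix_outbox) auto
    then have len: "m < length (requests (outbox (S i s) l))" using s(3) prefix_length_le by fastforce
    then have "length (starts (S i t)) \<le> length (starts (S i s))"
      unfolding st starts_requests[of i s l] using lR by simp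
    then have 2: "round_start i t \<le> s" by (rule round_start(3))
    have p1: "prefix (requests (outbox (S i s) l)) (requests (outbox (S i (Suc t)) l))"
      using s(1) by (intro prefix_requests S_mono)
    have p2: "prefix R (requests (outbox (S i (Suc t)) l))"
      unfolding R_def by (intro prefix_requests S_mono) simp
    have "m < length R" using lR by simp
    note prefix_nth[OF pre2 s(3), symmetric]
    also have "requests (outbox (S i s) l) ! m = requests (outbox (S i (Suc t)) l) ! m"
      using prefix_nth[OF p1 len] by (rule sym)
    also have "requests (outbox (S i (Suc t)) l) ! m = R ! m"
      using p2 \<open>m < length R\<close> by (rule prefix_nth)
    also have "R ! m = A" using R m_def by simp
    finally have "A \<in> set (requests (inbox (S l s) i))" using s(3) nth_mem by metis
    then have "set A \<subseteq> known l s" using inbox_know[of "(True, A)" l s i] by (simp add: set_requests)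
    then show ?thesis using 1 2 s(1) by blast
  qed
  moreover have "Q \<subseteq> {..<n}" using i by (auto simp: Q_def W_def)
  ultimately show ?thesis by blast
qed

text \<open>The reason for remembering two starts: the previous round has ended, and its witnesses
  have kept its starting knowledge ever since.\<close>

lemma previous_stored:
  assumes "starts (S i t) ! 1 \<noteq> []"
  shows "\<exists>Q\<subseteq>{..<n}. n \<le> f + card Q \<and> (\<forall>l\<in>Q. set (starts (S i t) ! 1) \<subseteq> known l t)"
  using assms
proof (induction t)
  case 0
  then show ?case by (simp add: init_node_def)
next
  case (Suc t)
  have IH: ?case if st: "starts (S i (Suc t)) = starts (S i t)"
  proof -
    obtain Q where "Q \<subseteq> {..<n}" "n \<le> f + card Q" "\<forall>l\<in>Q. set (starts (S i t) ! 1) \<subseteq> known l t"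
      using Suc unfolding st by blast
    then show ?thesis unfolding st using know_mono[of t "Suc t"] by (meson le_SucI order_refl subset_trans)
  qed
  show ?case
  proof (cases rule: S_Suc_round_cases[of i t])
    case (round e A' A B)
    have A: "starts (S i (Suc t)) ! 1 = A"
      using round_ends_Suc(3)[OF round(2)] round(2) by (auto simp: round_ends_def)
    then obtain Q where "Q \<subseteq> {..<n}" "n \<le> f + card Q"
      "\<forall>l\<in>Q. \<exists>s. replied i t A B l s"
      using round_witnesses[OF round(2)] Suc.prems by auto
    then show ?thesis unfolding A using know_mono by (meson subset_trans)
  qed (use IH in simp)+
qed

lemma quorums_intersect:
  assumes "Q \<subseteq> {..<n}" "n \<le> f + card Q" "Q' \<subseteq> {..<n}" "n \<le> f + card Q'"
  shows "\<exists>l. l \<in> Q \<and> l \<in> Q'"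
proof (rule ccontr)
  assume "\<nexists>l. l \<in> Q \<and> l \<in> Q'"
  moreover have "finite Q" "finite Q'" using assms finite_subset by blast+
  ultimately have "card (Q \<union> Q') = card Q + card Q'" by (intro card_Un_disjoint) auto
  moreover have "card (Q \<union> Q') \<le> card {..<n}" using assms by (intro card_mono) auto
  ultimately show False using assms majority by simp
qed

text \<open>A node common to both quorums took two snapshots, and the earlier one is contained in
  the later one.\<close>

lemma rounds_exchange:
  assumes "round_ends t i A' A B" "round_ends t1 i1 A1' A1 B1"
  shows "set A \<subseteq> set B1 \<or> set A1 \<subseteq> set B"
proof (cases "A = [] \<or> A1 = []")
  case False
  then obtain Q Q1 where Q: "Q \<subseteq> {..<n}" "n \<le> f + card Q" "Q1 \<subseteq> {..<n}" "n \<le> f + card Q1"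
      "\<forall>l\<in>Q. \<exists>s. set A \<subseteq> known l s \<and> known l s \<subseteq> set B"
      "\<forall>l\<in>Q1. \<exists>s. set A1 \<subseteq> known l s \<and> known l s \<subseteq> set B1"
    using round_witnesses[OF assms(1)] round_witnesses[OF assms(2)] by meson
  then obtain l where "l \<in> Q" "l \<in> Q1" using quorums_intersect by blast
  then obtain s s1 where "set A \<subseteq> known l s" "known l s \<subseteq> set B"
      "set A1 \<subseteq> known l s1" "known l s1 \<subseteq> set B1"
    using Q by meson
  then show ?thesis using know_mono[of s s1 l] know_mono[of s1 s l] nat_le_linear[of s s1] by blast
qed auto

text \<open>\<open>A'\<close> was stored by a quorum before the round of \<open>i\<close> started,
  hence before that of \<open>i1\<close> did, so the latter reads it at a common node. In contrast
  to \<open>rounds_exchange\<close>, the order of the starts fixes the direction.\<close>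

lemma later_round_collects:
  assumes "round_ends t i A' A B" "round_ends t1 i1 A1' A1 B1" "round_start i t \<le> round_start i1 t1"
    "A1 \<noteq> []"
  shows "set A' \<subseteq> set B1"
proof (cases "A' = []")
  case False
  have A': "A' = starts (S i (round_start i t)) ! 1"
    using assms(1) by (auto simp: round_ends_def round_start(2))
  then obtain Q where Q: "Q \<subseteq> {..<n}" "n \<le> f + card Q" "\<forall>l\<in>Q. set A' \<subseteq> known l (round_start i t)"
    using previous_stored[of i "round_start i t"] False by blast
  obtain Q1 where Q1: "Q1 \<subseteq> {..<n}" "n \<le> f + card Q1"
      "\<forall>l\<in>Q1. \<exists>s. replied i1 t1 A1 B1 l s"
    using round_witnesses[OF assms(2,4)] by blast
  obtain l where l: "l \<in> Q" "l \<in> Q1" using quorums_intersect[OF Q(1,2) Q1(1,2)] by blast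
  then obtain s where s: "round_start i1 t1 \<le> s" "known l s \<subseteq> set B1"
    using Q1(3) by blast
  have "set A' \<subseteq> known l (round_start i t)" using Q(3) l by blast
  also have "\<dots> \<subseteq> known l s" using assms(3) s(1) by (intro know_mono) simp
  finally show ?thesis using s(2) by blast
qed auto

end

section \<open>Views form a chain\<close>

context quorum_protocol
begin

text \<open>Causal closure: the grounds of an item are known wherever the item is. This survives
  communication because nodes always send their whole knowledge, never single items.\<close>

fun supported :: "'c item set \<Rightarrow> 'c item \<Rightarrow> bool" where
  "supported K (Op i m x) = True"
| "supported K (Level r) = (\<forall>r'. r = Suc r' \<longrightarrow> (\<exists>p es. leaf p \<and> Val r' p es \<in> K))"
| "supported K (Entry r j X) = (j < n \<and> Level r \<in> K \<and> (\<forall>i m. (i, m) \<in> set X \<longrightarrow> (\<exists>x. Op i m x \<in> K)))"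
| "supported K (Val r p es) =
     (Level r \<in> K \<and> lower p < card (set es) \<and> (\<forall>j\<in>set es. \<exists>X. Entry r j X \<in> K))"

definition coherent :: "'c item set \<Rightarrow> bool" where
  "coherent K \<longleftrightarrow> (\<forall>y\<in>K. supported K y)"

lemma coherentD: "coherent K \<Longrightarrow> y \<in> K \<Longrightarrow> supported K y"
  by (simp add: coherent_def)

lemma coherent_Entry:
  assumes "coherent K" "Entry r j X \<in> K"
  shows "j < n" "Level r \<in> K" "(i, m) \<in> set X \<Longrightarrow> \<exists>x. Op i m x \<in> K"
  using coherentD[OF assms] by simp_all

lemma coherent_Val:
  assumes "coherent K" "Val r p es \<in> K"
  shows "Level r \<in> K" "lower p < card (set es)" "j \<in> set es \<Longrightarrow> \<exists>X. Entry r j X \<in> K"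
  using coherentD[OF assms] by simp_all

lemma coherent_Level: "coherent K \<Longrightarrow> Level (Suc r) \<in> K \<Longrightarrow> \<exists>p es. leaf p \<and> Val r p es \<in> K"
  using coherentD[of K "Level (Suc r)"] by simp

lemma supported_mono: "supported K y \<Longrightarrow> K \<subseteq> L \<Longrightarrow> supported L y"
  by (cases y) (simp_all, blast+)

lemma coherent_Level_le:
  assumes "coherent K" "Level r' \<in> K" "r \<le> r'"
  shows "Level r \<in> K"
proof -
  have "Level (r + d) \<in> K \<Longrightarrow> Level r \<in> K" for d
  proof (induction d)
    case (Suc d)
    then have "Level (Suc (r + d)) \<in> K" by simp
    then obtain p es where "Val (r + d) p es \<in> K" using coherent_Level[OF assms(1)] by blast
    then have "Level (r + d) \<in> K" by (rule coherent_Val(1)[OF assms(1)])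
    then show ?case by (rule Suc.IH)
  qed simp
  from this[of "r' - r"] show ?thesis using assms(2,3) by simp
qed

lemma coherent_Un: "coherent K \<Longrightarrow> coherent L \<Longrightarrow> coherent (K \<union> L)"
  unfolding coherent_def using supported_mono by (metis Un_iff sup_ge1 sup_ge2)

lemma coherent_Op: "coherent {Op i m x}"
  by (auto simp: coherent_def)

lemma coherent_Level_0: "coherent {Level 0}"
  by (auto simp: coherent_def)

lemma card_pool_mono: "set A \<subseteq> set B \<Longrightarrow> card (set (pool r p A)) \<le> card (set (pool r p B))"
  by (rule card_mono[OF finite_set]) (auto simp: set_pool)

lemma supported_derived:
  assumes "coherent (set B)" "set A' \<subseteq> set A" "set A \<subseteq> set B" "i < n" "y \<in> set (derived i A' A B)"
  shows "supported (set B) y"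
proof (cases y)
  case (Level r)
  then show ?thesis using assms(5) by (auto simp: Level_derived)
next
  case (Entry r j X)
  then show ?thesis using assms(3-5) by (auto simp: Entry_derived set_ops)
next
  case (Val r p es)
  show ?thesis
  proof (cases p)
    case Nil
    have "es = entrants r A" "es \<noteq> []" "Level r \<in> set A"
      using assms(5) unfolding Val Nil Val_Nil_derived by blast+
    have "0 < card (set es)" using \<open>es \<noteq> []\<close> by (simp add: card_gt_0_iff)
    moreover have "\<exists>X. Entry r j X \<in> set B" if "j \<in> set es" for j
      using that assms(3) unfolding \<open>es = entrants r A\<close> set_entrants by blast
    ultimately show ?thesis using \<open>Level r \<in> set A\<close> assms(3) Val Nil by auto
  next
    case (Cons b q)
    show ?thesis
    proof (cases b)
      case True
      with Val Cons assms(5) obtain es'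
        where es': "es = pool r q B" "Val r q es' \<in> set A" "thr q < card (set (pool r q A))"
        by (auto simp: Val_True_derived)
      then have "thr q < card (set es)" using card_pool_mono[OF assms(3), of r q] by simp
      moreover have "Level r \<in> set B" using es'(2) assms(3) coherent_Val(1)[OF assms(1)] by blast
      moreover have "\<exists>X. Entry r j X \<in> set B" if "j \<in> set es" for j
        using that coherent_Val(3)[OF assms(1)] unfolding es'(1) set_pool by blast
      ultimately show ?thesis using Val Cons True by simp
    next
      case False
      with Val Cons assms(5) have "Val r q es \<in> set B" using assms(2,3) by (auto simp: Val_False_derived)
      then show ?thesis using coherentD[OF assms(1)] Val Cons False by fastforce
    qed
  qed
qed simp

lemma coherent_derived:
  assumes "coherent (set B)" "set A' \<subseteq> set A" "set A \<subseteq> set B" "i < n"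
  shows "coherent (set (B @ derived i A' A B))"
  unfolding coherent_def
proof
  fix y assume "y \<in> set (B @ derived i A' A B)"
  then have "supported (set B) y"
    using supported_derived[OF assms] coherentD[OF assms(1)] by auto
  then show "supported (set (B @ derived i A' A B)) y" by (rule supported_mono) simp
qed

end

context protocol_run
begin

lemma coherent_absorb:
  assumes "steps t i e" "coherent (known i t)"
    and "\<And>j a. a \<in> set (outbox (S j t) i) \<Longrightarrow> coherent (set (snd a))"
  shows "coherent (set (know (absorb i e (S i t))))"
proof (cases rule: absorb_know[of e i "S i t"])
  case (invocation x)
  then show ?thesis using coherent_Un[OF assms(2) coherent_Op] by simp
next
  case (packet j m a)
  have "a \<in> set (outbox (S j t) i)"
    by (rule received_packet) (use assms(1) packet in simp_all)
  then show ?thesis using coherent_Un[OF assms(2) assms(3)] packet(2) by simp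
next
  case (partial j m)
  then show ?thesis using assms(2) by simp
qed

lemma coherent_state:
  "coherent (known i t) \<and> (\<forall>j. \<forall>a\<in>set (outbox (S i t) j). coherent (set (snd a)))"
proof (induction t arbitrary: i)
  case 0
  then show ?case using coherent_Level_0 by (simp add: init_node_def)
next
  case (Suc t)
  have k: "coherent (known i (Suc t))"
  proof (cases rule: S_Suc_round_cases[of i t])
    case unchanged
    then show ?thesis using Suc.IH by simp
  next
    case (quiet e)
    then show ?thesis using coherent_absorb[OF quiet(1)] Suc.IH by simp
  next
    case (round e A' A B)
    have "coherent (set B)" unfolding round(3) using coherent_absorb[OF round(1)] Suc.IH by blast
    then show ?thesis
      unfolding round_ends_Suc(2)[OF round(2)]
      using round_ends_subset(1,3)[OF round(2)] round_ends_Suc(1)[OF round(2)] by (rule coherent_derived)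
  qed
  moreover have "coherent (set (snd a))" if a: "a \<in> set (outbox (S i (Suc t)) j)" for j a
  proof (cases "a \<in> set (outbox (S i t) j)")
    case True
    then show ?thesis using Suc.IH by blast
  next
    case False
    then have "snd a = know (S i (Suc t))"
      using a by (cases rule: S_Suc_cases[of i t]) (auto simp: outbox_step split: if_splits)
    then show ?thesis using k by simp
  qed
  ultimately show ?case by blast
qed

lemma coherent_know: "coherent (known i t)"
  using coherent_state by blast

lemma coherent_round: "round_ends t i A' A B \<Longrightarrow> coherent (set B)"
  unfolding round_ends_def using coherent_absorb coherent_state by blast

lemma round_item_know:
  assumes "round_ends t i A' A B" "y \<in> set B"
  shows "y \<in> known i (Suc t)"
  using assms round_ends_Suc(2)[OF assms(1)] by simp

lemma Entry_origin:
  assumes "Entry r j X \<in> known l t"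
  shows "\<exists>t' A' A B. t' < t \<and> round_ends t' j A' A B \<and> Level r \<in> set A \<and> X = ops B \<and> (\<nexists>X. Entry r j X \<in> set B) \<and>
    Entry r j X \<in> known j (Suc t')"
proof -
  obtain i t' A' A B where 1: "t' < t" "round_ends t' i A' A B" "Entry r j X \<in> set (derived i A' A B)"
    using item_origin[OF assms] by blast
  then have 2: "j = i" "X = ops B" "Level r \<in> set A" "\<nexists>X. Entry r i X \<in> set B"
    by (simp_all add: Entry_derived)
  have "Entry r j X \<in> known j (Suc t')"
    using 1(3) 2(1) round_ends_Suc(2)[OF 1(2)] by simp
  then show ?thesis using 1(1,2) 2 by blast
qed

text \<open>A node knows its own entry from the moment of creation, and \<open>derived\<close>
  creates none if one is there, so a later round cannot produce a second one. This makes a view the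
  same for all observers.\<close>

lemma Entry_unique:
  assumes "Entry r j X \<in> known l t" "Entry r j X' \<in> known l' t'"
  shows "X = X'"
proof -
  obtain t1 A1' A1 B1 where 1: "round_ends t1 j A1' A1 B1" "X = ops B1" "\<nexists>X. Entry r j X \<in> set B1"
      "Entry r j X \<in> known j (Suc t1)"
    using Entry_origin[OF assms(1)] by blast
  obtain t2 A2' A2 B2 where 2: "round_ends t2 j A2' A2 B2" "X' = ops B2" "\<nexists>X. Entry r j X \<in> set B2"
      "Entry r j X' \<in> known j (Suc t2)"
    using Entry_origin[OF assms(2)] by blast
  have "\<not> t1 < t2"
  proof
    assume "t1 < t2"
    then have "Entry r j X \<in> known j t2" using 1(4) know_mono[of "Suc t1" t2 j] by auto
    then show False using 2(3) round_ends_Suc(4)[OF 2(1)] by blast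
  qed
  moreover have "\<not> t2 < t1"
  proof
    assume "t2 < t1"
    then have "Entry r j X' \<in> known j t1" using 2(4) know_mono[of "Suc t2" t1 j] by auto
    then show False using 1(3) round_ends_Suc(4)[OF 1(1)] by blast
  qed
  ultimately have "t1 = t2" by simp
  then show ?thesis using round_ends_unique[OF 1(1)] 1(2) 2(1,2) by blast
qed

section \<open>Classifiers and the chain of their leaves\<close>

definition ever :: "('u, 'q) command item \<Rightarrow> bool" where
  "ever y \<longleftrightarrow> (\<exists>l t. y \<in> known l t)"

lemma ever_round: "round_ends t i A' A B \<Longrightarrow> y \<in> set B \<Longrightarrow> ever y"
  unfolding ever_def using round_item_know by blast

lemma ever_Val_derived:
  assumes "ever (Val r p es)"
  shows "\<exists>t i A' A B. round_ends t i A' A B \<and> Val r p es \<in> set (derived i A' A B)"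
proof -
  obtain l t where "Val r p es \<in> known l t" using assms unfolding ever_def by blast
  from item_origin[OF this] show ?thesis by blast
qed

lemma ever_Val_Nil:
  assumes "ever (Val r [] es)"
  shows "\<exists>t i A' A B. round_ends t i A' A B \<and> es = entrants r A \<and> (\<nexists>r'. r < r' \<and> Level r' \<in> set B)"
  using ever_Val_derived[OF assms] unfolding Val_Nil_derived by blast

lemma ever_Val_False:
  assumes "ever (Val r (False # p) es)"
  shows "\<exists>t i A' A B. round_ends t i A' A B \<and> Val r p es \<in> set A' \<and> \<not> leaf p \<and> card (set (pool r p B)) \<le> thr p"
  using ever_Val_derived[OF assms] unfolding Val_False_derived by blast

lemma ever_Val_True:
  assumes "ever (Val r (True # p) es)"
  shows "\<exists>t i A' A B. round_ends t i A' A B \<and> es = pool r p B \<and> (\<exists>es'. Val r p es' \<in> set A) \<and> \<not> leaf p \<and>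
    thr p < card (set (pool r p A))"
  using ever_Val_derived[OF assms] unfolding Val_True_derived by blast

lemma ever_Val_lt:
  assumes "ever (Val r p es)" "j \<in> set es"
  shows "j < n"
proof -
  obtain l t where "Val r p es \<in> known l t" using assms(1) unfolding ever_def by blast
  then show ?thesis using coherent_Val(3)[OF coherent_know] coherent_Entry(1)[OF coherent_know] assms(2)
    by blast
qed

lemma ever_Val_lower:
  assumes "ever (Val r p es)"
  shows "lower p < card (set es)"
  using assms coherent_Val(2)[OF coherent_know] unfolding ever_def by blast

definition united :: "nat \<Rightarrow> bool list \<Rightarrow> nat set" where
  "united r p = {j. \<exists>es. ever (Val r p es) \<and> j \<in> set es}"

lemma united_lt: "united r p \<subseteq> {..<n}"
  unfolding united_def using ever_Val_lt by blast

lemma finite_united [simp]: "finite (united r p)"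
  using united_lt finite_subset by blast

lemma united_Cons: "united r (b # p) \<subseteq> united r p"
proof
  fix j assume "j \<in> united r (b # p)"
  then obtain es where es: "ever (Val r (b # p) es)" "j \<in> set es" unfolding united_def by blast
  show "j \<in> united r p"
  proof (cases b)
    case True
    with es(1) have "ever (Val r (True # p) es)" by simp
    from ever_Val_True[OF this] obtain t i A' A B where 1: "round_ends t i A' A B" "es = pool r p B"
      by blast
    then obtain es' where "Val r p es' \<in> set B" "j \<in> set es'" using es(2) by (auto simp: set_pool)
    then show ?thesis unfolding united_def using ever_round[OF 1(1)] by blast
  next
    case False
    with es(1) have "ever (Val r (False # p) es)" by simp
    from ever_Val_False[OF this] obtain t i A' A B where 1: "round_ends t i A' A B" "Val r p es \<in> set A'"
      by blast
    then have "Val r p es \<in> set B" using round_ends_subset(1,3)[OF 1(1)] by blast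
    then show ?thesis unfolding united_def using ever_round[OF 1(1)] es(2) by blast
  qed
qed

lemma united_append: "united r (q @ p) \<subseteq> united r p"
proof (induction q)
  case (Cons b q)
  then show ?case using united_Cons[of r b "q @ p"] by auto
qed simp

lemma card_united_False: "card (united r (False # p)) \<le> thr p"
proof (cases "united r (False # p) = {}")
  case False
  let ?U = "united r (False # p)"
  \<comment> \<open>One passage is chosen for every element of the union rather than for every set:
    there may be infinitely many passages, but there are at most \<open>n\<close> elements.\<close>
  define R where "R j d \<longleftrightarrow> (case d of (t, i, A', A, B, es) \<Rightarrow>
      round_ends t i A' A B \<and> Val r p es \<in> set A' \<and> card (set (pool r p B)) \<le> thr p \<and> j \<in> set es)" for j d
  have "\<exists>d. R j d" if j: "j \<in> ?U" for j
  proof -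
    obtain es where es: "ever (Val r (False # p) es)" "j \<in> set es" using j unfolding united_def by blast
    from ever_Val_False[OF es(1)] obtain t i A' A B where
      "round_ends t i A' A B" "Val r p es \<in> set A'" "card (set (pool r p B)) \<le> thr p" by blast
    then have "R j (t, i, A', A, B, es)" using es(2) by (simp add: R_def)
    then show ?thesis by blast
  qed
  then obtain d where d: "\<And>j. j \<in> ?U \<Longrightarrow> R j (d j)" by metis
  \<comment> \<open>Passages are compared by the starts of their rounds; by
    \<open>later_round_collects\<close>, the one that starts last sees all the others.\<close>
  define g where "g j = (case d j of (t, i, _) \<Rightarrow> round_start i t)" for j
  have "Max (g ` ?U) \<in> g ` ?U" using False by (intro Max_in) auto
  then obtain k where k: "k \<in> ?U" "g k = Max (g ` ?U)" by (metis imageE)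
  obtain t i A' A B es where dk: "d k = (t, i, A', A, B, es)" by (metis prod_cases6)
  then have 1: "round_ends t i A' A B" "Val r p es \<in> set A'" "card (set (pool r p B)) \<le> thr p"
    "g k = round_start i t"
    using d[OF k(1)] by (simp_all add: g_def R_def)
  have "A \<noteq> []" using round_ends_subset(1)[OF 1(1)] 1(2) by auto
  have "?U \<subseteq> set (pool r p B)"
  proof
    fix j assume j: "j \<in> ?U"
    obtain t1 i1 A1' A1 B1 es1 where dj: "d j = (t1, i1, A1', A1, B1, es1)" by (metis prod_cases6)
    then have 2: "round_ends t1 i1 A1' A1 B1" "Val r p es1 \<in> set A1'" "j \<in> set es1"
      "g j = round_start i1 t1"
      using d[OF j] by (simp_all add: g_def R_def)
    have "g j \<le> g k" unfolding k(2) using j by (intro Max_ge) auto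
    then have "set A1' \<subseteq> set B"
      using later_round_collects[OF 2(1) 1(1)] 1(4) 2(4) \<open>A \<noteq> []\<close> by simp
    then show "j \<in> set (pool r p B)" using 2(2,3) by (auto simp: set_pool)
  qed
  then have "card ?U \<le> card (set (pool r p B))" by (intro card_mono) auto
  then show ?thesis using 1(3) by simp
qed simp

lemma card_united: "card (united r p) \<le> upper p"
proof (induction p)
  case Nil
  then show ?case using card_mono[OF _ united_lt, of r "[]"] by simp
next
  case (Cons b p)
  show ?case
  proof (cases b)
    case True
    have "card (united r (b # p)) \<le> card (united r p)" by (intro card_mono united_Cons) simp
    then show ?thesis using Cons True by simp
  next
    case False
    then show ?thesis using card_united_False by simp
  qed
qed

text \<open>To the left a set is passed on unchanged; to the right it is replaced by a pool that
  contains it.\<close>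

lemma Val_contains_ancestor:
  assumes "ever (Val r (q @ p) es)"
  shows "\<exists>es'. ever (Val r p es') \<and> set es' \<subseteq> set es"
  using assms
proof (induction q arbitrary: es)
  case (Cons b q)
  have "\<exists>es'. ever (Val r (q @ p) es') \<and> set es' \<subseteq> set es"
  proof (cases b)
    case True
    with Cons.prems have "ever (Val r (True # q @ p) es)" by simp
    from ever_Val_True[OF this] obtain t i A' A B es'
      where 1: "round_ends t i A' A B" "es = pool r (q @ p) B" "Val r (q @ p) es' \<in> set A"
      by blast
    then have "Val r (q @ p) es' \<in> set B" using round_ends_subset(3)[OF 1(1)] by blast
    then show ?thesis using 1(2) ever_round[OF 1(1)] by (auto simp: set_pool)
  next
    case False
    with Cons.prems have "ever (Val r (False # q @ p) es)" by simp
    from ever_Val_False[OF this] obtain t i A' A B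
      where 1: "round_ends t i A' A B" "Val r (q @ p) es \<in> set A'"
      by blast
    then have "Val r (q @ p) es \<in> set B" using round_ends_subset(1,3)[OF 1(1)] by blast
    then show ?thesis using ever_round[OF 1(1)] by blast
  qed
  then show ?case using Cons.IH by blast
qed auto

lemma inner_not_leaf:
  assumes "ever (Val r (q @ b # p) es)"
  shows "\<not> leaf p"
proof -
  obtain es' where "ever (Val r (b # p) es')" using Val_contains_ancestor[OF assms] by blast
  then show ?thesis using ever_Val_False[of r p es'] ever_Val_True[of r p es'] by (cases b) auto
qed

text \<open>By \<open>rounds_exchange\<close>, either the collecting round sees the small set, or
  the round of the small set sees all that exceeded the threshold, which contradicts its own
  count.\<close>

lemma slave_subset_master:
  assumes "ever (Val r (False # p) es)" "ever (Val r (True # p) es')"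
  shows "set es \<subseteq> set es'"
proof -
  obtain t i A' A B where 1: "round_ends t i A' A B" "Val r p es \<in> set A'" "card (set (pool r p B)) \<le> thr p"
    using ever_Val_False[OF assms(1)] by blast
  obtain t1 i1 A1' A1 B1 where 2: "round_ends t1 i1 A1' A1 B1" "es' = pool r p B1"
    "thr p < card (set (pool r p A1))"
    using ever_Val_True[OF assms(2)] by blast
  from rounds_exchange[OF 1(1) 2(1)] show ?thesis
  proof
    assume "set A \<subseteq> set B1"
    then have "Val r p es \<in> set B1" using 1(2) round_ends_subset(1)[OF 1(1)] by blast
    then show ?thesis unfolding 2(2) by (auto simp: set_pool)
  next
    assume "set A1 \<subseteq> set B"
    then show ?thesis using card_pool_mono[of A1 B r p] 1(3) 2(3) by simp
  qed
qed

text \<open>Sets further down on the left stay within the union of the left branch, and those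
  further down on the right contain some set that entered the right branch.\<close>

lemma slave_subset_master_descendants:
  assumes "ever (Val r (q @ False # p) es)" "ever (Val r (q' @ True # p) es')"
  shows "set es \<subseteq> set es'"
proof
  fix j assume "j \<in> set es"
  then have "j \<in> united r (q @ False # p)" using assms(1) unfolding united_def by blast
  then have "j \<in> united r (False # p)" using united_append by blast
  then obtain e where e: "ever (Val r (False # p) e)" "j \<in> set e" unfolding united_def by blast
  obtain e' where "ever (Val r (True # p) e')" "set e' \<subseteq> set es'" using Val_contains_ancestor[OF assms(2)]
    by blast
  then show "j \<in> set es'" using slave_subset_master[OF e(1)] e(2) by blast
qed

lemma suffix_decomposition:
  fixes p p' :: "'x list"
  obtains (1) q where "p' = q @ p" | (2) q where "p = q @ p'"
    | (3) q q' b b' s where "b \<noteq> b'" "p = q @ b # s" "p' = q' @ b' # s"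
proof (cases "rev p \<parallel> rev p'")
  case True
  then obtain as b bs c cs where d: "b \<noteq> c" "rev p = as @ b # bs" "rev p' = as @ c # cs"
    using parallel_decomp[OF True] by blast
  have "p = rev bs @ b # rev as" "p' = rev cs @ c # rev as"
    using arg_cong[OF d(2), of rev] arg_cong[OF d(3), of rev] by simp_all
  then show ?thesis using 3 d(1) by blast
next
  case False
  then have "prefix (rev p) (rev p') \<or> prefix (rev p') (rev p)" by blast
  then have "suffix p p' \<or> suffix p' p" by (simp add: suffix_to_prefix)
  then show ?thesis using 1 2 unfolding suffix_def by blast
qed

text \<open>Sets at the same leaf all equal their union, as \<open>lower\<close> and
  \<open>upper\<close> leave a single size. Different leaves cannot lie below each other, so their
  paths part at a classifier, where the left set is contained in the right one.\<close>

lemma leaves_comparable: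
  assumes "ever (Val r p es)" "leaf p" "ever (Val r p' es')" "leaf p'"
  shows "set es \<subseteq> set es' \<or> set es' \<subseteq> set es"
proof (cases "p = p'")
  case True
  have sub: "set e \<subseteq> united r p \<and> lower p < card (set e)" if "ever (Val r p e)" for e
    using that ever_Val_lower unfolding united_def by blast
  have eq: "set e = united r p" if "ever (Val r p e)" for e
  proof (rule card_seteq)
    show "card (united r p) \<le> card (set e)"
      using card_united[of r p] sub[OF that] assms(2) by (simp add: leaf_def)
  qed (use sub[OF that] in auto)
  then show ?thesis using assms True by simp
next
  case False
  have no_leaf_below: False if below: "p1 = q @ p2" "p1 \<noteq> p2" "ever (Val r p1 e)" "leaf p2" for p1 p2 q e
  proof -
    obtain q' b where "q = q' @ [b]" using below(1,2) by (cases q rule: rev_cases) auto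
    then show False using inner_not_leaf[of r q' b p2 e] below by simp
  qed
  consider q where "p' = q @ p" | q where "p = q @ p'"
    | q q' b b' s where "b \<noteq> b'" "p = q @ b # s" "p' = q' @ b' # s"
    using suffix_decomposition[of p' p] by metis
  then show ?thesis
  proof cases
    case 1
    then show ?thesis using no_leaf_below[of p' _ p es'] False assms by blast
  next
    case 2
    then show ?thesis using no_leaf_below[of p _ p' es] False assms by blast
  next
    case (3 q q' b b' s)
    then show ?thesis
      using slave_subset_master_descendants[of r q s es q' es'] slave_subset_master_descendants[of r q' s es' q es] assms
      by (cases b; cases b') auto
  qed
qed

text \<open>\<open>j\<close> belongs to a set launched by a round that ended without hearing of a
  level above \<open>r\<close>, whereas the round of the later entry started with level
  \<open>r'\<close>. So the exchange between these rounds can only go forward: the later entry is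
  made with the entry of \<open>j\<close> already known.\<close>

lemma Entry_subset_later_Entry:
  assumes "ever (Val r p es)" "j \<in> set es" "ever (Entry r j X)" "ever (Entry r' j' X')" "r < r'"
  shows "set X \<subseteq> set X'"
proof -
  have "j \<in> united r (p @ [])" using assms(1,2) unfolding united_def by auto
  then have "j \<in> united r []" using united_append by blast
  then obtain es0 where "ever (Val r [] es0)" "j \<in> set es0" unfolding united_def by blast
  then obtain t i A' A B where 1: "round_ends t i A' A B" "j \<in> set (entrants r A)"
    "\<nexists>r'. r < r' \<and> Level r' \<in> set B"
    using ever_Val_Nil by blast
  then obtain X0 where X0: "Entry r j X0 \<in> set A" by (auto simp: set_entrants)
  then have "X0 = X"
    using Entry_unique round_ends_subset(2)[OF 1(1)] assms(3) unfolding ever_def by blast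
  obtain l t' where "Entry r' j' X' \<in> known l t'" using assms(4) unfolding ever_def by blast
  then obtain t1 A1' A1 B1 where 2: "round_ends t1 j' A1' A1 B1" "Level r' \<in> set A1" "X' = ops B1"
    using Entry_origin by blast
  have "\<not> set A1 \<subseteq> set B" using 1(3) 2(2) assms(5) by blast
  then have "set A \<subseteq> set B1" using rounds_exchange[OF 1(1) 2(1)] by blast
  then have "Entry r j X \<in> set B1" using X0 \<open>X0 = X\<close> by blast
  then show ?thesis using coherent_Entry(3)[OF coherent_round[OF 2(1)]] 2(3) by (auto simp: set_ops)
qed

text \<open>Within an agreement the leaves decide, and \<open>Entry_unique\<close> takes care of
  views evaluated at different nodes. Across agreements, a view is contained in each single entry of
  the later one, and a leaf has at least one entrant.\<close>

lemma views_comparable: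
  assumes "v \<in> views_at l t" "v' \<in> views_at l' t'" "l < n" "l' < n"
  shows "set v \<subseteq> set v' \<or> set v' \<subseteq> set v"
proof (cases "n = 1")
  case True
  have "l = l'" using True assms(3,4) by simp
  moreover have "v = ops (know (S l t))" "v' = ops (know (S l' t'))"
    using assms(1,2) unfolding set_views if_P[OF True] by simp_all
  ultimately show ?thesis using know_mono[of t t' l] know_mono[of t' t l] nat_le_linear[of t t']
    by (simp add: set_ops) blast
next
  case False
  obtain r p es where v: "v = view r es (know (S l t))" "Val r p es \<in> known l t" "leaf p"
    using assms(1) False by (auto simp: set_views)
  obtain r' p' es' where v': "v' = view r' es' (know (S l' t'))" "Val r' p' es' \<in> known l' t'" "leaf p'"
    using assms(2) False by (auto simp: set_views)
  have same: "set (view r e (know (S k s))) \<subseteq> set (view r e' (know (S k' s')))"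
    if sub: "set e \<subseteq> set e'" "Val r p' e' \<in> known k' s'" for r p' e e' k s k' s'
  proof
    fix a assume "a \<in> set (view r e (know (S k s)))"
    then obtain X j where X: "Entry r j X \<in> known k s" "j \<in> set e" "a \<in> set X" by (auto simp: set_view)
    then have "j \<in> set e'" using sub by blast
    then obtain X' where "Entry r j X' \<in> known k' s'" using coherent_Val(3)[OF coherent_know sub(2)]
      by blast
    moreover from this have "X = X'" using Entry_unique X(1) by blast
    ultimately show "a \<in> set (view r e' (know (S k' s')))" using X(3) \<open>j \<in> set e'\<close> by (auto simp: set_view)
  qed
  have later: "set (view r e (know (S k s))) \<subseteq> set (view r' e' (know (S k' s')))"
    if lt: "r < r'" "Val r p e \<in> known k s" "Val r' p' e' \<in> known k' s'" for r r' p p' e e' k s k' s'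
  proof
    fix a assume "a \<in> set (view r e (know (S k s)))"
    then obtain X j where X: "Entry r j X \<in> known k s" "j \<in> set e" "a \<in> set X" by (auto simp: set_view)
    have "e' \<noteq> []" using coherent_Val(2)[OF coherent_know lt(3)] by auto
    then obtain j' where j': "j' \<in> set e'" by (cases e') auto
    then obtain X' where X': "Entry r' j' X' \<in> known k' s'" using coherent_Val(3)[OF coherent_know lt(3)]
      by blast
    have "set X \<subseteq> set X'"
      using Entry_subset_later_Entry[of r p e j X r' j' X'] lt(1,2) X(1,2) X' unfolding ever_def by blast
    then show "a \<in> set (view r' e' (know (S k' s')))" using X(3) X' j' by (auto simp: set_view)
  qed
  consider "r = r'" | "r < r'" | "r' < r" by linarith
  then show ?thesis
  proof cases
    case 1
    have "set es \<subseteq> set es' \<or> set es' \<subseteq> set es"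
      using leaves_comparable v(2,3) v'(2,3) 1 unfolding ever_def by blast
    then show ?thesis using same v(1,2) v'(1,2) 1 by blast
  next
    case 2
    then show ?thesis using later v v' by blast
  next
    case 3
    then show ?thesis using later v v' by blast
  qed
qed

end

section \<open>Linearizability\<close>

lemma finite_sorted_list:
  assumes "finite A" "trans R" "irrefl R" "total_on A R"
  shows "\<exists>bs. distinct bs \<and> set bs = A \<and> sorted_wrt (\<lambda>b b'. (b, b') \<in> R) bs"
  using assms(1,4)
proof (induction A)
  case (insert x A)
  then obtain bs where bs: "distinct bs" "set bs = A" "sorted_wrt (\<lambda>b b'. (b, b') \<in> R) bs"
    by (meson total_on_subset subset_insertI)
  let ?l = "filter (\<lambda>b. (b, x) \<in> R) bs" and ?r = "filter (\<lambda>b. (x, b) \<in> R) bs"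
  have tot: "(b, x) \<in> R \<or> (x, b) \<in> R" if "b \<in> A" for b
    using insert.prems insert.hyps(2) that unfolding total_on_def by (metis insertCI)
  have anti: "\<not> ((b, x) \<in> R \<and> (x, b) \<in> R)" for b
    using assms(2,3) unfolding trans_def irrefl_def by blast
  have "distinct (?l @ x # ?r)" using bs(1,2) insert.hyps(2) anti by auto
  moreover have "set (?l @ x # ?r) = insert x A" using bs(2) tot by auto
  moreover have "sorted_wrt (\<lambda>b b'. (b, b') \<in> R) (?l @ x # ?r)"
    using bs(3) assms(2) by (auto simp: sorted_wrt_append sorted_wrt_filter dest: transD)
  ultimately show ?case by blast
qed simp

text \<open>
  Commands are ordered by the set of views that contain them (for queries: that extend their own
  view), those in more views first; ties are broken in favour of updates.
\<close>

lemma linearization_of_views: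
  fixes V :: "nat \<Rightarrow> nat set"
  assumes "D \<subseteq> C" and V: "\<And>a. a \<in> D \<Longrightarrow> a \<in> V a \<and> V a \<subseteq> C"
    and chain: "\<And>a b. a \<in> D \<Longrightarrow> b \<in> D \<Longrightarrow> V a \<subseteq> V b \<or> V b \<subseteq> V a"
  shows "\<exists>R. R \<subseteq> C \<times> C \<and> trans R \<and> irrefl R \<and> total_on C R \<and>
    (\<forall>a\<in>D. \<forall>b\<in>C. b \<notin> V a \<longrightarrow> (a, b) \<in> R) \<and>
    (\<forall>a\<in>D. \<not> upd a \<longrightarrow> {b. (b, a) \<in> R \<and> upd b} = {b \<in> V a. upd b})"
proof -
  define U where "U x = {c \<in> D. if upd x then x \<in> V c else x \<in> D \<and> V x \<subseteq> V c}" for x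
  define key where "key a b \<longleftrightarrow> (upd a \<and> \<not> upd b) \<or> (upd a = upd b \<and> a < b)" for a b :: nat
  define R where "R = {(a, b). a \<in> C \<and> b \<in> C \<and> (U b \<subset> U a \<or> U a = U b \<and> key a b)}"
  \<comment> \<open>Each \<open>U x\<close> is closed upwards in the chain of views, so any two of
    them are comparable by inclusion.\<close>
  have up: "c' \<in> U x" if "c \<in> U x" "c' \<in> D" "V c \<subseteq> V c'" for c c' x
    using that unfolding U_def by (auto split: if_splits)
  have U_chain: "U x \<subseteq> U y \<or> U y \<subseteq> U x" for x y
  proof (rule ccontr)
    assume "\<not> (U x \<subseteq> U y \<or> U y \<subseteq> U x)"
    then obtain c c' where "c \<in> U x" "c \<notin> U y" "c' \<in> U y" "c' \<notin> U x" by blast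
    moreover from this have "c \<in> D" "c' \<in> D" unfolding U_def by blast+
    ultimately show False using chain up by metis
  qed
  have self: "a \<in> U a" if "a \<in> D" for a using V that unfolding U_def by auto
  have "trans R"
  proof (rule transI)
    fix a b c assume "(a, b) \<in> R" "(b, c) \<in> R"
    moreover have "key a b \<Longrightarrow> key b c \<Longrightarrow> key a c" unfolding key_def by auto
    ultimately show "(a, c) \<in> R" unfolding R_def by auto
  qed
  moreover have "irrefl R" unfolding irrefl_def R_def key_def by auto
  moreover have "total_on C R"
  proof (rule total_onI)
    fix a b assume "a \<in> C" "b \<in> C" "a \<noteq> b"
    moreover have "key a b \<or> key b a" using \<open>a \<noteq> b\<close> unfolding key_def by auto
    ultimately show "(a, b) \<in> R \<or> (b, a) \<in> R" using U_chain[of a b] unfolding R_def by auto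
  qed
  moreover have "(a, b) \<in> R" if "a \<in> D" "b \<in> C" "b \<notin> V a" for a b
  proof -
    have "a \<notin> U b" using V[of b] that(1,3) unfolding U_def by (auto split: if_splits)
    then have "U b \<subset> U a" using U_chain[of a b] self[OF that(1)] by blast
    then show ?thesis unfolding R_def using that assms(1) by blast
  qed
  moreover have "{b. (b, a) \<in> R \<and> upd b} = {b \<in> V a. upd b}" if "a \<in> D" "\<not> upd a" for a
  proof -
    have "(b, a) \<in> R \<longleftrightarrow> b \<in> V a" if "upd b" for b
    proof
      assume "(b, a) \<in> R"
      then have "a \<in> U b" unfolding R_def using self[OF \<open>a \<in> D\<close>] by blast
      then show "b \<in> V a" using \<open>upd b\<close> unfolding U_def by simp
    next
      assume b: "b \<in> V a"
      then have "a \<in> U b" using \<open>upd b\<close> \<open>a \<in> D\<close> unfolding U_def by simp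
      then have "U a \<subseteq> U b" using up[of a b] \<open>\<not> upd a\<close> unfolding U_def[of a] by auto
      moreover have "key b a" using \<open>upd b\<close> \<open>\<not> upd a\<close> unfolding key_def by simp
      ultimately show "(b, a) \<in> R" unfolding R_def using b V[OF \<open>a \<in> D\<close>] assms(1) \<open>a \<in> D\<close> by blast
    qed
    then show ?thesis by blast
  qed
  moreover have "R \<subseteq> C \<times> C" unfolding R_def by blast
  ultimately show ?thesis by blast
qed

context protocol_run
begin

section \<open>Commands and responses\<close>

lemma invokedD:
  assumes "invoked E t = Some (i, x)"
  shows "\<exists>stop. event E t = Step i (Invoked x) stop" "steps t i (Invocation x)" "i < n"
    "own (S i (Suc t)) = own (S i t) @ [x]"
proof -
  show 1: "\<exists>stop. event E t = Step i (Invoked x) stop"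
    using assms unfolding invoked_def by (auto split: event.splits trigger.splits)
  then show 2: "steps t i (Invocation x)" by (auto simp: steps_def local_event_def)
  then show "i < n" using steps_lt by blast
  show "own (S i (Suc t)) = own (S i t) @ [x]" using steps_S[OF 2, of i] by simp
qed

lemma length_own_mono: "t \<le> t' \<Longrightarrow> length (own (S i t)) \<le> length (own (S i t'))"
  by (rule prefix_length_le) (rule S_mono)

lemma invocation_index_inj:
  assumes "invoked E a = Some (j, x)" "invoked E b = Some (j, y)"
    "length (own (S j a)) = length (own (S j b))"
  shows "a = b"
proof -
  have "\<not> a' < b'" if "invoked E a' = Some (j, z)"
    "length (own (S j a')) = length (own (S j b'))" for a' b' z
    using invokedD(4)[OF that(1)] length_own_mono[of "Suc a'" b' j] that(2) by auto
  then show ?thesis using assms by (metis linorder_neqE_nat)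
qed

text \<open>The response is the last action of a step. So a step cut short by a crash has lost its
  response, if it had one, and then consists of sends only.\<close>

lemma done_actions_cases:
  assumes "event E t = Step i tr stop"
  obtains (silent) "\<forall>x\<in>set (done_actions t i stop). \<exists>j m. x = Send j m"
      "stop = None \<Longrightarrow> waiting (S i (Suc t)) = waiting (absorb i (local_event t i tr) (S i t))"
    | (response) v where "waiting (absorb i (local_event t i tr) (S i t))" "\<not> waiting (S i (Suc t))"
      "v \<in> views_at i (Suc t)" "(i, length (own (S i (Suc t))) - 1) \<in> set v"
      "done_actions t i stop = sends i (S i t) (S i (Suc t)) @
         [Respond (reply (know (S i (Suc t))) v (last (own (S i (Suc t)))))]"
proof -
  let ?s = "sends i (S i t) (S i (Suc t))"
  have S': "S i (Suc t) = step i (S i t) (local_event t i tr)" using S_Suc[OF assms, of i] by simp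
  show thesis
  proof (cases rule: step_answers[of i "local_event t i tr" "S i t"])
    case (response v)
    let ?r = "reply (know (S i (Suc t))) v (last (own (S i (Suc t))))"
    have d: "done_actions t i stop = (case stop of None \<Rightarrow> ?s @ [Respond ?r] | Some m \<Rightarrow> take m (?s @ [Respond ?r]))"
      unfolding done_actions_def using response(5) unfolding S'[symmetric] by (simp add: Let_def)
    show thesis
    proof (cases "done_actions t i stop = ?s @ [Respond ?r]")
      case True
      then show thesis using that(2) response(1-4) unfolding S'[symmetric] by blast
    next
      case False
      then obtain m where m: "stop = Some m" "done_actions t i stop = take m (?s @ [Respond ?r])"
        using d by (cases stop) auto
      have "m \<le> length ?s" using False m(2) by (cases "m \<le> length ?s") auto
      then have "done_actions t i stop = take m ?s" using m(2) by simp
      then show thesis using that(1) m(1) in_sends by (metis in_set_takeD option.distinct(1))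
    qed
  next
    case silent
    have d: "done_actions t i stop = (case stop of None \<Rightarrow> ?s | Some m \<Rightarrow> take m ?s)"
      unfolding done_actions_def using silent(2) unfolding S'[symmetric] by (simp add: Let_def)
    have "\<forall>x\<in>set (done_actions t i stop). \<exists>j m. x = Send j m"
      unfolding d using in_sends by (auto split: option.splits dest: in_set_takeD)
    then show thesis using that(1) silent(1) unfolding S'[symmetric] by blast
  qed
qed

lemma pending_observe: "pending (observe t i tr c) j = (if j = i \<and> (\<exists>x. tr = Invoked x) then Some t else pending c j)"
  by (cases tr) auto

text \<open>\<open>waiting\<close> mirrors \<open>pending\<close> only at nodes that have not
  crashed: a truncated step may clear \<open>waiting\<close> although the response was never
  given.\<close>

definition pending_ok :: "nat \<Rightarrow> bool" where
  "pending_ok t \<longleftrightarrow> (\<forall>i. (i \<notin> crashed (cfg t) \<longrightarrow> (pending (cfg t) i = None \<longleftrightarrow> \<not> waiting (S i t))) \<and>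
     (\<forall>a. pending (cfg t) i = Some a \<longrightarrow> a < t \<and> responses (cfg t) a = None \<and>
        (\<exists>x. invoked E a = Some (i, x) \<and> own (S i t) = own (S i a) @ [x])))"

abbreviation explained :: "nat \<Rightarrow> nat \<Rightarrow> 'r response \<Rightarrow> bool" where
  "explained a t r \<equiv> \<exists>i x v. invoked E a = Some (i, x) \<and> v \<in> views_at i (Suc t) \<and>
     (i, length (own (S i a))) \<in> set v \<and> r = reply (know (S i (Suc t))) v x"

definition responses_ok :: "nat \<Rightarrow> bool" where
  "responses_ok t \<longleftrightarrow> (\<forall>a t' r. responses (cfg t) a = Some (t', r) \<longrightarrow> t' < t \<and> a \<le> t' \<and>
     explained a t' r)"

lemma pending_cfg_Suc:
  assumes "event E t = Step i tr stop"
  shows "pending (cfg (Suc t)) = pending (performed t i tr stop)"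
    "responses (cfg (Suc t)) = responses (performed t i tr stop)"
  by (cases stop; simp add: cfg_Suc[OF assms] Let_def del: config_at.simps)+

lemma silent_Suc:
  assumes "event E t = Step i tr stop" "\<forall>x\<in>set (done_actions t i stop). \<exists>j m. x = Send j m"
  shows "pending (cfg (Suc t)) j = (if j = i \<and> (\<exists>x. tr = Invoked x) then Some t else pending (cfg t) j)"
    "responses (cfg (Suc t)) = responses (cfg t)"
  unfolding pending_cfg_Suc[OF assms(1)] pending_fold_sends[OF assms(2)] pending_observe by simp_all

lemma response_Suc:
  assumes "event E t = Step i tr stop"
    "done_actions t i stop = sends i (S i t) (S i (Suc t)) @ [Respond r]"
    "(if \<exists>x. tr = Invoked x then Some t else pending (cfg t) i) = Some a"
  shows "pending (cfg (Suc t)) j = (if j = i then None else pending (cfg t) j)"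
    "responses (cfg (Suc t)) = (responses (cfg t))(a := Some (t, r))"
proof -
  let ?c = "fold (perform t (time E t) i) (sends i (S i t) (S i (Suc t))) (observe t i tr (cfg t))"
  have p: "pending ?c = pending (observe t i tr (cfg t))" "responses ?c = responses (cfg t)"
    using pending_fold_sends[of "sends i (S i t) (S i (Suc t))"] in_sends
      by (blast, simp add: pending_fold_sends in_sends)
  have "pending ?c i = Some a" unfolding p pending_observe using assms(3) by simp
  then show "pending (cfg (Suc t)) j = (if j = i then None else pending (cfg t) j)"
    "responses (cfg (Suc t)) = (responses (cfg t))(a := Some (t, r))"
    unfolding pending_cfg_Suc[OF assms(1)] assms(2) using p assms(3) by (auto simp: pending_observe)
qed

lemma pending_responses_ok: "pending_ok t \<and> responses_ok t"
proof (induction t)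
  case 0
  then show ?case by (simp add: pending_ok_def responses_ok_def initial_config_def init_node_def)
next
  case (Suc t)
  have p1: "pending (cfg t) i = None \<longleftrightarrow> \<not> waiting (S i t)" if "i \<notin> crashed (cfg t)" for i
    using Suc that unfolding pending_ok_def by blast
  have p2: "a < t" "responses (cfg t) a = None"
    "\<exists>x. invoked E a = Some (i, x) \<and> own (S i t) = own (S i a) @ [x]"
    if "pending (cfg t) i = Some a" for i a
    using Suc that unfolding pending_ok_def by blast+
  have r: "t' < t \<and> a \<le> t' \<and>
     explained a t' r"
    if "responses (cfg t) a = Some (t', r)" for a t' r
    using Suc that unfolding responses_ok_def by blast
  show ?case
  proof (cases "\<exists>i tr stop. event E t = Step i tr stop")
    case False
    then have S': "S l (Suc t) = S l t" for l using S_Suc_idle by blast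
    have eq: "pending (cfg (Suc t)) = pending (cfg t)" "responses (cfg (Suc t)) = responses (cfg t)"
      using False by (cases "event E t"; simp)+
    have "pending_ok (Suc t)" unfolding pending_ok_def eq S'
      using p1 p2 crashed_mono[of t] less_SucI by blast
    moreover have "responses_ok (Suc t)" unfolding responses_ok_def eq
      using r less_SucI by blast
    ultimately show ?thesis by blast
  next
    case True
    then obtain i tr stop where ev: "event E t = Step i tr stop" by blast
    let ?e = "local_event t i tr"
    have st: "steps t i ?e" using ev unfolding steps_def by blast
    have i: "i < n" "i \<notin> crashed (cfg t)" using steps_lt[OF st] by auto
    have S': "S l (Suc t) = (if l = i then step i (S i t) ?e else S l t)" for l using S_Suc[OF ev] .
    define a0 where "a0 = (if \<exists>x. tr = Invoked x then Some t else pending (cfg t) i)"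
    have w: "waiting (absorb i ?e (S i t)) \<longleftrightarrow> a0 \<noteq> None"
    proof (cases tr)
      case (Invoked x)
      then show ?thesis by (simp add: a0_def local_event_def)
    next
      case (Received j)
      then show ?thesis using p1[OF i(2)] by (auto simp: a0_def local_event_def Let_def)
    qed
    have fresh: "responses (cfg t) t = None" using r[of t] by (cases "responses (cfg t) t") fastforce+
    have a0: "a < Suc t \<and> responses (cfg t) a = None \<and> (\<exists>x. invoked E a = Some (i, x) \<and> own (S i (Suc t)) = own (S i a) @ [x])"
      if "a0 = Some a" for a
    proof (cases tr)
      case (Invoked x)
      then have "invoked E t = Some (i, x)" using ev by (simp add: invoked_def)
      then show ?thesis using that Invoked fresh invokedD(4) by (auto simp: a0_def)
    next
      case (Received j)
      then have "own (S i (Suc t)) = own (S i t)" unfolding S' by (simp add: local_event_def Let_def)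
      then show ?thesis using that Received p2[of i a] by (auto simp: a0_def)
    qed
    have other: "a < Suc t \<and> (\<exists>x. invoked E a = Some (j, x) \<and> own (S j (Suc t)) = own (S j a) @ [x])"
      if "pending (cfg t) j = Some a" "j \<noteq> i" for a j
      using p2[OF that(1)] that(2) S'[of j] by auto
    have pw: "pending (cfg t) j = None \<longleftrightarrow> \<not> waiting (S j (Suc t))" if "j \<noteq> i" "j \<notin> crashed (cfg t)" for j
      using p1[OF that(2)] S'[of j] that(1) by simp
    have cr: "crashed (cfg t) \<subseteq> crashed (cfg (Suc t))" by (rule crashed_mono)
    show ?thesis
    proof (cases rule: done_actions_cases[OF ev, case_names silent response])
      case silent
      have pn: "pending (cfg (Suc t)) j = (if j = i then a0 else pending (cfg t) j)" for j
        unfolding silent_Suc(1)[OF ev silent(1)] a0_def by simp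
      have "pending (cfg (Suc t)) j = None \<longleftrightarrow> \<not> waiting (S j (Suc t))" if "j \<notin> crashed (cfg (Suc t))" for j
      proof (cases "j = i")
        case True
        then have "stop = None" using that crashed_Suc[OF ev] by (auto split: if_splits)
        then show ?thesis using silent(2) w True unfolding pn by simp
      next
        case False
        then show ?thesis using pw that cr unfolding pn by auto
      qed
      moreover have "a < Suc t \<and> responses (cfg (Suc t)) a = None \<and>
          (\<exists>x. invoked E a = Some (j, x) \<and> own (S j (Suc t)) = own (S j a) @ [x])"
        if "pending (cfg (Suc t)) j = Some a" for j a
        using that a0[of a] other[of j a] p2(2)[of j a] unfolding pn silent_Suc(2)[OF ev silent(1)]
        by (cases "j = i") auto
      ultimately have "pending_ok (Suc t)" unfolding pending_ok_def by blast
      moreover have "responses_ok (Suc t)"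
        unfolding responses_ok_def silent_Suc(2)[OF ev silent(1)] using r less_SucI by blast
      ultimately show ?thesis by blast
    next
      case (response v)
      let ?r = "reply (know (S i (Suc t))) v (last (own (S i (Suc t))))"
      obtain a where a: "a0 = Some a" using w response(1) by auto
      note suc = response_Suc[OF ev response(5) a[unfolded a0_def]]
      obtain x where x: "invoked E a = Some (i, x)" "own (S i (Suc t)) = own (S i a) @ [x]" "a < Suc t"
        using a0[OF a] by blast
      have "pending (cfg (Suc t)) j = None \<longleftrightarrow> \<not> waiting (S j (Suc t))" if "j \<notin> crashed (cfg (Suc t))" for j
        using response(2) pw[of j] that cr unfolding suc(1) by (cases "j = i") auto
      moreover have "b < Suc t \<and> responses (cfg (Suc t)) b = None \<and>
          (\<exists>x. invoked E b = Some (j, x) \<and> own (S j (Suc t)) = own (S j b) @ [x])"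
        if "pending (cfg (Suc t)) j = Some b" for j b
      proof -
        have j: "j \<noteq> i" "pending (cfg t) j = Some b" using that unfolding suc(1) by (auto split: if_splits)
        then have "b \<noteq> a" using other[OF j(2,1)] x(1) by auto
        then show ?thesis using other[OF j(2,1)] p2(2)[OF j(2)] unfolding suc(2) by simp
      qed
      ultimately have "pending_ok (Suc t)" unfolding pending_ok_def by blast
      moreover have "responses_ok (Suc t)"
        unfolding responses_ok_def
      proof (intro allI impI)
        fix b t' r' assume b: "responses (cfg (Suc t)) b = Some (t', r')"
        show "t' < Suc t \<and> b \<le> t' \<and>
          explained b t' r'"
        proof (cases "b = a")
          case True
          then have "t' = t" "r' = reply (know (S i (Suc t))) v x" using b x(2) unfolding suc(2) by auto
          moreover have "(i, length (own (S i a))) \<in> set v" using response(4) x(2) by simp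
          ultimately show ?thesis using True x(1,3) response(3) by auto
        next
          case False
          then have "responses (cfg t) b = Some (t', r')" using b unfolding suc(2) by simp
          then show ?thesis using r less_SucI by blast
        qed
      qed
      ultimately show ?thesis by blast
    qed
  qed
qed

text \<open>A response goes to a pending command only, and a pending command has none yet; hence
  responses are never overwritten.\<close>

lemma responses_Suc:
  assumes "responses (cfg t) a = Some z"
  shows "responses (cfg (Suc t)) a = Some z"
proof (cases "\<exists>i tr stop. event E t = Step i tr stop")
  case False
  then show ?thesis using assms by (cases "event E t") auto
next
  case True
  then obtain i tr stop where ev: "event E t = Step i tr stop" by blast
  show ?thesis
  proof (cases rule: done_actions_cases[OF ev, case_names silent response])
    case silent
    then show ?thesis using silent_Suc(2)[OF ev silent(1)] assms by simp
  next
    case (response v)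
    have "responses (cfg (Suc t)) a = responses (cfg t) a \<or>
        (if \<exists>x. tr = Invoked x then Some t else pending (cfg t) i) = Some a"
    proof (cases "if \<exists>x. tr = Invoked x then Some t else pending (cfg t) i")
      case None
      then have "\<not> waiting (absorb i (local_event t i tr) (S i t))"
        using pending_responses_ok[of t] steps_lt[of t i "local_event t i tr"] ev
        unfolding pending_ok_def steps_def by (cases tr) (auto simp: local_event_def Let_def)
      then show ?thesis using response(1) by simp
    next
      case (Some b)
      then show ?thesis using response_Suc(2)[OF ev response(5) Some] by auto
    qed
    moreover have "(if \<exists>x. tr = Invoked x then Some t else pending (cfg t) i) \<noteq> Some a"
    proof
      assume eq: "(if \<exists>x. tr = Invoked x then Some t else pending (cfg t) i) = Some a"
      obtain t' r where "responses (cfg t) a = Some (t', r)" using assms by (cases z) auto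
      then have "a \<le> t' \<and> t' < t" using pending_responses_ok[of t] unfolding responses_ok_def by blast
      then have "pending (cfg t) i = Some a" using eq by (simp split: if_splits)
      then have "responses (cfg t) a = None" using pending_responses_ok[of t] unfolding pending_ok_def
        by blast
      then show False using assms by simp
    qed
    ultimately show ?thesis using assms by simp
  qed
qed

lemma responses_mono:
  assumes "t \<le> t'" "responses (cfg t) a = Some z"
  shows "responses (cfg t') a = Some z"
  using assms(1)
proof (induction t' rule: dec_induct)
  case base
  then show ?case by (rule assms(2))
next
  case (step m)
  then show ?case using responses_Suc by blast
qed

lemma completes_unique:
  assumes "completes protocol E a t r" "completes protocol E a t' r'"
  shows "t = t' \<and> r = r'"
proof -
  obtain s s' where "responses (cfg s) a = Some (t, r)" "responses (cfg s') a = Some (t', r')"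
    using assms unfolding completes_def by blast
  moreover have "s \<le> max s s'" "s' \<le> max s s'" by auto
  ultimately have "responses (cfg (max s s')) a = Some (t, r)"
    "responses (cfg (max s s')) a = Some (t', r')"
    using responses_mono by blast+
  then show ?thesis by simp
qed

lemma completesD:
  assumes "completes protocol E a t r"
  obtains i x v where "invoked E a = Some (i, x)" "v \<in> views_at i (Suc t)"
    "(i, length (own (S i a))) \<in> set v" "r = reply (know (S i (Suc t))) v x" "a \<le> t"
proof -
  obtain s where "responses (cfg s) a = Some (t, r)" using assms unfolding completes_def by blast
  then show thesis using pending_responses_ok[of s] that unfolding responses_ok_def by blast
qed

section \<open>Views as sets of invocations\<close>

definition op_id :: "nat \<Rightarrow> nat \<times> nat" where
  "op_id a = (let i = fst (the (invoked E a)) in (i, length (own (S i a))))"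

lemma op_id: "invoked E a = Some (i, x) \<Longrightarrow> op_id a = (i, length (own (S i a)))"
  by (simp add: op_id_def)

lemma inj_on_op_id: "inj_on op_id (commands E)"
proof (rule inj_onI)
  fix a b assume "a \<in> commands E" "b \<in> commands E" "op_id a = op_id b"
  then obtain i x j y where "invoked E a = Some (i, x)" "invoked E b = Some (j, y)"
    by (auto simp: commands_def)
  then show "a = b" using \<open>op_id a = op_id b\<close> invocation_index_inj by (auto simp: op_id)
qed

lemma view_Op:
  assumes "v \<in> views_at l t" "(j, m) \<in> set v"
  shows "\<exists>x. Op j m x \<in> known l t"
proof (cases "n = 1")
  case True
  then have "v = ops (know (S l t))" using assms(1) unfolding set_views if_P[OF True] by simp
  then show ?thesis using assms(2) by (simp add: set_ops)
next
  case False
  then obtain r p es where "v = view r es (know (S l t))" using assms(1)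
    unfolding set_views if_not_P[OF False] by blast
  then obtain X k where "Entry r k X \<in> known l t" "(j, m) \<in> set X" using assms(2) by (auto simp: set_view)
  then show ?thesis using coherent_Entry(3)[OF coherent_know] by blast
qed

definition positions :: "(nat \<times> nat) list \<Rightarrow> nat set" where
  "positions v = {b \<in> commands E. op_id b \<in> set v}"

lemma Op_know:
  assumes "b \<in> commands E" "op_id b = (j, m)" "Op j m x \<in> known l t"
  shows "b < t" "invoked E b = Some (j, x)"
proof -
  obtain a where a: "a < t" "invoked E a = Some (j, x)" "length (own (S j a)) = m"
    using Op_origin[OF assms(3)] by blast
  then have "op_id a = op_id b" using assms(2) by (simp add: op_id)
  moreover have "a \<in> commands E" using a(2) by (auto simp: commands_def)
  ultimately have "a = b" using inj_on_op_id assms(1) by (auto dest: inj_onD)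
  then show "b < t" "invoked E b = Some (j, x)" using a by auto
qed

lemma positions_less:
  assumes "v \<in> views_at l t" "b \<in> positions v"
  shows "b < t"
proof -
  obtain j m where jm: "op_id b = (j, m)" by (cases "op_id b")
  then obtain x where "Op j m x \<in> known l t"
    using view_Op[OF assms(1)] assms(2) by (auto simp: positions_def)
  then show ?thesis using Op_know(1)[OF _ jm] assms(2) by (auto simp: positions_def)
qed

lemma op_id_positions:
  assumes "v \<in> views_at l t"
  shows "op_id ` positions v = set v"
proof
  show "op_id ` positions v \<subseteq> set v" by (auto simp: positions_def)
  show "set v \<subseteq> op_id ` positions v"
  proof
    fix a assume a: "a \<in> set v"
    obtain j m where jm: "a = (j, m)" by (cases a)
    then obtain x where "Op j m x \<in> known l t" using view_Op[OF assms] a by blast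
    then obtain b where "invoked E b = Some (j, x)" "length (own (S j b)) = m" using Op_origin by blast
    then have "op_id b = a" "b \<in> commands E" using jm by (auto simp: op_id commands_def)
    then show "a \<in> op_id ` positions v" using a by (auto simp: positions_def)
  qed
qed

lemma finite_positions: "finite (positions v)"
proof -
  have "inj_on op_id (positions v)"
    using inj_on_op_id by (rule inj_on_subset) (auto simp: positions_def)
  moreover have "finite (op_id ` positions v)"
    by (rule finite_subset[of _ "set v"]) (auto simp: positions_def)
  ultimately show ?thesis using finite_imageD by blast
qed

lemma query_reply:
  assumes M: "update_query_state_machine M" and v: "v \<in> views_at l t"
    and bs: "distinct bs" "set bs = {b \<in> positions v. \<exists>i u. invoked E b = Some (i, Update u)}"
  shows "reply (know (S l t)) v (Query q) = Result (answer M q (fold (apply_command M E) bs (init_state M)))"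
proof -
  let ?K = "know (S l t)"
  define F where "F = (\<lambda>a. case_command (apply_update M) (\<lambda>_ s. s) (SOME x. Op (fst a) (snd a) x \<in> set ?K))"
  have comm: "apply_update M u (apply_update M w s) = apply_update M w (apply_update M u s)" for u w s
    using M by (simp add: update_query_state_machine_def)
  interpret A: comp_fun_commute_on UNIV "apply_command M E"
    by standard (auto simp: fun_eq_iff apply_command_def comm split: option.split command.split)
  have F: "F (op_id b) = apply_command M E b" if "b \<in> positions v" for b
  proof -
    obtain j m where jm: "op_id b = (j, m)" by (cases "op_id b")
    have b: "b \<in> commands E" "(j, m) \<in> set v" using that jm by (auto simp: positions_def)
    obtain x where x: "Op j m x \<in> set ?K" using view_Op[OF v b(2)] by blast
    have "(SOME x. Op j m x \<in> set ?K) = x"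
    proof (rule some_equality)
      fix y assume "Op j m y \<in> set ?K"
      then show "y = x" using Op_know(2)[OF b(1) jm x] Op_know(2)[OF b(1) jm, of y l t] by simp
    qed (rule x)
    then show ?thesis using Op_know(2)[OF b(1) jm x] jm
      by (auto simp: F_def apply_command_def fun_eq_iff split: command.split)
  qed
  \<comment> \<open>The queries in the view. They act as the identity, and appending them to
    \<open>bs\<close> gives the whole view, over which \<open>reply\<close> folds.\<close>
  define cs where "cs = sorted_list_of_set (positions v - set bs)"
  have cs: "distinct cs" "set cs = positions v - set bs" unfolding cs_def using finite_positions by auto
  have id: "apply_command M E b s = s" if b: "b \<in> set cs" for b s
  proof -
    obtain i x where "invoked E b = Some (i, x)" using b cs(2) by (auto simp: positions_def commands_def)
    moreover have "x \<noteq> Update u" for u using b calculation cs(2) bs(2) by auto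
    ultimately show ?thesis by (cases x) (auto simp: apply_command_def)
  qed
  have "fold (apply_command M E) xs s = s" if "set xs \<subseteq> set cs" for xs s
    using that by (induction xs) (auto simp: id)
  then have cs_id: "fold (apply_command M E) cs s = s" for s by blast
  have pos: "positions v = set (bs @ cs)" using cs(2) bs(2) by auto
  have dist: "distinct (bs @ cs)" using bs(1) cs by auto
  have inj: "inj_on op_id (positions v)"
    using inj_on_op_id by (rule inj_on_subset) (auto simp: positions_def)
  \<comment> \<open>Views name commands by node and index, the order to be found names them by
    position; the injective \<open>op_id\<close> transports the fold.\<close>
  have "Finite_Set.fold F (init_state M) (set v) = Finite_Set.fold (F \<circ> op_id) (init_state M) (positions v)"
    unfolding op_id_positions[OF v, symmetric] by (rule fold_image[OF inj])
  also have "\<dots> = Finite_Set.fold (apply_command M E) (init_state M) (positions v)"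
  proof (rule fold_closed_eq[where B = UNIV])
    fix a b assume "a \<in> positions v"
    then show "(F \<circ> op_id) a b = apply_command M E a b" using F by simp
  qed auto
  also have "\<dots> = fold (apply_command M E) (bs @ cs) (init_state M)"
    unfolding pos using A.fold_set_fold_remdups[of "bs @ cs"] dist by (simp add: distinct_remdups_id)
  finally show ?thesis using cs_id unfolding reply_def F_def by simp
qed

lemma linearizable:
  assumes "update_query_state_machine M"
  shows "linearizable M protocol E"
proof -
  define D where "D = {a. \<exists>t r. completes protocol E a t r}"
  define upd where "upd a \<longleftrightarrow> (\<exists>i u. invoked E a = Some (i, Update u))" for a
  have "\<exists>v. \<forall>t r. completes protocol E a t r \<longrightarrow> (\<exists>i x. invoked E a = Some (i, x) \<and> v \<in> views_at i (Suc t) \<and>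
      op_id a \<in> set v \<and> r = reply (know (S i (Suc t))) v x)" if a: "a \<in> D" for a
  proof -
    obtain t r where c: "completes protocol E a t r" using a by (auto simp: D_def)
    then obtain i x v where "invoked E a = Some (i, x)" "v \<in> views_at i (Suc t)"
      "(i, length (own (S i a))) \<in> set v" "r = reply (know (S i (Suc t))) v x" using completesD by blast
    then show ?thesis using completes_unique[OF c] by (intro exI[of _ v]) (auto simp: op_id)
  qed
  then obtain w where w: "\<And>a t r. a \<in> D \<Longrightarrow> completes protocol E a t r \<Longrightarrow>
      \<exists>i x. invoked E a = Some (i, x) \<and> w a \<in> views_at i (Suc t) \<and>
        op_id a \<in> set (w a) \<and> r = reply (know (S i (Suc t))) (w a) x"
    by metis
  define V where "V a = positions (w a)" for a
  have D: "\<exists>i x t. invoked E a = Some (i, x) \<and> w a \<in> views_at i (Suc t) \<and> op_id a \<in> set (w a)"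
    if a: "a \<in> D" for a
  proof -
    obtain t r where c: "completes protocol E a t r" using a by (auto simp: D_def)
    show ?thesis using w[OF a c] by blast
  qed
  have "\<exists>R. R \<subseteq> commands E \<times> commands E \<and> trans R \<and> irrefl R \<and> total_on (commands E) R \<and>
    (\<forall>a\<in>D. \<forall>b\<in>commands E. b \<notin> V a \<longrightarrow> (a, b) \<in> R) \<and>
    (\<forall>a\<in>D. \<not> upd a \<longrightarrow> {b. (b, a) \<in> R \<and> upd b} = {b \<in> V a. upd b})"
  proof (rule linearization_of_views)
    show "D \<subseteq> commands E" using D unfolding commands_def by blast
  next
    fix a assume "a \<in> D"
    then show "a \<in> V a \<and> V a \<subseteq> commands E"
      using D[of a] by (auto simp: V_def positions_def commands_def)
  next
    fix a b assume "a \<in> D" "b \<in> D"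
    then obtain i x t j y s where "invoked E a = Some (i, x)" "w a \<in> views_at i (Suc t)"
      "invoked E b = Some (j, y)" "w b \<in> views_at j (Suc s)" using D by meson
    then have "set (w a) \<subseteq> set (w b) \<or> set (w b) \<subseteq> set (w a)" using views_comparable invokedD(3) by blast
    then show "V a \<subseteq> V b \<or> V b \<subseteq> V a" by (auto simp: V_def positions_def)
  qed
  then obtain R where R: "R \<subseteq> commands E \<times> commands E" "trans R" "irrefl R" "total_on (commands E) R"
    "\<And>a b. a \<in> D \<Longrightarrow> b \<in> commands E \<Longrightarrow> b \<notin> V a \<Longrightarrow> (a, b) \<in> R"
    "\<And>a. a \<in> D \<Longrightarrow> \<not> upd a \<Longrightarrow> {b. (b, a) \<in> R \<and> upd b} = {b \<in> V a. upd b}"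
    by blast
  show ?thesis
    unfolding linearizable_def
  proof (intro exI[of _ R] conjI allI impI ballI)
    fix a b assume b: "b \<in> commands E" and "precedes protocol E a b"
    then obtain t r where c: "completes protocol E a t r" "t < b" by (auto simp: precedes_def)
    then have a: "a \<in> D" by (auto simp: D_def)
    obtain i where "w a \<in> views_at i (Suc t)" using w[OF a c(1)] by blast
    \<comment> \<open>A view contains only commands that have been invoked when it is formed, so a
      command invoked after the completion of \<open>a\<close> lies outside the view of
      \<open>a\<close> and is ordered behind it.\<close>
    then have "b \<notin> V a" using positions_less[of "w a" i "Suc t" b] c(2) by (auto simp: V_def)
    then show "(a, b) \<in> R" using R(5) a b by blast
  next
    fix a i u t r assume "invoked E a = Some (i, Update u) \<and> completes protocol E a t r"
    then show "r = Ack" using w[of a t r] by (auto simp: D_def reply_def)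
  next
    fix a i q t r assume aq: "invoked E a = Some (i, Query q) \<and> completes protocol E a t r"
    then have a: "a \<in> D" by (auto simp: D_def)
    have v: "w a \<in> views_at i (Suc t)" "r = reply (know (S i (Suc t))) (w a) (Query q)"
      using w[OF a, of t r] aq by auto
    have "\<not> upd a" using aq by (auto simp: upd_def)
    then have ub: "updates_before E R a = {b \<in> V a. upd b}"
      using R(6)[OF a] by (simp add: updates_before_def upd_def)
    have fin: "finite {b \<in> V a. upd b}" using finite_positions by (simp add: V_def)
    have "total_on {b \<in> V a. upd b} R"
      by (rule total_on_subset[OF R(4)]) (auto simp: V_def positions_def)
    then obtain bs where bs: "distinct bs" "set bs = {b \<in> V a. upd b}" "sorted_wrt (\<lambda>b b'. (b, b') \<in> R) bs"
      using finite_sorted_list[OF fin R(2,3)] by blast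
    have "r = Result (answer M q (fold (apply_command M E) bs (init_state M)))"
      unfolding v(2) using bs(1,2) by (intro query_reply[OF assms v(1)]) (auto simp: V_def upd_def)
    then show "\<exists>bs. distinct bs \<and> set bs = updates_before E R a \<and> sorted_wrt (\<lambda>b b'. (b, b') \<in> R) bs \<and>
        r = Result (answer M q (fold (apply_command M E) bs (init_state M)))"
      using bs ub by blast
  qed (use R in auto)
qed

section \<open>Message size and delivery\<close>


lemma channel_entry:
  assumes "(m, s) \<in> set (chan t i j)"
  shows "(\<exists>l a. m = [l] \<and> l \<in> set (encode a) \<and> a \<in> set (outbox (S i t) j)) \<and> (\<exists>t'<t. s = time E t')"
  using assms
proof (induction t arbitrary: m s)
  case 0
  then show ?case by (simp add: initial_config_def)
next
  case (Suc t)
  have old: ?case if "(m, s) \<in> set (chan t i j)"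
  proof -
    have "set (outbox (S i t) j) \<subseteq> set (outbox (S i (Suc t)) j)" by (intro set_mono_prefix S_mono) simp
    then show ?thesis using Suc.IH[OF that] less_SucI by blast
  qed
  show ?case
  proof (cases "\<exists>k tr stop. event E t = Step k tr stop")
    case False
    then have "channel (cfg (Suc t)) = channel (cfg t)" by (cases "event E t") auto
    then show ?thesis using Suc.prems old by simp
  next
    case True
    then obtain k tr stop where ev: "event E t = Step k tr stop" by blast
    show ?thesis
    proof (cases "(m, s) \<in> set (chan t i j)")
      case True
      then show ?thesis by (rule old)
    next
      case False
      then have "(m, s) \<notin> set (tl (chan t i j))" by (cases "chan t i j") auto
      then have ki: "k = i" "m \<in> set (sent_to j (done_actions t i stop))" "s = time E t"
        using Suc.prems False unfolding channel_Suc[OF ev] by (auto split: if_splits)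
      then have "m \<in> set (sent_to j (sends i (S i t) (S i (Suc t))))"
        using set_mono_prefix[OF sent_to_done_actions(1)[of j t i stop]] by blast
      then obtain l a where "m = [l]" "l \<in> set (encode a)"
          "a \<in> set (drop (length (outbox (S i t) j)) (outbox (S i (Suc t)) j))"
        unfolding sent_to_sends by (auto split: if_splits)
      then have "\<exists>l a. m = [l] \<and> l \<in> set (encode a) \<and> a \<in> set (outbox (S i (Suc t)) j)"
        using in_set_dropD by fast
      then show ?thesis using ki(3) by blast
    qed
  qed
qed

text \<open>A letter is a bit or a command taken from an item \<open>Op\<close>; such a command has
  been invoked, so its size is bounded by assumption.\<close>

lemma message_size_le:
  assumes "\<And>a i x. invoked E a = Some (i, x) \<Longrightarrow> sz x \<le> b" "m \<in> sent_messages protocol E"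
  shows "message_size sz m \<le> max 1 b"
proof -
  obtain t i j s where "(m, s) \<in> set (chan t i j)" using assms(2) unfolding sent_messages_def by blast
  from channel_entry[OF this] obtain l a
    where m: "m = [l]" "l \<in> set (encode a)" "a \<in> set (outbox (S i t) j)" by blast
  show ?thesis
  proof (cases l)
    case (Bit c)
    then show ?thesis using m(1) by (simp add: message_size_def)
  next
    case (Cmd x)
    then obtain j' m' where "Op j' m' x \<in> set (snd a)" using m(2) Cmd_in_encode by metis
    then obtain c where "invoked E c = Some (j', x)" using outbox_know[OF m(3)] Op_origin by blast
    then show ?thesis using assms(1) m(1) Cmd by (fastforce simp: message_size_def)
  qed
qed

lemma crashed_faulty: "crashed (cfg t) \<subseteq> faulty E"
proof (induction t)
  case 0
  then show ?case by (simp add: initial_config_def)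
next
  case (Suc t)
  show ?case
  proof (cases "event E t")
    case (Step i tr stop)
    then show ?thesis using Suc crashed_Suc[OF Step] by (cases stop) (auto simp: faulty_def)
  next
    case (Crash i)
    then show ?thesis using Suc by (auto simp: faulty_def)
  qed (use Suc in auto)
qed

section \<open>Nonfaulty nodes and reliable delivery\<close>

definition G :: "nat set" where
  "G = {..<n} - faulty E"

lemma finite_G [simp]: "finite G"
  by (simp add: G_def)

lemma faulty_lt: "faulty E \<subseteq> {..<n}"
proof
  fix i assume "i \<in> faulty E"
  then obtain t where "event E t = Crash i \<or> (\<exists>e m. event E t = Step i e (Some m))"
    by (auto simp: faulty_def)
  then consider "event E t = Crash i" | tr m where "event E t = Step i tr (Some m)" by blast
  then show "i \<in> {..<n}"
  proof cases
    case 1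
    then show ?thesis using en[of t] by simp
  next
    case (2 tr m)
    then show ?thesis using en[of t] by (cases tr) auto
  qed
qed

lemma card_faulty: "card (faulty E) \<le> f"
  using run by (simp add: is_execution_def)

lemma card_G: "card G + card (faulty E) = n"
proof -
  have "finite (faulty E)" using faulty_lt finite_subset by blast
  then have "card G = n - card (faulty E)" unfolding G_def using faulty_lt by (simp add: card_Diff_subset)
  then show ?thesis using card_faulty majority by linarith
qed

lemma quorum_meets_G:
  assumes "Q \<subseteq> {..<n}" "n \<le> f + card Q"
  shows "\<exists>l. l \<in> Q \<and> l \<in> G"
  using assms
proof (rule quorums_intersect)
  show "G \<subseteq> {..<n}" by (auto simp: G_def)
  show "n \<le> f + card G" using card_G card_faulty by linarith
qed

lemma G_lt: "i \<in> G \<Longrightarrow> i < n"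
  by (simp add: G_def)

lemma G_not_crashed: "i \<in> G \<Longrightarrow> i \<notin> crashed (cfg t)"
  using crashed_faulty by (auto simp: G_def)

lemma G_no_stop: "i \<in> G \<Longrightarrow> event E t = Step i tr stop \<Longrightarrow> stop = None"
  by (cases stop) (auto simp: G_def faulty_def)

definition received :: "nat \<Rightarrow> nat \<Rightarrow> nat \<Rightarrow> ('u, 'q) letter list" where
  "received t i j = stream (inbox (S j t) i) @ buffer (S j t) i"

lemma received_total:
  assumes "i \<in> G" "j < n" "i \<noteq> j"
  shows "\<exists>ls. length ls = length (chan t i j) \<and>
    received t i j @ ls = stream (outbox (S i t) j)"
proof -
  have "stream_ok t i j" using stream_ok assms G_lt by blast
  then obtain ls where ls: "map fst (chan t i j) = map (\<lambda>l. [l]) ls"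
    "received t i j @ ls = stream (outbox (S i t) j)"
    using G_not_crashed[OF assms(1)] unfolding stream_ok_def received_def by auto
  then show ?thesis using map_eq_imp_length_eq[OF ls(1)] by auto
qed

lemma channel_receive:
  assumes "event E t = Step j (Received i) None"
  shows "chan t i j \<noteq> []" "chan (Suc t) i j = tl (chan t i j)"
proof -
  have "i \<noteq> j" "chan t i j \<noteq> []" using en[of t] assms by auto
  then show "chan t i j \<noteq> []" "chan (Suc t) i j = tl (chan t i j)"
    unfolding channel_Suc[OF assms] by auto
qed

lemma length_received_receive:
  assumes "i \<in> G" "j < n" "event E t = Step j (Received i) None"
  shows "length (received (Suc t) i j) = Suc (length (received t i j))"
proof -
  have ij: "i \<noteq> j" using en[of t] assms(3) by auto
  have "S i (Suc t) = S i t" using S_Suc[OF assms(3)] ij by simp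
  moreover obtain ls where "length ls = length (chan t i j)"
    "received t i j @ ls = stream (outbox (S i t) j)" using received_total[OF assms(1,2) ij] by blast
  moreover obtain ls' where "length ls' = length (chan (Suc t) i j)"
    "received (Suc t) i j @ ls' = stream (outbox (S i (Suc t)) j)" using received_total[OF assms(1,2) ij]
      by blast
  ultimately have "length (received t i j) + length (chan t i j) =
      length (received (Suc t) i j) + length (chan (Suc t) i j)"
    by (metis length_append)
  then show ?thesis using channel_receive[OF assms(3)] by (cases "chan t i j") simp_all
qed

lemma channel_no_receive:
  assumes "j \<in> G" "event E t \<noteq> Step j (Received i) None"
  shows "prefix (chan t i j) (chan (Suc t) i j)" "received (Suc t) i j = received t i j"
proof -
  have nr: "\<not> (k = j \<and> tr = Received i)" if "event E t = Step k tr stop" for k tr stop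
    using that assms G_no_stop by blast
  show "prefix (chan t i j) (chan (Suc t) i j)"
  proof (cases "\<exists>k tr stop. event E t = Step k tr stop")
    case False
    then have "channel (cfg (Suc t)) = channel (cfg t)" by (cases "event E t") auto
    then show ?thesis by simp
  next
    case True
    then obtain k tr stop where ev: "event E t = Step k tr stop" by blast
    then show ?thesis using nr[OF ev] unfolding channel_Suc[OF ev] by auto
  qed
  show "received (Suc t) i j = received t i j"
  proof (cases rule: S_Suc_cases[of j t])
    case 1
    then show ?thesis by (simp add: received_def)
  next
    case (2 e)
    have "e \<noteq> Receipt i m" for m
    proof
      assume "e = Receipt i m"
      then obtain stop where "event E t = Step j (Received i) stop" using steps_Receipt(5) 2(1) by blast
      then show False using nr by blast
    qed
    then show ?thesis unfolding received_def 2(2) step_simps by (simp add: absorb_other)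
  qed
qed

lemma next_receive:
  assumes "i < n" "j \<in> G" "i \<noteq> j" "chan t i j \<noteq> []"
  shows "\<exists>t1\<ge>t. event E t1 = Step j (Received i) None \<and>
    prefix (chan t i j) (chan t1 i j) \<and> received t1 i j = received t i j"
proof -
  have "\<exists>t1\<ge>t. event E t1 = Step j (Received i) None"
    using run assms unfolding is_execution_def G_def by blast
  then obtain t1 where t1: "t \<le> t1" "event E t1 = Step j (Received i) None"
    "\<And>s. t \<le> s \<Longrightarrow> event E s = Step j (Received i) None \<Longrightarrow> t1 \<le> s"
    using LeastI_ex[of "\<lambda>s. t \<le> s \<and> event E s = Step j (Received i) None"]
      Least_le[of "\<lambda>s. t \<le> s \<and> event E s = Step j (Received i) None"] by blast
  have "s \<le> t1 \<Longrightarrow> prefix (chan t i j) (chan s i j) \<and> received s i j = received t i j" if "t \<le> s" for s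
    using that
  proof (induction s rule: dec_induct)
    case (step s)
    then have "event E s \<noteq> Step j (Received i) None" using t1(3)[of s] by force
    note nr = channel_no_receive[OF assms(2) this]
    have IH: "prefix (chan t i j) (chan s i j)" "received s i j = received t i j"
      using step by auto
    show ?case using prefix_order.order_trans[OF IH(1) nr(1)] nr(2) IH(2) by simp
  qed simp
  then show ?thesis using t1 by blast
qed

text \<open>Follows the message at index \<open>q\<close> until it has come to the front and is
  received. The content of the channel is tracked so that the sending time of this message remains
  available for the delay bound.\<close>

lemma eventual_receive:
  assumes "i \<in> G" "j \<in> G" "i \<noteq> j" "q < length (chan t i j)"
  shows "\<exists>t1\<ge>t. event E t1 = Step j (Received i) None \<and>
    prefix (drop q (chan t i j)) (chan t1 i j) \<and>
    length (received t1 i j) = length (received t i j) + q"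
  using assms(4)
proof (induction q)
  case 0
  then have "chan t i j \<noteq> []" by auto
  from next_receive[OF G_lt[OF assms(1)] assms(2,3) this] show ?case by auto
next
  case (Suc q)
  then obtain t1 where t1: "t \<le> t1" "event E t1 = Step j (Received i) None"
    "prefix (drop q (chan t i j)) (chan t1 i j)"
    "length (received t1 i j) = length (received t i j) + q" by auto
  have d: "drop q (chan t i j) = chan t i j ! q # drop (Suc q) (chan t i j)"
    using Suc.prems by (simp add: Cons_nth_drop_Suc)
  then have p: "prefix (drop (Suc q) (chan t i j)) (chan (Suc t1) i j)"
    using t1(3) unfolding channel_receive(2)[OF t1(2)] by (auto simp: prefix_def)
  have "drop (Suc q) (chan t i j) \<noteq> []" using Suc.prems by simp
  then have "chan (Suc t1) i j \<noteq> []" using p by auto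
  from next_receive[OF G_lt[OF assms(1)] assms(2,3) this] obtain t2 where t2: "Suc t1 \<le> t2"
    "event E t2 = Step j (Received i) None" "prefix (chan (Suc t1) i j) (chan t2 i j)"
    "received t2 i j = received (Suc t1) i j" by blast
  have "prefix (drop (Suc q) (chan t i j)) (chan t2 i j)"
    using p t2(3) by (rule prefix_order.order_trans)
  moreover have "length (received t2 i j) = length (received t i j) + Suc q"
    unfolding t2(4) length_received_receive[OF assms(1) G_lt[OF assms(2)] t1(2)] using t1(4) by simp
  moreover have "t \<le> t2" using t1(1) t2(1) by simp
  ultimately show ?case using t2(2) by blast
qed

lemma waiting_not_ready: "waiting (S i t) \<Longrightarrow> \<not> ready i (S i t)"
proof (induction t)
  case 0
  then show ?case by (simp add: init_node_def)
next
  case (Suc t)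
  then show ?case by (cases rule: S_Suc_cases[of i t]) (auto simp: step_waiting)
qed

lemma pending_or_completed:
  assumes "invoked E a = Some (i, x)" "i \<in> G" "a < t"
  shows "pending (cfg t) i = Some a \<or> (\<exists>z. responses (cfg t) a = Some z)"
  using assms(3)
proof (induction t)
  case (Suc t)
  show ?case
  proof (cases "\<exists>k tr stop. event E t = Step k tr stop")
    case False
    then have "a \<noteq> t" using invokedD(1)[OF assms(1)] by blast
    moreover have "pending (cfg (Suc t)) = pending (cfg t)" "responses (cfg (Suc t)) = responses (cfg t)"
      using False by (cases "event E t"; simp)+
    ultimately show ?thesis using Suc by simp
  next
    case True
    then obtain k tr stop where ev: "event E t = Step k tr stop" by blast
    show ?thesis
    proof (cases "\<exists>z. responses (cfg t) a = Some z")
      case True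
      then show ?thesis using responses_Suc by blast
    next
      case False
      have cur: "(if i = k \<and> (\<exists>x. tr = Invoked x) then Some t else pending (cfg t) i) = Some a"
      proof (cases "a = t")
        case True
        then have "i = k" "\<exists>x. tr = Invoked x" using invokedD(1)[OF assms(1)] ev by auto
        then show ?thesis using True by simp
      next
        case a: False
        then have p: "pending (cfg t) i = Some a" using Suc False by simp
        then have "\<not> (i = k \<and> (\<exists>x. tr = Invoked x))" using en[of t] ev by auto
        from if_not_P[OF this] show ?thesis using p by (rule trans)
      qed
      show ?thesis
      proof (cases rule: done_actions_cases[OF ev, case_names silent response])
        case silent
        then show ?thesis using cur unfolding silent_Suc(1)[OF ev silent(1)] by simp
      next
        case (response v)
        let ?r = "reply (know (S k (Suc t))) v (last (own (S k (Suc t))))"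
        have "k \<notin> crashed (cfg t)" using steps_lt ev unfolding steps_def by blast
        moreover have "waiting (S k t) \<or> (\<exists>x. tr = Invoked x)"
          using response(1) by (cases tr) (auto simp: local_event_def Let_def split: if_splits)
        ultimately have "pending (cfg t) k \<noteq> None \<or> (\<exists>x. tr = Invoked x)"
          using pending_responses_ok[of t] unfolding pending_ok_def by blast
        then have "(if \<exists>x. tr = Invoked x then Some t else pending (cfg t) k) \<noteq> None"
          by (cases "\<exists>x. tr = Invoked x") auto
        then obtain b where b: "(if \<exists>x. tr = Invoked x then Some t else pending (cfg t) k) = Some b"
          by blast
        note suc = response_Suc[OF ev response(5) b]
        show ?thesis
        proof (cases "k = i")
          case True
          then have "b = a" using b cur by auto
          then show ?thesis unfolding suc(2) by simp
        next
          case False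
          then show ?thesis using cur unfolding suc(1) by simp
        qed
      qed
    qed
  qed
qed simp

text \<open>A nonfaulty node responds in the very step in which a view first contains its command,
  so the command cannot be pending afterwards.\<close>

lemma completed_by:
  assumes "invoked E a = Some (i, x)" "i \<in> G" "a \<le> t"
    and "v \<in> views_at i (Suc t)" "(i, length (own (S i a))) \<in> set v"
  shows "\<exists>t' r. completes protocol E a t' r \<and> t' \<le> t"
proof -
  have "\<not> pending (cfg (Suc t)) i = Some a"
  proof
    assume p: "pending (cfg (Suc t)) i = Some a"
    then have "waiting (S i (Suc t))" "own (S i (Suc t)) = own (S i a) @ [x]"
      using pending_responses_ok[of "Suc t"] G_not_crashed[OF assms(2)] assms(1)
      unfolding pending_ok_def by (metis option.distinct(1), metis option.inject prod.inject)
    then show False using waiting_not_ready assms(4,5) unfolding ready_def by fastforce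
  qed
  then obtain t' r where "responses (cfg (Suc t)) a = Some (t', r)"
    using pending_or_completed[OF assms(1,2), of "Suc t"] assms(3) by auto
  moreover from this have "t' < Suc t" using pending_responses_ok[of "Suc t"] unfolding responses_ok_def
    by blast
  ultimately show ?thesis unfolding completes_def by (metis less_Suc_eq_le)
qed

end

section \<open>Latency\<close>

context quorum_protocol
begin

text \<open>Bounds the number of classifiers below \<open>p\<close> for sets of at least \<open>n - k\<close> entrants,
  where \<open>k < (s + 1)\<^sup>2\<close>.\<close>

definition descent :: "nat \<Rightarrow> bool list \<Rightarrow> nat" where
  "descent s p = (if lower p = 0 then 3 * s + 2 - length p else upper p - lower p - 1)"

text \<open>As thresholds are positive, \<open>lower p = 0\<close> means that only left turns were
  taken. Then \<open>upper p\<close> is \<open>n\<close> or the last threshold, which lies a square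
  below \<open>n\<close> unless the square has reached \<open>n\<close>; in that case the threshold
  is 1 and \<open>p\<close> is a leaf.\<close>

lemma upper_when_lower_0: "lower p = 0 \<Longrightarrow> leaf p \<or> upper p = n - (length p)\<^sup>2"
proof (induction p)
  case (Cons b p)
  have "\<not> b" using Cons.prems thr_pos[of p] by (cases b) auto
  then show ?case using Cons.prems by (auto simp: leaf_def thr_def cut_def lower_def[symmetric])
qed simp

text \<open>Before the first right turn, the size condition bounds the depth \<open>l\<close> by
  \<open>l\<^sup>2 \<le> k\<close>, hence \<open>l \<le> s\<close>. A left turn uses up one level. A
  right turn leaves an interval of at most \<open>2 * l + 1\<close> sizes, whose linear search takes
  at most \<open>2 * l\<close> steps, fewer than \<open>3 * s + 2 - l\<close>. In the linear search
  the left branch is a leaf at once, and a right turn drops one size.\<close>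

lemma descent_Cons:
  assumes "\<not> leaf p" "\<not> leaf (b # p)" "lower p = 0 \<longrightarrow> n \<le> k + upper p" "k < (Suc s)\<^sup>2"
  shows "descent s (b # p) < descent s p"
proof (cases "lower p = 0")
  case False
  then have "thr p = Suc (lower p)" by (simp add: thr_def cut_def lower_def[symmetric])
  moreover from this have b using assms(2) by (cases b) (auto simp: leaf_def)
  ultimately show ?thesis using False assms(1) by (simp add: descent_def leaf_def)
next
  case True
  define l where "l = length p"
  have u: "upper p = n - l\<^sup>2" "Suc 0 < upper p"
    using upper_when_lower_0[OF True] assms(1) True by (auto simp: l_def leaf_def)
  then have "l\<^sup>2 < n" by simp
  then have "l\<^sup>2 \<le> k" using assms(3) True u(1) by linarith
  then have "l\<^sup>2 < (Suc s)\<^sup>2" using assms(4) by linarith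
  then have ls: "l \<le> s" using power_less_imp_less_base by fastforce
  have t: "thr p = (if (Suc l)\<^sup>2 < n then n - (Suc l)\<^sup>2 else 1)"
    using True by (simp add: thr_def cut_def lower_def[symmetric] l_def)
  have sq: "(Suc l)\<^sup>2 = l\<^sup>2 + 2 * l + 1" by (simp add: power2_eq_square)
  show ?thesis
  proof (cases b)
    case False
    then show ?thesis using True ls by (simp add: descent_def l_def)
  next
    case b: True
    have "upper p - thr p \<le> 2 * l + 1" using u(1) t sq by (auto split: if_splits)
    then show ?thesis using b True ls thr_pos[of p] by (simp add: descent_def l_def)
  qed
qed

end

locale timed_run = protocol_run n f M E for n f and M :: "('s, 'u, 'q, 'r) state_machine" and E +
  fixes D :: real
  assumes D_nonneg: "0 \<le> D" and delays: "d \<in> nonfaulty_delays protocol E \<Longrightarrow> d \<le> D"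
    and several: "2 \<le> n"
begin

definition soon :: "real \<Rightarrow> nat \<Rightarrow> nat \<Rightarrow> bool" where
  "soon c t t' \<longleftrightarrow> t \<le> t' \<and> time E t' \<le> time E t + c * D"

lemma time_mono: "t \<le> t' \<Longrightarrow> time E t \<le> time E t'"
  using run by (auto simp: is_execution_def mono_def)

lemma soon_refl: "0 \<le> c \<Longrightarrow> soon c t t"
  using D_nonneg by (simp add: soon_def)

lemma soon_trans: "soon c t t' \<Longrightarrow> soon c' t' t'' \<Longrightarrow> soon (c + c') t t''"
  by (auto simp: soon_def algebra_simps)

lemma soon_le: "soon c t t' \<Longrightarrow> c \<le> c' \<Longrightarrow> soon c' t t'"
  using mult_right_mono[OF _ D_nonneg, of c c'] by (auto simp: soon_def)

lemma soon_common:
  assumes "finite A" "0 \<le> c" "\<And>x. x \<in> A \<Longrightarrow> \<exists>t'. soon c t t' \<and> P x t'"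
    and mono: "\<And>x t' t''. P x t' \<Longrightarrow> t' \<le> t'' \<Longrightarrow> P x t''"
  shows "\<exists>t'. soon c t t' \<and> (\<forall>x\<in>A. P x t')"
  using assms(1,3)
proof (induction A)
  case empty
  then show ?case using soon_refl[OF assms(2)] by blast
next
  case (insert x A)
  then obtain t1 where t1: "soon c t t1" "\<forall>y\<in>A. P y t1" by auto
  obtain t2 where t2: "soon c t t2" "P x t2" using insert.prems by blast
  have "soon c t (max t1 t2)" using t1(1) t2(1) by (simp add: max_def)
  moreover have "\<forall>y\<in>insert x A. P y (max t1 t2)"
    using mono[of _ t1 "max t1 t2"] mono[of _ t2 "max t1 t2"] t1(2) t2(2) by auto
  ultimately show ?case by blast
qed

text \<open>All letters in the channel after event \<open>t\<close> were sent no later than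
  \<open>time E t\<close>. The last of them arrives within \<open>D\<close>, and by FIFO all others
  are in by then, however long the packets are. \<open>Suc t\<close> denotes the state after event
  \<open>t\<close>.\<close>

lemma delivery:
  assumes "i \<in> G" "j \<in> G" "i \<noteq> j"
  shows "\<exists>t'. soon 1 t t' \<and> prefix (outbox (S i (Suc t)) j) (inbox (S j (Suc t')) i)"
proof -
  let ?N = "length (chan (Suc t) i j)"
  have j: "j < n" using G_lt[OF assms(2)] .
  note tot = received_total[OF assms(1) j assms(3)]
  have fin: "prefix (outbox (S i (Suc t)) j) (inbox (S j (Suc t')) i)"
    if tt: "t \<le> t'" and len: "length (received (Suc t) i j) + ?N \<le> length (received (Suc t') i j)" for t'
  proof -
    obtain ls where ls: "length ls = ?N" "received (Suc t) i j @ ls = stream (outbox (S i (Suc t)) j)"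
      using tot by blast
    obtain ls' where ls': "received (Suc t') i j @ ls' = stream (outbox (S i (Suc t')) j)"
      using tot by blast
    have "prefix (outbox (S i (Suc t)) j) (outbox (S i (Suc t')) j)" using tt by (intro S_mono) simp
    then have p: "prefix (stream (outbox (S i (Suc t)) j)) (received (Suc t') i j @ ls')"
      unfolding ls' by (auto simp: prefix_def)
    have "length (stream (outbox (S i (Suc t)) j)) \<le> length (received (Suc t') i j)"
      using len ls(1) unfolding ls(2)[symmetric] by simp
    then have "prefix (stream (outbox (S i (Suc t)) j)) (received (Suc t') i j)"
      using p prefix_length_prefix[OF p, of "received (Suc t') i j"] by simp
    moreover have "\<And>a. \<not> prefix (encode a) (buffer (S j (Suc t')) i)"
      using stream_ok[OF G_lt[OF assms(1)] j assms(3), of "Suc t'"] unfolding stream_ok_def by blast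
    ultimately show ?thesis unfolding received_def by (rule concat_encode_prefix_of)
  qed
  show ?thesis
  proof (cases "?N = 0")
    case True
    then show ?thesis using fin[of t] soon_refl[of 1 t] by auto
  next
    case False
    then have lt: "?N - 1 < ?N" by simp
    from eventual_receive[OF assms lt] obtain t1
      where t1: "Suc t \<le> t1" "event E t1 = Step j (Received i) None"
      "prefix (drop (?N - 1) (chan (Suc t) i j)) (chan t1 i j)"
      "length (received t1 i j) = length (received (Suc t) i j) + (?N - 1)" by blast
    have "drop (?N - 1) (chan (Suc t) i j) = [last (chan (Suc t) i j)]"
      using False by (metis append_butlast_last_id append_eq_conv_conj length_0_conv length_butlast)
    then have hd: "hd (chan t1 i j) = last (chan (Suc t) i j)"
      using t1(3) by (auto simp: prefix_def)
    obtain m s where ms: "last (chan (Suc t) i j) = (m, s)" by (cases "last (chan (Suc t) i j)")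
    have "(m, s) \<in> set (chan (Suc t) i j)" using ms False last_in_set by (metis length_0_conv)
    then obtain t0 where "t0 < Suc t" "s = time E t0" using channel_entry by blast
    then have s: "s \<le> time E t" using time_mono by auto
    have "time E t1 - snd (hd (chan t1 i j)) \<in> nonfaulty_delays protocol E"
      using assms t1(2) unfolding nonfaulty_delays_def G_def by blast
    then have "time E t1 - s \<le> D" using delays unfolding hd ms by simp
    then have "soon 1 t t1" using s t1(1) by (simp add: soon_def)
    moreover have "prefix (outbox (S i (Suc t)) j) (inbox (S j (Suc t1)) i)"
      using t1(1,4) False length_received_receive[OF assms(1) j t1(2)] by (intro fin) auto
    ultimately show ?thesis by blast
  qed
qed

section \<open>Pace of the rounds\<close>

abbreviation rounds :: "nat \<Rightarrow> nat \<Rightarrow> nat" where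
  "rounds i t \<equiv> length (starts (S i t))"

lemma rounds_mono: "t \<le> t' \<Longrightarrow> rounds i t \<le> rounds i t'"
  using S_mono(2) suffix_length_le by blast

lemma started_if_step:
  assumes "steps t i e"
  shows "3 \<le> rounds i (Suc t)"
proof -
  have i: "i < n" using steps_lt[OF assms] by simp
  have S': "S i (Suc t) = step i (S i t) e" using steps_S[OF assms, of i] by simp
  show ?thesis
  proof (cases "rounds i t = 2")
    case True
    have "{j. j < n \<and> j \<noteq> i \<and> length (starts (absorb i e (S i t))) \<le> length (replies (inbox (absorb i e (S i t)) j)) + 2} = {..<n} - {i}"
      using True by auto
    then have "quorum_replied i (absorb i e (S i t))" using i unfolding quorum_replied_def by simp
    then show ?thesis unfolding S' using True by (cases rule: step_cases[of i e "S i t"]) auto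
  next
    case False
    then show ?thesis using length_starts[of i t] rounds_mono[of t "Suc t" i] by simp
  qed
qed

lemma started_if_inbox:
  assumes "inbox (S l t) j \<noteq> []"
  shows "3 \<le> rounds l t"
  using assms
proof (induction t)
  case 0
  then show ?case by (simp add: init_node_def)
next
  case (Suc t)
  show ?case
  proof (cases rule: S_Suc_cases[of l t])
    case 1
    then show ?thesis using Suc by simp
  next
    case (2 e)
    then show ?thesis using started_if_step by blast
  qed
qed

text \<open>A node checks for a quorum at each of its events, so a completed round never stays open.
  Nor is a round complete when it has just been opened: nobody has replied more often than he was
  asked, and as \<open>2 \<le> n\<close>, the node alone is no quorum.\<close>

lemma not_quorum_replied:
  assumes "i < n" "3 \<le> rounds i t"
  shows "\<not> quorum_replied i (S i t)"
  using assms(2)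
proof (induction t)
  case 0
  then show ?case by (simp add: init_node_def)
next
  case (Suc t)
  show ?case
  proof (cases rule: S_Suc_round_cases[of i t])
    case unchanged
    then show ?thesis using Suc by simp
  next
    case (quiet e)
    have "starts (S i (Suc t)) = starts (absorb i e (S i t))"
      "inbox (S i (Suc t)) = inbox (absorb i e (S i t))"
      using quiet(3,5) by simp_all
    then show ?thesis using quiet(4) unfolding quorum_replied_def by simp
  next
    case (round e A' A B)
    have "\<not> rounds i (Suc t) \<le> length (replies (inbox (S i (Suc t)) l)) + 2" if l: "l < n" "l \<noteq> i" for l
    proof -
      have "length (replies (inbox (S i (Suc t)) l)) \<le> length (replies (outbox (S l (Suc t)) i))"
        using l assms(1) by (intro prefix_length_le prefix_replies inbox_prefix_outbox) auto
      also have "S l (Suc t) = S l t" using steps_S[OF round(1), of l] l by simp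
      also have "length (replies (outbox (S l t) i)) = length (requests (inbox (S l t) i))"
        by (rule length_replies_requests)
      also have "\<dots> \<le> length (requests (outbox (S i t) l))"
        using l assms(1) by (intro prefix_length_le prefix_requests inbox_prefix_outbox) auto
      finally show ?thesis
        using round_ends_Suc(3)[OF round(2)] by (simp add: starts_requests[of i t l])
    qed
    then have e: "{l. l < n \<and> l \<noteq> i \<and> rounds i (Suc t) \<le> length (replies (inbox (S i (Suc t)) l)) + 2} = {}" by blast
    show ?thesis unfolding quorum_replied_def e using several majority by simp
  qed
qed

text \<open>Request and reply take one delay each. The replies of the nonfaulty nodes suffice for a
  quorum, so a round still open when they are in would contradict
  \<open>not_quorum_replied\<close>.\<close>

lemma round_progress:
  assumes "i \<in> G" "3 \<le> rounds i (Suc t)"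
  shows "\<exists>t'. soon 2 t t' \<and> rounds i (Suc t) < rounds i (Suc t')"
proof -
  define L where "L = rounds i (Suc t)"
  have ex: "\<exists>t'. soon 2 t t' \<and> L \<le> length (replies (inbox (S i (Suc t')) l)) + 2" if "l \<in> G - {i}" for l
  proof -
    have l: "l \<in> G" "l \<noteq> i" using that by auto
    from delivery[OF assms(1) l(1)] l(2) obtain t1 where t1: "soon 1 t t1"
      "prefix (outbox (S i (Suc t)) l) (inbox (S l (Suc t1)) i)" by metis
    from delivery[OF l(1) assms(1)] l(2) obtain t2 where t2: "soon 1 t1 t2"
      "prefix (outbox (S l (Suc t1)) i) (inbox (S i (Suc t2)) l)" by metis
    have "L = length (requests (outbox (S i (Suc t)) l)) + 2"
      unfolding L_def by (simp add: starts_requests[of i "Suc t" l])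
    also have "length (requests (outbox (S i (Suc t)) l)) \<le> length (requests (inbox (S l (Suc t1)) i))"
      using t1(2) by (intro prefix_length_le prefix_requests)
    also have "\<dots> = length (replies (outbox (S l (Suc t1)) i))" by (rule length_replies_requests[symmetric])
    also have "\<dots> \<le> length (replies (inbox (S i (Suc t2)) l))"
      using t2(2) by (intro prefix_length_le prefix_replies)
    finally show ?thesis using soon_trans[OF t1(1) t2(1)] by auto
  qed
  have "\<exists>t'. soon 2 t t' \<and> (\<forall>l\<in>G - {i}. L \<le> length (replies (inbox (S i (Suc t')) l)) + 2)"
  proof (rule soon_common)
    fix l t' t'' assume l: "L \<le> length (replies (inbox (S i (Suc t')) l)) + 2" "t' \<le> (t'' :: nat)"
    have "length (replies (inbox (S i (Suc t')) l)) \<le> length (replies (inbox (S i (Suc t'')) l))"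
      using l(2) by (intro prefix_length_le prefix_replies S_mono) simp
    then show "L \<le> length (replies (inbox (S i (Suc t'')) l)) + 2" using l(1) by simp
  qed (use ex in auto)
  then obtain T where T: "soon 2 t T" "\<And>l. l \<in> G - {i} \<Longrightarrow> L \<le> length (replies (inbox (S i (Suc T)) l)) + 2"
    by blast
  have le: "L \<le> rounds i (Suc T)" unfolding L_def using T(1) by (intro rounds_mono) (simp add: soon_def)
  have "rounds i (Suc T) \<noteq> L"
  proof
    assume eq: "rounds i (Suc T) = L"
    let ?W = "{l. l < n \<and> l \<noteq> i \<and> rounds i (Suc T) \<le> length (replies (inbox (S i (Suc T)) l)) + 2}"
    have "G - {i} \<subseteq> ?W" using T(2) G_lt unfolding eq by blast
    then have "card (G - {i}) \<le> card ?W" by (intro card_mono) auto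
    moreover have "card (G - {i}) = card G - 1" using assms(1) by simp
    ultimately have "quorum_replied i (S i (Suc T))"
      unfolding quorum_replied_def using card_G card_faulty by linarith
    moreover have "3 \<le> rounds i (Suc T)" using eq assms(2) unfolding L_def by simp
    ultimately show False using not_quorum_replied G_lt[OF assms(1)] by blast
  qed
  then show ?thesis using T(1) le unfolding L_def by (intro exI[of _ T]) simp
qed

lemma rounds_progress:
  assumes "i \<in> G" "3 \<le> rounds i (Suc t)"
  shows "\<exists>t'. soon (2 * real m) t t' \<and> rounds i (Suc t) + m \<le> rounds i (Suc t')"
proof (induction m)
  case 0
  then show ?case using soon_refl[of 0 t] by auto
next
  case (Suc m)
  then obtain t1 where t1: "soon (2 * real m) t t1" "rounds i (Suc t) + m \<le> rounds i (Suc t1)" by blast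
  moreover from this have "3 \<le> rounds i (Suc t1)" using assms(2) by simp
  from round_progress[OF assms(1) this] obtain t2
    where t2: "soon 2 t1 t2" "rounds i (Suc t1) < rounds i (Suc t2)"
    by blast
  have "soon (2 * real (Suc m)) t t2" using soon_trans[OF t1(1) t2(1)] by (simp add: algebra_simps)
  then show ?case using t1(2) t2(2) by (intro exI[of _ t2]) simp
qed

lemma rounds_crossing:
  assumes "rounds i a \<le> m" "m < rounds i b"
  shows "\<exists>s A' A B. a \<le> s \<and> s < b \<and> rounds i s = m \<and> round_ends s i A' A B"
  using assms(2)
proof (induction b)
  case 0
  then show ?case using assms(1) rounds_mono[of 0 a i] by simp
next
  case (Suc b)
  show ?case
  proof (cases "m < rounds i b")
    case True
    then show ?thesis using Suc.IH less_SucI by blast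
  next
    case False
    have ab: "a \<le> b"
    proof (rule ccontr)
      assume "\<not> a \<le> b"
      then show False using rounds_mono[of "Suc b" a i] assms(1) Suc.prems by simp
    qed
    show ?thesis
    proof (cases rule: S_Suc_round_cases[of i b])
      case unchanged
      then show ?thesis using False Suc.prems by simp
    next
      case (quiet e)
      then show ?thesis using False Suc.prems by simp
    next
      case (round e A' A B)
      have "rounds i b = m" using round_ends_Suc(3)[OF round(2)] False Suc.prems by simp
      then show ?thesis using round(2) ab by blast
    qed
  qed
qed

lemma know_in_starts:
  assumes "rounds i a < rounds i b"
  shows "\<exists>s. a \<le> s \<and> s < b \<and> rounds i s = rounds i a \<and>
    suffix (know (S i (Suc s)) # starts (S i s)) (starts (S i b))"
proof -
  obtain s A' A B where s: "a \<le> s" "s < b" "rounds i s = rounds i a" "round_ends s i A' A B"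
    using rounds_crossing[OF order_refl assms] by blast
  have "suffix (starts (S i (Suc s))) (starts (S i b))" using s(2) by (intro S_mono) simp
  then show ?thesis using s round_ends_Suc(3)[OF s(4)] by (intro exI[of _ s]) simp
qed

text \<open>The round running at \<open>a\<close> may have started too early. The next one starts
  with the knowledge at \<open>a\<close>, and the one after it has that start as its
  \<open>A'\<close>; so three rounds have to end.\<close>

lemma third_round:
  assumes "rounds i a + 3 \<le> rounds i b"
  shows "\<exists>s A' A B. s < b \<and> round_ends s i A' A B \<and> known i a \<subseteq> set A'"
proof -
  obtain s A' A B where s: "a \<le> s" "s < b" "rounds i s = Suc (Suc (rounds i a))" "round_ends s i A' A B"
    using rounds_crossing[of i a "Suc (Suc (rounds i a))" b] assms by auto
  obtain s2 where s2: "a \<le> s2" "s2 < s" "rounds i s2 = rounds i a"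
    "suffix (know (S i (Suc s2)) # starts (S i s2)) (starts (S i s))"
    using know_in_starts[of i a s] s(3) by auto
  obtain Ks where Ks: "starts (S i s) = Ks @ know (S i (Suc s2)) # starts (S i s2)"
    using s2(4) by (auto simp: suffix_def)
  then have "length Ks = 1" using s(3) s2(3) by simp
  then have "starts (S i s) ! 1 = know (S i (Suc s2))" unfolding Ks by (cases Ks) auto
  then have "A' = know (S i (Suc s2))" using s(4) by (auto simp: round_ends_def)
  then show ?thesis using s know_mono[of a "Suc s2" i] s2(1) by (intro exI[of _ s]) auto
qed

definition started :: "nat \<Rightarrow> bool" where
  "started t \<longleftrightarrow> (\<forall>i\<in>G. 3 \<le> rounds i t)"

lemma started_mono: "started t \<Longrightarrow> t \<le> t' \<Longrightarrow> started t'"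
  unfolding started_def using rounds_mono order_trans by blast

lemma Level_0_know: "Level 0 \<in> known i t"
  using know_mono[of 0 t i] by (auto simp: init_node_def)

lemma know_spreads:
  assumes "i \<in> G" "l \<in> G" "rounds i (Suc t) < rounds i (Suc t')" "t \<le> t'"
  shows "\<exists>t''. soon 1 t' t'' \<and> known i (Suc t) \<subseteq> known l (Suc t'')"
proof (cases "l = i")
  case True
  then show ?thesis using know_mono[of "Suc t" "Suc t'" i] assms(4) soon_refl[of 1 t'] by auto
next
  case False
  obtain s where s: "Suc t \<le> s" "suffix (know (S i (Suc s)) # starts (S i s)) (starts (S i (Suc t')))"
    using know_in_starts[OF assms(3)] by blast
  let ?K = "know (S i (Suc s))"
  have "?K \<in> set (starts (S i (Suc t')))" using s(2) by (auto simp: suffix_def)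
  moreover have "?K \<noteq> []" using Level_0_know[of i "Suc s"] by auto
  ultimately have "?K \<in> set (requests (outbox (S i (Suc t')) l))"
    unfolding starts_requests[of i "Suc t'" l] by auto
  then have out: "(True, ?K) \<in> set (outbox (S i (Suc t')) l)" by (simp add: set_requests)
  obtain t'' where t'': "soon 1 t' t''" "prefix (outbox (S i (Suc t')) l) (inbox (S l (Suc t'')) i)"
    using delivery[OF assms(1,2)] False by metis
  have "(True, ?K) \<in> set (inbox (S l (Suc t'')) i)" using out set_mono_prefix[OF t''(2)] by blast
  then have "set ?K \<subseteq> known l (Suc t'')" using inbox_know by fastforce
  moreover have "known i (Suc t) \<subseteq> set ?K" using s(1) by (intro know_mono) simp
  ultimately show ?thesis using t''(1) by blast
qed

section \<open>Phases\<close>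

abbreviation spread :: "nat \<Rightarrow> nat \<Rightarrow> bool" where
  "spread t t' \<equiv> \<forall>i\<in>G. \<forall>l\<in>G. known i t \<subseteq> known l t'"

abbreviation collected :: "nat \<Rightarrow> nat \<Rightarrow> nat \<Rightarrow> bool" where
  "collected i t t' \<equiv> \<exists>s A' A B. s < t' \<and> round_ends s i A' A B \<and> known i t \<subseteq> set A'"

text \<open>Three rounds of two delays each for \<open>collected\<close>, and one more delay for the
  broadcasts to arrive and yield \<open>spread\<close>.\<close>

lemma phase:
  assumes "started (Suc t)"
  shows "\<exists>t'. soon 7 t t' \<and>
    spread (Suc t) (Suc t') \<and>
    (\<forall>i\<in>G. collected i (Suc t) (Suc t'))"
proof -
  have "\<exists>t'. soon 6 t t' \<and> (\<forall>i\<in>G. rounds i (Suc t) + 3 \<le> rounds i (Suc t'))"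
  proof (rule soon_common)
    fix i assume i: "i \<in> G"
    then show "\<exists>t'. soon 6 t t' \<and> rounds i (Suc t) + 3 \<le> rounds i (Suc t')"
      using rounds_progress[OF i, of t 3] assms unfolding started_def by simp
  next
    fix i t' t'' assume "rounds i (Suc t) + 3 \<le> rounds i (Suc t')" "t' \<le> (t'' :: nat)"
    then show "rounds i (Suc t) + 3 \<le> rounds i (Suc t'')" using rounds_mono[of "Suc t'" "Suc t''" i] by simp
  qed auto
  then obtain t1 where t1: "soon 6 t t1" "\<And>i. i \<in> G \<Longrightarrow> rounds i (Suc t) + 3 \<le> rounds i (Suc t1)" by blast
  have tt1: "t \<le> t1" using t1(1) by (simp add: soon_def)
  have "\<exists>t'. soon 1 t1 t' \<and> (\<forall>il\<in>G \<times> G. known (fst il) (Suc t) \<subseteq> known (snd il) (Suc t'))"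
  proof (rule soon_common)
    fix il assume "il \<in> G \<times> G"
    then have il: "fst il \<in> G" "snd il \<in> G" by auto
    have "rounds (fst il) (Suc t) < rounds (fst il) (Suc t1)" using t1(2)[OF il(1)] by simp
    then show "\<exists>t'. soon 1 t1 t' \<and> known (fst il) (Suc t) \<subseteq> known (snd il) (Suc t')"
      using il tt1 by (intro know_spreads) auto
  next
    fix il t' t'' assume "known (fst il) (Suc t) \<subseteq> known (snd il) (Suc t')" "t' \<le> (t'' :: nat)"
    then show "known (fst il) (Suc t) \<subseteq> known (snd il) (Suc t'')"
      using know_mono[of "Suc t'" "Suc t''" "snd il"] by auto
  qed auto
  then obtain t2 where t2: "soon 1 t1 t2"
    "\<And>i l. i \<in> G \<Longrightarrow> l \<in> G \<Longrightarrow> known i (Suc t) \<subseteq> known l (Suc t2)" by auto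
  show ?thesis
  proof (rule exI[of _ t2], intro conjI ballI)
    show "soon 7 t t2" using soon_trans[OF t1(1) t2(1)] by simp
  next
    fix i l assume "i \<in> G" "l \<in> G"
    then show "known i (Suc t) \<subseteq> known l (Suc t2)" by (rule t2(2))
  next
    fix i assume i: "i \<in> G"
    have le: "Suc t1 \<le> Suc t2" using t2(1) by (simp add: soon_def)
    obtain s A' A B where "s < Suc t1" "round_ends s i A' A B" "known i (Suc t) \<subseteq> set A'"
      using third_round[OF t1(2)[OF i]] by blast
    then show "collected i (Suc t) (Suc t2)"
      using order_less_le_trans[OF _ le] by blast
  qed
qed

section \<open>Descent through one agreement\<close>

lemma round_know:
  assumes "round_ends s i A' A B" "s < t"
  shows "set B \<subseteq> known i t" "set (derived i A' A B) \<subseteq> known i t"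
proof -
  have "known i (Suc s) \<subseteq> known i t" using assms(2) by (intro know_mono) simp
  then show "set B \<subseteq> known i t" "set (derived i A' A B) \<subseteq> known i t"
    unfolding round_ends_Suc(2)[OF assms(1)] by auto
qed

text \<open>One phase provides a round with the set in its \<open>A'\<close>, so the set passes to
  the left unless the threshold is exceeded. If it is, the excess is known after this phase, and a
  second phase provides a round that starts with it and collects to the right. Hence 14.\<close>

lemma classify:
  assumes "started (Suc t)" "i \<in> G" "Val r p es \<in> known i (Suc t)" "\<not> leaf p"
  shows "\<exists>t' b es'. soon 14 t t' \<and> Val r (b # p) es' \<in> known i (Suc t') \<and>
    card (set es) \<le> card (set es') \<and> (\<not> b \<longrightarrow> card (set es') \<le> thr p)"
proof -
  obtain t1 where t1: "soon 7 t t1"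
    "collected i (Suc t) (Suc t1)"
    using phase[OF assms(1)] assms(2) by fast
  then obtain s A' A B where s: "s < Suc t1" "round_ends s i A' A B" "Val r p es \<in> set A'" using assms(3)
    by blast
  then have "Val r p es \<in> set B" using round_ends_subset(1,3)[OF s(2)] by blast
  then have es: "set es \<subseteq> set (pool r p B)" by (auto simp: set_pool)
  show ?thesis
  proof (cases "card (set (pool r p B)) \<le> thr p")
    case True
    have "card (set es) \<le> card (set (pool r p B))" using es by (intro card_mono) auto
    moreover have "Val r (False # p) es \<in> set (derived i A' A B)"
      unfolding Val_False_derived using s(3) assms(4) True by blast
    moreover have "soon 14 t t1" using soon_le[OF t1(1)] by simp
    ultimately show ?thesis
      using round_know(2)[OF s(2,1)] True \<open>card (set es) \<le> card (set (pool r p B))\<close>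
      by (meson order_refl order_trans subsetD)
  next
    case False
    have "started (Suc t1)" using assms(1) started_mono t1(1) by (simp add: soon_def)
    then obtain t2 where t2: "soon 7 t1 t2"
      "collected i (Suc t1) (Suc t2)"
      using phase[of t1] assms(2) by fast
    then obtain s2 A2' A2 B2 where s2: "s2 < Suc t2" "round_ends s2 i A2' A2 B2"
      "known i (Suc t1) \<subseteq> set A2'"
      by blast
    have BA: "set B \<subseteq> set A2" using round_know(1)[OF s(2,1)] s2(3) round_ends_subset(1)[OF s2(2)] by blast
    then have "thr p < card (set (pool r p A2))" using card_pool_mono[OF BA, of r p] False by linarith
    moreover have "Val r p es \<in> set A2" using BA \<open>Val r p es \<in> set B\<close> by blast
    ultimately have "Val r (True # p) (pool r p B2) \<in> set (derived i A2' A2 B2)"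
      unfolding Val_True_derived using assms(4) by blast
    moreover have "Val r p es \<in> set B2" using \<open>Val r p es \<in> set A2\<close> round_ends_subset(3)[OF s2(2)] by blast
    then have "card (set es) \<le> card (set (pool r p B2))"
      by (intro card_mono[OF finite_set]) (auto simp: set_pool)
    moreover have "soon 14 t t2" using soon_trans[OF t1(1) t2(1)] by simp
    ultimately show ?thesis using round_know(2)[OF s2(2,1)] by blast
  qed
qed

text \<open>Sizes never decrease on the way down, so the set keeps lacking at most \<open>k\<close>
  of the \<open>n\<close> nodes; together with the premise on \<open>upper p\<close> this is the
  size condition of \<open>descent_Cons\<close>. The \<open>+ 1\<close> pays for the step into a
  leaf, to which \<open>descent_Cons\<close> does not apply.\<close>

lemma reach_leaf:
  assumes "started (Suc t)" "i \<in> G" "Val r p es \<in> known i (Suc t)"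
    and "n \<le> k + card (set es)" "lower p = 0 \<longrightarrow> card (set es) \<le> upper p" "k < (Suc s)\<^sup>2"
  shows "\<exists>t' p' es'. soon (14 * (real (descent s p) + 1)) t t' \<and> leaf p' \<and> Val r p' es' \<in> known i (Suc t')"
  using assms(1,3-5)
proof (induction "descent s p" arbitrary: t p es rule: less_induct)
  case less
  show ?case
  proof (cases "leaf p")
    case True
    then show ?thesis using less.prems(2) soon_refl by (intro exI[of _ t]) auto
  next
    case False
    obtain t1 b es' where t1: "soon 14 t t1" "Val r (b # p) es' \<in> known i (Suc t1)"
      "card (set es) \<le> card (set es')" "\<not> b \<longrightarrow> card (set es') \<le> thr p"
      using classify[OF less.prems(1) assms(2) less.prems(2) False] by blast
    show ?thesis
    proof (cases "leaf (b # p)")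
      case True
      then show ?thesis using t1(2) soon_le[OF t1(1), of "14 * (real (descent s p) + 1)"]
        by (intro exI[of _ t1] exI[of _ "b # p"]) auto
    next
      case nl: False
      have desc: "descent s (b # p) < descent s p"
        using less.prems(3,4) by (intro descent_Cons[OF False nl _ assms(6)]) auto
      have st: "started (Suc t1)" using less.prems(1) started_mono t1(1) by (simp add: soon_def)
      have big: "n \<le> k + card (set es')" using less.prems(3) t1(3) by linarith
      have "lower (b # p) = 0 \<longrightarrow> card (set es') \<le> upper (b # p)"
        using t1(4) thr_pos[of p] by (cases b) auto
      from less.hyps[OF desc st t1(2) big this]
      obtain t2 p' es'' where t2: "soon (14 * (real (descent s (b # p)) + 1)) t1 t2" "leaf p'"
        "Val r p' es'' \<in> known i (Suc t2)"
        by (elim exE conjE)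
      have "soon (14 + 14 * (real (descent s (b # p)) + 1)) t t2" using soon_trans[OF t1(1) t2(1)] .
      moreover have "14 + 14 * (real (descent s (b # p)) + 1) \<le> 14 * (real (descent s p) + 1)"
        using desc by simp
      ultimately show ?thesis using soon_le t2(2,3) by blast
    qed
  qed
qed

text \<open>Three phases for the nonfaulty nodes to enter, for their entries to spread, and for one
  node to launch a set of at least \<open>card G\<close> entrants; then the descent from the root,
  where \<open>descent s []\<close> is \<open>3 * s + 2\<close>; then one phase to announce the next
  level and one to spread it. This makes \<open>5 * 7 + 14 * (3 * s + 3)\<close> delays.\<close>

lemma next_level:
  assumes "started (Suc t)" "\<And>i. i \<in> G \<Longrightarrow> Level r \<in> known i (Suc t)"
    and "card (faulty E) < (Suc s)\<^sup>2"
  shows "\<exists>t'. soon (42 * real s + 77) t t' \<and> (\<forall>i\<in>G. Level (Suc r) \<in> known i (Suc t'))"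
proof -
  have le: "a \<le> b" if "soon c a b" for a b c using that by (simp add: soon_def)
  obtain t1 where t1: "soon 7 t t1"
    "\<forall>i\<in>G. collected i (Suc t) (Suc t1)"
    using phase[OF assms(1)] by fast
  have st1: "started (Suc t1)" using started_mono[OF assms(1)] le[OF t1(1)] by simp
  have entry: "\<exists>X. Entry r i X \<in> known i (Suc t1)" if i: "i \<in> G" for i
  proof -
    obtain s A' A B where s: "s < Suc t1" "round_ends s i A' A B" "known i (Suc t) \<subseteq> set A'"
      using t1(2) i by blast
    have "Level r \<in> set A" using assms(2)[OF i] s(3) round_ends_subset(1)[OF s(2)] by blast
    then have "(\<exists>X. Entry r i X \<in> set B) \<or> Entry r i (ops B) \<in> set (derived i A' A B)"
      unfolding Entry_derived by blast
    then show ?thesis using round_know[OF s(2,1)] by blast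
  qed
  obtain t2 where t2: "soon 7 t1 t2"
    "spread (Suc t1) (Suc t2)"
    using phase[OF st1] by fast
  have st2: "started (Suc t2)" using started_mono[OF st1] le[OF t2(1)] by simp
  obtain t3 where t3: "soon 7 t2 t3"
    "\<forall>i\<in>G. collected i (Suc t2) (Suc t3)"
    using phase[OF st2] by fast
  have st3: "started (Suc t3)" using started_mono[OF st2] le[OF t3(1)] by simp
  have "G \<noteq> {}" using card_G card_faulty majority by auto
  then obtain i where i: "i \<in> G" by blast
  obtain u A' A B where u: "u < Suc t3" "round_ends u i A' A B" "known i (Suc t2) \<subseteq> set A'"
    using t3(2) i by blast
  have A: "known i (Suc t2) \<subseteq> set A" using u(3) round_ends_subset(1)[OF u(2)] by blast
  have "\<exists>t5. soon (14 * (3 * real s + 3) + 7) t3 t5 \<and> Level (Suc r) \<in> known i (Suc t5)"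
  \<comment> \<open>With entrants at hand, a launch is refused only to a node that has heard of a
    higher level. Levels are closed downwards, so this node knows level \<open>Suc r\<close>
    already.\<close>
  proof (cases "\<exists>r'>r. Level r' \<in> set B")
    case True
    then obtain r' where "r < r'" "Level r' \<in> set B" by blast
    then have "Level (Suc r) \<in> set B" using coherent_Level_le[OF coherent_round[OF u(2)], of r' "Suc r"]
      by simp
    then have "Level (Suc r) \<in> known i (Suc t3)" using round_know(1)[OF u(2,1)] by blast
    then show ?thesis using soon_refl[of "14 * (3 * real s + 3) + 7" t3] by auto
  next
    case False
    have G: "G \<subseteq> set (entrants r A)"
    proof
      fix l assume "l \<in> G"
      then obtain X where "Entry r l X \<in> known i (Suc t2)" using entry t2(2) i by blast
      then show "l \<in> set (entrants r A)" using A by (auto simp: set_entrants)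
    qed
    then have ne: "entrants r A \<noteq> []" using i by auto
    have "Level r \<in> known i (Suc t2)"
      using assms(2)[OF i] know_mono[of "Suc t" "Suc t2" i] le[OF t1(1)] le[OF t2(1)] by auto
    then have "Level r \<in> set A" using A by blast
    then have "Val r [] (entrants r A) \<in> set (derived i A' A B)"
      unfolding Val_Nil_derived using ne False by blast
    then have V: "Val r [] (entrants r A) \<in> known i (Suc t3)" using round_know(2)[OF u(2,1)] by blast
    have "card G \<le> card (set (entrants r A))" using G by (intro card_mono) auto
    then have big: "n \<le> card (faulty E) + card (set (entrants r A))" using card_G by linarith
    have "set (entrants r A) \<subseteq> {..<n}" using ever_Val_lt[of r "[]" "entrants r A"] V unfolding ever_def
      by blast
    then have "card (set (entrants r A)) \<le> n" using card_mono[of "{..<n}" "set (entrants r A)"] by simp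
    then obtain t4 p es where t4: "soon (14 * (real (descent s []) + 1)) t3 t4" "leaf p"
      "Val r p es \<in> known i (Suc t4)"
      using reach_leaf[OF st3 i V big _ assms(3)] by auto
    have st4: "started (Suc t4)" using started_mono[OF st3] le[OF t4(1)] by simp
    obtain t5 where t5: "soon 7 t4 t5"
      "\<forall>i\<in>G. collected i (Suc t4) (Suc t5)"
      using phase[OF st4] by fast
    obtain w A1' A1 B1 where w: "w < Suc t5" "round_ends w i A1' A1 B1" "known i (Suc t4) \<subseteq> set A1'"
      using t5(2) i by blast
    have "Val r p es \<in> set B1" using t4(3) w(3) round_ends_subset(1,3)[OF w(2)] by blast
    then have "Level (Suc r) \<in> set (derived i A1' A1 B1)" unfolding Level_derived using t4(2) by blast
    then have "Level (Suc r) \<in> known i (Suc t5)" using round_know(2)[OF w(2,1)] by blast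
    moreover have "soon (14 * (3 * real s + 3) + 7) t3 t5"
      using soon_trans[OF t4(1) t5(1)] by (simp add: descent_def algebra_simps)
    ultimately show ?thesis by blast
  qed
  then obtain t5 where t5: "soon (14 * (3 * real s + 3) + 7) t3 t5" "Level (Suc r) \<in> known i (Suc t5)"
    by blast
  have st5: "started (Suc t5)" using started_mono[OF st3] le[OF t5(1)] by simp
  obtain t6 where t6: "soon 7 t5 t6"
    "spread (Suc t5) (Suc t6)"
    using phase[OF st5] by fast
  have "soon (7 + 7 + 7 + (14 * (3 * real s + 3) + 7) + 7) t t6"
    by (intro soon_trans[OF _ t6(1)] soon_trans[OF _ t5(1)] soon_trans[OF _ t3(1)] soon_trans[OF t1(1) t2(1)])
  then have "soon (42 * real s + 77) t t6" by (rule soon_le) simp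
  then show ?thesis using t6(2) i t5(2) by blast
qed

section \<open>From invocation to completion\<close>

lemma all_started:
  assumes "i \<in> G" "steps t i e"
  shows "\<exists>t'. soon 1 t t' \<and> started (Suc t')"
proof -
  have "\<exists>t'. soon 1 t t' \<and> (\<forall>l\<in>G. 3 \<le> rounds l (Suc t'))"
  proof (rule soon_common)
    fix l assume l: "l \<in> G"
    \<comment> \<open>Any event leaves its node in a real round; the request of \<open>i\<close> for
      such a round is itself an event at \<open>l\<close> once it arrives.\<close>
    have i: "3 \<le> rounds i (Suc t)" using started_if_step[OF assms(2)] .
    show "\<exists>t'. soon 1 t t' \<and> 3 \<le> rounds l (Suc t')"
    proof (cases "l = i")
      case True
      then show ?thesis using i soon_refl[of 1 t] by auto
    next
      case False
      then obtain t' where t': "soon 1 t t'" "prefix (outbox (S i (Suc t)) l) (inbox (S l (Suc t')) i)"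
        using delivery[OF assms(1) l] by metis
      have "requests (outbox (S i (Suc t)) l) \<noteq> []"
      proof
        assume "requests (outbox (S i (Suc t)) l) = []"
        then show False using i by (simp add: starts_requests[of i "Suc t" l])
      qed
      then have "outbox (S i (Suc t)) l \<noteq> []" by auto
      then have "inbox (S l (Suc t')) i \<noteq> []" using t'(2) by auto
      then show ?thesis using started_if_inbox t'(1) by blast
    qed
  next
    fix l t' t'' assume "3 \<le> rounds l (Suc t')" "t' \<le> (t'' :: nat)"
    then show "3 \<le> rounds l (Suc t'')" using rounds_mono[of "Suc t'" "Suc t''" l] by simp
  qed auto
  then show ?thesis by (auto simp: started_def)
qed

text \<open>
  A round that starts after a command is known to all nonfaulty nodes collects it from one of them,
  so only the agreements that faulty nodes have already opened by then can miss the command.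
\<close>

lemma Entry_contains_Op:
  assumes "Entry r j X \<in> known l t" "\<And>l. l < n \<Longrightarrow> Level r \<notin> known l t0"
    and "\<And>l. l \<in> G \<Longrightarrow> Op i m x \<in> known l t0"
  shows "(i, m) \<in> set X"
proof -
  obtain u A' A B where u: "round_ends u j A' A B" "Level r \<in> set A" "X = ops B"
    using Entry_origin[OF assms(1)] by blast
  have "A = starts (S j (round_start j u)) ! 0"
    using u(1) unfolding round_start(2) by (auto simp: round_ends_def)
  then have "Level r \<in> known j (round_start j u)" using u(2) hd_starts_subset by blast
  then have "\<not> round_start j u \<le> t0"
    using assms(2)[OF round_ends_Suc(1)[OF u(1)]] know_mono by blast
  then have t0: "t0 \<le> round_start j u" by simp
  have "A \<noteq> []" using u(2) by auto
  then obtain Q where Q: "Q \<subseteq> {..<n}" "n \<le> f + card Q" "\<forall>l\<in>Q. \<exists>s. replied j u A B l s"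
    using round_witnesses[OF u(1)] by blast
  obtain k where k: "k \<in> Q" "k \<in> G" using quorum_meets_G[OF Q(1,2)] by blast
  obtain s where s: "round_start j u \<le> s" "known k s \<subseteq> set B" using Q(3) k(1) by blast
  have "Op i m x \<in> known k s" using assms(3)[OF k(2)] know_mono[of t0 s k] t0 s(1) by auto
  then show ?thesis using s(2) unfolding u(3) set_ops by blast
qed

text \<open>Faulty nodes are at most one level ahead: level \<open>Suc r\<close> stems from an entry
  in agreement \<open>r\<close>, made at the end of a round that started with level \<open>r\<close>
  and told it to a quorum, which includes a nonfaulty node.\<close>

lemma G_knows_previous_level:
  assumes "Level (Suc r) \<in> known l t"
  shows "\<exists>k\<in>G. Level r \<in> known k t"
proof -
  obtain p es where "Val r p es \<in> known l t" using coherent_Level[OF coherent_know assms] by blast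
  note V = coherent_Val[OF coherent_know this]
  obtain j where "j \<in> set es" using V(2) by (cases es) auto
  then obtain X where "Entry r j X \<in> known l t" using V(3) by blast
  from Entry_origin[OF this] obtain u A' A B where u: "u < t" "round_ends u j A' A B" "Level r \<in> set A"
    by blast
  have "A \<noteq> []" using u(3) by auto
  then obtain Q where Q: "Q \<subseteq> {..<n}" "n \<le> f + card Q" "\<forall>l\<in>Q. \<exists>s. replied j u A B l s"
    using round_witnesses[OF u(2)] by blast
  obtain k where k: "k \<in> Q" "k \<in> G" using quorum_meets_G[OF Q(1,2)] by blast
  obtain s where s: "s \<le> Suc u" "set A \<subseteq> known k s" using Q(3) k(1) by blast
  then have "Level r \<in> known k t" using know_mono[of s t k] u(1,3) by auto
  then show ?thesis using k(2) by blast
qed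

lemma max_level:
  shows "\<exists>r. (\<exists>l<n. Level r \<in> known l t) \<and> (\<forall>l<n. \<forall>r'>r. Level r' \<notin> known l t)"
proof -
  let ?L = "{r. \<exists>l<n. Level r \<in> known l t}"
  have "?L = (\<Union>l\<in>{..<n}. Level -` known l t)" by auto
  moreover have "finite (Level -` known l t)" for l by (intro finite_vimageI) (auto simp: inj_def)
  ultimately have fin: "finite ?L" by simp
  moreover have "0 \<in> ?L" using several Level_0_know[of 0 t] by force
  ultimately have "Max ?L \<in> ?L" by (intro Max_in) blast+
  moreover have "r \<notin> ?L" if "Max ?L < r" for r using Max_ge[OF fin, of r] that by linarith
  ultimately show ?thesis by blast
qed

text \<open>Let \<open>r\<close> be the highest level open anywhere when all nonfaulty nodes have
  learned of the command. One phase later they all know level \<open>r - 1\<close>, and three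
  agreements lead them to level \<open>r + 2\<close>. This level rests on a view of agreement
  \<open>r + 1\<close>, whose entries all contain the command. The delays are
  \<open>1 + 7 + 7 + 3 * (42 * s + 77)\<close>.\<close>

lemma completes_soon:
  assumes a: "invoked E a = Some (i, x)" and i: "i \<in> G" and s: "card (faulty E) < (Suc s)\<^sup>2"
  shows "\<exists>t r. completes protocol E a t r \<and> time E t - time E a \<le> (126 * real s + 246) * D"
proof -
  have le: "a \<le> b" if "soon c a b" for a b c using that by (simp add: soon_def)
  define m where "m = length (own (S i a))"
  note st = invokedD(2)[OF a]
  obtain t0 where t0: "soon 1 a t0" "started (Suc t0)" using all_started[OF i st] by blast
  have "Op i m x \<in> set (know (absorb i (Invocation x) (S i a)))" by (simp add: m_def)
  moreover have "S i (Suc a) = step i (S i a) (Invocation x)" using steps_S[OF st, of i] by simp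
  ultimately have "Op i m x \<in> known i (Suc a)"
    by (cases rule: step_cases[of i "Invocation x" "S i a"]) auto
  then have op0: "Op i m x \<in> known i (Suc t0)" using know_mono[of "Suc a" "Suc t0" i] le[OF t0(1)] by auto
  obtain t1 where t1: "soon 7 t0 t1"
    "spread (Suc t0) (Suc t1)"
    using phase[OF t0(2)] by fast
  have st1: "started (Suc t1)" using started_mono[OF t0(2)] le[OF t1(1)] by simp
  have op1: "\<And>l. l \<in> G \<Longrightarrow> Op i m x \<in> known l (Suc t1)" using t1(2) i op0 by blast
  obtain t2 where t2: "soon 7 t1 t2"
    "spread (Suc t1) (Suc t2)"
    using phase[OF st1] by fast
  have st2: "started (Suc t2)" using started_mono[OF st1] le[OF t2(1)] by simp
  obtain r where r: "\<exists>l<n. Level r \<in> known l (Suc t1)" "\<And>l r'. l < n \<Longrightarrow> r < r' \<Longrightarrow> Level r' \<notin> known l (Suc t1)"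
    using max_level by blast
  have prev: "\<And>l. l \<in> G \<Longrightarrow> Level (r - 1) \<in> known l (Suc t2)"
  proof (cases r)
    case 0
    then show "\<And>l. l \<in> G \<Longrightarrow> Level (r - 1) \<in> known l (Suc t2)" using Level_0_know by simp
  next
    case (Suc r')
    then obtain k where k: "k \<in> G" "Level r' \<in> known k (Suc t1)" using r(1) G_knows_previous_level by blast
    fix l assume "l \<in> G"
    then show "Level (r - 1) \<in> known l (Suc t2)" using k t2(2) Suc by auto
  qed
  let ?c = "42 * real s + 77"
  obtain t3 where t3: "soon ?c t2 t3" "\<forall>l\<in>G. Level (Suc (r - 1)) \<in> known l (Suc t3)"
    using next_level[OF st2 prev s] by blast
  have st3: "started (Suc t3)" using started_mono[OF st2] le[OF t3(1)] by simp
  obtain t4 where t4: "soon ?c t3 t4" "\<forall>l\<in>G. Level (Suc (Suc (r - 1))) \<in> known l (Suc t4)"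
    using next_level[OF st3 _ s, of "Suc (r - 1)"] t3(2) by blast
  have st4: "started (Suc t4)" using started_mono[OF st3] le[OF t4(1)] by simp
  obtain t5 where t5: "soon ?c t4 t5" "\<forall>l\<in>G. Level (Suc (Suc (Suc (r - 1)))) \<in> known l (Suc t5)"
    using next_level[OF st4 _ s, of "Suc (Suc (r - 1))"] t4(2) by blast
  have total: "soon (1 + 7 + 7 + ?c + ?c + ?c) a t5"
    by (intro soon_trans[OF _ t5(1)] soon_trans[OF _ t4(1)] soon_trans[OF _ t3(1)] soon_trans[OF _ t2(1)]
        soon_trans[OF t0(1) t1(1)])
  \<comment> \<open>For \<open>r = 0\<close> the difference \<open>r - 1\<close> is cut off at 0,
    and the third agreement leads to level 3 instead of 2; levels are closed downwards.\<close>
  have "Level (Suc (Suc r)) \<in> known i (Suc t5)"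
    using t5(2) i coherent_Level_le[OF coherent_know, of "Suc (Suc (Suc (r - 1)))" i "Suc t5"
      "Suc (Suc r)"] by auto
  then obtain p es where V: "leaf p" "Val (Suc r) p es \<in> known i (Suc t5)"
    using coherent_Level[OF coherent_know] by blast
  obtain j where j: "j \<in> set es" using coherent_Val(2)[OF coherent_know V(2)] by (cases es) auto
  then obtain X where X: "Entry (Suc r) j X \<in> known i (Suc t5)"
    using coherent_Val(3)[OF coherent_know V(2)] by blast
  have "(i, m) \<in> set X"
    using Entry_contains_Op[OF X, of "Suc t1" i m x] r(2) op1 by blast
  then have "(i, m) \<in> set (view (Suc r) es (know (S i (Suc t5))))"
    unfolding set_view using X j by blast
  moreover have "view (Suc r) es (know (S i (Suc t5))) \<in> views_at i (Suc t5)"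
    using V several unfolding set_views by auto
  ultimately obtain t r' where "completes protocol E a t r'" "t \<le> t5"
    using completed_by[OF a i le[OF total]] unfolding m_def by blast
  moreover from this have "time E t \<le> time E t5" using time_mono by blast
  ultimately show ?thesis using total unfolding soon_def
    by (intro exI[of _ t] exI[of _ r']) (simp add: algebra_simps)
qed

end

context protocol_run
begin

lemma completes_at_once:
  assumes "n = 1" "invoked E a = Some (i, x)" "i \<in> G"
  shows "\<exists>r. completes protocol E a a r"
proof -
  note st = invokedD(2)[OF assms(2)]
  have "Op i (length (own (S i a))) x \<in> set (know (absorb i (Invocation x) (S i a)))" by simp
  moreover have "S i (Suc a) = step i (S i a) (Invocation x)" using steps_S[OF st, of i] by simp
  ultimately have "Op i (length (own (S i a))) x \<in> known i (Suc a)"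
    by (cases rule: step_cases[of i "Invocation x" "S i a"]) auto
  then have "(i, length (own (S i a))) \<in> set (ops (know (S i (Suc a))))" unfolding set_ops by blast
  moreover have "ops (know (S i (Suc a))) \<in> views_at i (Suc a)"
    unfolding set_views if_P[OF assms(1)] by simp
  ultimately obtain t r where t: "completes protocol E a t r" "t \<le> a"
    using completed_by[OF assms(2,3) order_refl] by blast
  then have "a \<le> t" using completesD by blast
  then show ?thesis using t by auto
qed

end

lemma ex_nat_sqrt: "\<exists>s :: nat. s\<^sup>2 \<le> k \<and> k < (Suc s)\<^sup>2"
proof (induction k)
  case 0
  then show ?case by (intro exI[of _ 0]) simp
next
  case (Suc k)
  then obtain s where s: "s\<^sup>2 \<le> k" "k < (Suc s)\<^sup>2" by blast
  show ?case
  proof (cases "Suc k < (Suc s)\<^sup>2")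
    case True
    then show ?thesis using s by (intro exI[of _ s]) simp
  next
    case False
    have "(Suc s)\<^sup>2 < (Suc (Suc s))\<^sup>2" by (simp add: power2_eq_square)
    then show ?thesis using False s(2) by (intro exI[of _ "Suc s"]) linarith
  qed
qed

lemma (in quorum_protocol) protocol_correct:
  assumes "2 * f < n" "update_query_state_machine M"
  shows "linearizable_implementation n f M protocol"
    "command_latency n f protocol (\<lambda>k. 372 * max 1 (sqrt (real k)))"
    "message_size_bound n f protocol (max 1)"
proof -
  have run: "protocol_run n f M E" if "is_execution n f protocol E" for E
    using that assms(1) by unfold_locales
  show "linearizable_implementation n f M protocol"
    unfolding linearizable_implementation_def using protocol_run.linearizable[OF run assms(2)] by blast
  show "message_size_bound n f protocol (max 1)"
    unfolding message_size_bound_def using protocol_run.message_size_le[OF run] by blast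
  show "command_latency n f protocol (\<lambda>k. 372 * max 1 (sqrt (real k)))"
    unfolding command_latency_def takes_message_delays_def
  proof (intro allI impI, elim conjE)
    fix E a i x and D :: real
    assume E: "is_execution n f protocol E" and a: "invoked E a = Some (i, x)" and i: "i \<notin> faulty E"
      and D: "0 \<le> D" "\<forall>d\<in>nonfaulty_delays protocol E. d \<le> D"
    interpret protocol_run n f M E by (rule run[OF E])
    have iG: "i \<in> G" using i invokedD(3)[OF a] by (simp add: G_def)
    show "\<exists>t r. completes protocol E a t r \<and> time E t - time E a \<le> 372 * max 1 (sqrt (real (card (faulty E)))) * D"
    proof (cases "n = 1")
      case True
      then show ?thesis using completes_at_once[OF True a iG] D(1)
        by (intro exI[of _ a]) auto
    next
      case False
      interpret timed_run n f M E D
        by unfold_locales (use D False assms(1) in auto)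
      obtain s where s: "s\<^sup>2 \<le> card (faulty E)" "card (faulty E) < (Suc s)\<^sup>2" using ex_nat_sqrt by blast
      have "(real s)\<^sup>2 \<le> real (card (faulty E))" using s(1) by (metis of_nat_le_iff of_nat_power)
      then have "real s \<le> sqrt (real (card (faulty E)))" by (rule real_le_rsqrt)
      then have "real s \<le> max 1 (sqrt (real (card (faulty E))))" by simp
      \<comment> \<open>\<open>372 = 126 + 246\<close>; the maximum with 1 dominates the constant
        term even if no node crashes.\<close>
      then have "126 * real s + 246 \<le> 372 * max 1 (sqrt (real (card (faulty E))))"
        using max.cobounded1[of 1 "sqrt (real (card (faulty E)))"] by linarith
      then have "(126 * real s + 246) * D \<le> 372 * max 1 (sqrt (real (card (faulty E)))) * D"
        using D(1) by (rule mult_right_mono)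
      then show ?thesis using completes_soon[OF a iG s(2)] by force
    qed
  qed
qed

theorem theorem33:
  shows "\<exists>(C :: real) (B :: nat \<Rightarrow> nat).
    \<forall>(n :: nat) (f :: nat) (M :: ('s, 'u, 'q, 'r) state_machine).
      2 * f < n \<and> update_query_state_machine M \<longrightarrow>
      (\<exists>P :: ('u, 'q, 'r) protocol.
         linearizable_implementation n f M P \<and>
         command_latency n f P (\<lambda>k. C * max 1 (sqrt (real k))) \<and>
         message_size_bound n f P B)"
  using quorum_protocol.protocol_correct by blast

end
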